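(* Let $C$ be an SP-domain which is not a Dedekind domain, let $M=qC$ be a principal maximal ideal of $C$, and let $D$ be a DVR with quotient field $C/M$. Let $\pi:C\rightarrow C/M$ be the canonical map, and assume that there exists a unit $p$ of $C$ such that $\pi(p)$ generates the maximal ideal of $D$. Then the pull-back domain $A=\pi^{-1}(D)$ is a two-dimensional ISP-domain which is not h-local.
   Context: All rings are commutative and unitary; "ideal" of a domain means integral ideal; dimension means Krull dimension. DVR means rank one discrete valuation domain. A domain is an SP-domain if every ideal of it is a (finite) product of radical ideals. Fields are counted as (trivial) Dedekind domains, so $C$ is not a field. A domain $A$ is an ISP-domain (invertible semiprime domain) if every proper nonzero ideal $I$ of $A$ can be written as $I=JQ_1\cdots Q_n$ where $n\geq 1$, $J$ is an invertible ideal of $A$ and each $Q_i$ is a proper radical ideal of $A$. A domain $A$ is h-local if $A/I$ has a unique maximal ideal for each nonzero prime ideal $I$ of $A$ and $A/I$ has only finitely many maximal ideals for each nonzero ideal $I$ of $A$. *)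

theory Defs
  imports "HOL-Algebra.Algebra" "HOL-Library.Extended_Nat"
begin

section \<open>Radical ideals, products of ideals, dimension\<close>

definition radical :: "('a, 'b) ring_scheme \<Rightarrow> 'a set \<Rightarrow> 'a set" where
  "radical R I = {x \<in> carrier R. \<exists>n::nat. n \<ge> 1 \<and> x [^]\<^bsub>R\<^esub> n \<in> I}"

definition radical_ideal :: "'a set \<Rightarrow> ('a, 'b) ring_scheme \<Rightarrow> bool" where
  "radical_ideal I R \<longleftrightarrow> ideal I R \<and> radical R I = I"

text \<open>The product of a finite list of ideals; the empty product is the unit ideal.\<close>

definition ideal_prod_list :: "('a, 'b) ring_scheme \<Rightarrow> 'a set list \<Rightarrow> 'a set" where
  "ideal_prod_list R Is = foldr (ideal_prod R) Is (carrier R)"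

text \<open>Supremum of the lengths \<open>n\<close> of chains \<open>P 0 \<subset> \<dots> \<subset> P n\<close> of prime ideals.\<close>

definition krull_dim :: "('a, 'b) ring_scheme \<Rightarrow> enat" where
  "krull_dim R = Sup {enat n | n. \<exists>P :: nat \<Rightarrow> 'a set.
     (\<forall>i\<le>n. primeideal (P i) R) \<and> (\<forall>i<n. P i \<subset> P (Suc i))}"


section \<open>The quotient field and invertible ideals\<close>

definition frac_rel :: "('a, 'b) ring_scheme \<Rightarrow> (('a \<times> 'a) \<times> ('a \<times> 'a)) set" where
  "frac_rel R = {((a, b), (c, d)). a \<in> carrier R \<and> b \<in> carrier R - {\<zero>\<^bsub>R\<^esub>} \<and>
     c \<in> carrier R \<and> d \<in> carrier R - {\<zero>\<^bsub>R\<^esub>} \<and> a \<otimes>\<^bsub>R\<^esub> d = c \<otimes>\<^bsub>R\<^esub> b}"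

definition frac_class :: "('a, 'b) ring_scheme \<Rightarrow> 'a \<Rightarrow> 'a \<Rightarrow> ('a \<times> 'a) set" where
  "frac_class R a b = frac_rel R `` {(a, b)}"

text \<open>In the operations below the unions range over all representatives; over a domain all
  members of such a union coincide, see \<open>quotient_field_mult\<close> and \<open>quotient_field_add\<close>.\<close>

definition quotient_field :: "('a, 'b) ring_scheme \<Rightarrow> ('a \<times> 'a) set ring" where
  "quotient_field R =
    \<lparr>carrier = {frac_class R a b | a b. a \<in> carrier R \<and> b \<in> carrier R - {\<zero>\<^bsub>R\<^esub>}},
     monoid.mult = (\<lambda>U V. \<Union>{frac_class R (a \<otimes>\<^bsub>R\<^esub> c) (b \<otimes>\<^bsub>R\<^esub> d) | a b c d.
              (a, b) \<in> U \<and> (c, d) \<in> V}),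
     monoid.one = frac_class R \<one>\<^bsub>R\<^esub> \<one>\<^bsub>R\<^esub>,
     ring.zero = frac_class R \<zero>\<^bsub>R\<^esub> \<one>\<^bsub>R\<^esub>,
     ring.add = (\<lambda>U V. \<Union>{frac_class R (a \<otimes>\<^bsub>R\<^esub> d \<oplus>\<^bsub>R\<^esub> c \<otimes>\<^bsub>R\<^esub> b) (b \<otimes>\<^bsub>R\<^esub> d) | a b c d.
              (a, b) \<in> U \<and> (c, d) \<in> V})\<rparr>"

definition frac_embed :: "('a, 'b) ring_scheme \<Rightarrow> 'a \<Rightarrow> ('a \<times> 'a) set" where
  "frac_embed R a = frac_class R a \<one>\<^bsub>R\<^esub>"

text \<open>Fractional ideals: the \<open>R\<close>-submodules \<open>F\<close> of the quotient field with
  \<open>d F \<subseteq> R\<close> for some nonzero \<open>d\<close> in \<open>R\<close>.\<close>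

definition fractional_ideal :: "('a \<times> 'a) set set \<Rightarrow> ('a, 'b) ring_scheme \<Rightarrow> bool" where
  "fractional_ideal F R \<longleftrightarrow>
     additive_subgroup F (quotient_field R) \<and>
     (\<forall>r\<in>carrier R. \<forall>x\<in>F. frac_embed R r \<otimes>\<^bsub>quotient_field R\<^esub> x \<in> F) \<and>
     (\<exists>d\<in>carrier R - {\<zero>\<^bsub>R\<^esub>}. \<forall>x\<in>F.
        frac_embed R d \<otimes>\<^bsub>quotient_field R\<^esub> x \<in> frac_embed R ` carrier R)"

text \<open>Here \<open>ideal_prod\<close> is used for subsets of the quotient field: it yields the set of
  finite nonempty sums of products.\<close>

definition invertible_ideal :: "'a set \<Rightarrow> ('a, 'b) ring_scheme \<Rightarrow> bool" where
  "invertible_ideal I R \<longleftrightarrow> ideal I R \<and>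
     (\<exists>F. fractional_ideal F R \<and>
          ideal_prod (quotient_field R) (frac_embed R ` I) F = frac_embed R ` carrier R)"


section \<open>Classes of domains\<close>

definition sp_domain :: "('a, 'b) ring_scheme \<Rightarrow> bool" where
  "sp_domain R \<longleftrightarrow> domain R \<and>
     (\<forall>I. ideal I R \<longrightarrow>
        (\<exists>Qs. (\<forall>Q\<in>set Qs. radical_ideal Q R) \<and> I = ideal_prod_list R Qs))"

text \<open>The ideal-theoretic definition of Dedekind domains (Zariski--Samuel, Gilmer).
  Fields satisfy it.\<close>

definition dedekind_domain :: "('a, 'b) ring_scheme \<Rightarrow> bool" where
  "dedekind_domain R \<longleftrightarrow> domain R \<and>
     (\<forall>I. ideal I R \<longrightarrow>
        (\<exists>Ps. (\<forall>P\<in>set Ps. primeideal P R) \<and> I = ideal_prod_list R Ps))"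

definition isp_domain :: "('a, 'b) ring_scheme \<Rightarrow> bool" where
  "isp_domain R \<longleftrightarrow> domain R \<and>
     (\<forall>I. ideal I R \<and> I \<noteq> {\<zero>\<^bsub>R\<^esub>} \<and> I \<noteq> carrier R \<longrightarrow>
        (\<exists>J Qs. invertible_ideal J R \<and> length Qs \<ge> 1 \<and>
           (\<forall>Q\<in>set Qs. radical_ideal Q R \<and> Q \<noteq> carrier R) \<and>
           I = ideal_prod R J (ideal_prod_list R Qs)))"

definition h_local :: "('a, 'b) ring_scheme \<Rightarrow> bool" where
  "h_local R \<longleftrightarrow> domain R \<and>
     (\<forall>I. primeideal I R \<and> I \<noteq> {\<zero>\<^bsub>R\<^esub>} \<longrightarrow> (\<exists>!N. maximalideal N (R Quot I))) \<and>
     (\<forall>I. ideal I R \<and> I \<noteq> {\<zero>\<^bsub>R\<^esub>} \<longrightarrow> finite {N. maximalideal N (R Quot I)})"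


section \<open>Rank one discrete valuation domains\<close>

text \<open>A discrete valuation of rank one on a field, normalized to have value group \<open>\<int>\<close>.
  The value at zero, conventionally infinite, is left unspecified.\<close>

definition discrete_valuation :: "('k, 'b) ring_scheme \<Rightarrow> ('k \<Rightarrow> int) \<Rightarrow> bool" where
  "discrete_valuation K v \<longleftrightarrow> field K \<and>
     v ` (carrier K - {\<zero>\<^bsub>K\<^esub>}) = UNIV \<and>
     (\<forall>x\<in>carrier K - {\<zero>\<^bsub>K\<^esub>}. \<forall>y\<in>carrier K - {\<zero>\<^bsub>K\<^esub>}.
        v (x \<otimes>\<^bsub>K\<^esub> y) = v x + v y \<and>
        (x \<oplus>\<^bsub>K\<^esub> y \<noteq> \<zero>\<^bsub>K\<^esub> \<longrightarrow> v (x \<oplus>\<^bsub>K\<^esub> y) \<ge> min (v x) (v y)))"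

text \<open>\<open>dvr_of_field D K\<close>: the subset \<open>D\<close> of \<open>K\<close> is a rank one discrete valuation domain
  with quotient field \<open>K\<close>. The last part is automatic, see \<open>dvr_of_field_quotients\<close>.\<close>

definition dvr_of_field :: "'k set \<Rightarrow> ('k, 'b) ring_scheme \<Rightarrow> bool" where
  "dvr_of_field D K \<longleftrightarrow>
     (\<exists>v. discrete_valuation K v \<and> D = {x \<in> carrier K. x = \<zero>\<^bsub>K\<^esub> \<or> v x \<ge> 0})"


section \<open>Pull-backs\<close>

text \<open>The preimage of \<open>D\<close> under the canonical map from \<open>C\<close> to \<open>C Quot M\<close>, which sends
  \<open>x\<close> to its coset.\<close>

definition pullback :: "('a, 'b) ring_scheme \<Rightarrow> 'a set \<Rightarrow> 'a set set \<Rightarrow> ('a, 'b) ring_scheme" where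
  "pullback C M D = C\<lparr>carrier := {x \<in> carrier C. M +>\<^bsub>C\<^esub> x \<in> D}\<rparr>"


section \<open>Basic properties\<close>

context domain
begin

lemma frac_rel_equiv:
  "equiv {(a, b). a \<in> carrier R \<and> b \<in> carrier R - {\<zero>}} (frac_rel R)"
proof (rule equivI)
  show "frac_rel R \<subseteq> {(a, b). a \<in> carrier R \<and> b \<in> carrier R - {\<zero>}} \<times>
      {(a, b). a \<in> carrier R \<and> b \<in> carrier R - {\<zero>}}"
    by (auto simp: frac_rel_def)
  show "refl_on {(a, b). a \<in> carrier R \<and> b \<in> carrier R - {\<zero>}} (frac_rel R)"
    by (auto simp: frac_rel_def refl_on_def)
  show "sym (frac_rel R)"
    by (auto simp: frac_rel_def sym_def)
  show "trans (frac_rel R)"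
  proof (rule transI)
    fix x y z assume "(x, y) \<in> frac_rel R" "(y, z) \<in> frac_rel R"
    then obtain a b c d e f where
      xyz: "x = (a, b)" "y = (c, d)" "z = (e, f)" and
      m: "a \<in> carrier R" "b \<in> carrier R - {\<zero>}" "c \<in> carrier R" "d \<in> carrier R - {\<zero>}"
        "e \<in> carrier R" "f \<in> carrier R - {\<zero>}" and
      eq: "a \<otimes> d = c \<otimes> b" "c \<otimes> f = e \<otimes> d"
      by (auto simp: frac_rel_def)
    have "d \<otimes> (a \<otimes> f) = (a \<otimes> d) \<otimes> f" using m by (simp add: m_ac)
    also have "\<dots> = (c \<otimes> f) \<otimes> b" using m by (simp add: eq(1) m_ac)
    also have "\<dots> = d \<otimes> (e \<otimes> b)" using m by (simp add: eq(2) m_ac)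
    finally have "a \<otimes> f = e \<otimes> b" using m by (simp add: m_lcancel)
    then show "(x, z) \<in> frac_rel R" using m xyz by (auto simp: frac_rel_def)
  qed
qed

lemma frac_class_eq_iff:
  assumes "a \<in> carrier R" "b \<in> carrier R - {\<zero>}" "c \<in> carrier R" "d \<in> carrier R - {\<zero>}"
  shows "frac_class R a b = frac_class R c d \<longleftrightarrow> a \<otimes> d = c \<otimes> b"
proof -
  have "frac_class R a b = frac_class R c d \<longleftrightarrow> ((a, b), (c, d)) \<in> frac_rel R"
    unfolding frac_class_def using assms by (intro eq_equiv_class_iff[OF frac_rel_equiv]) auto
  then show ?thesis using assms by (auto simp: frac_rel_def)
qed

lemma mem_frac_class_iff:
  assumes "a \<in> carrier R" "b \<in> carrier R - {\<zero>}"
  shows "(c, d) \<in> frac_class R a b \<longleftrightarrow> c \<in> carrier R \<and> d \<in> carrier R - {\<zero>} \<and> a \<otimes> d = c \<otimes> b"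
  using assms by (auto simp: frac_class_def frac_rel_def)

lemma quotient_field_mult:
  assumes m: "a \<in> carrier R" "b \<in> carrier R - {\<zero>}" "c \<in> carrier R" "d \<in> carrier R - {\<zero>}"
  shows "frac_class R a b \<otimes>\<^bsub>quotient_field R\<^esub> frac_class R c d = frac_class R (a \<otimes> c) (b \<otimes> d)"
proof -
  have *: "frac_class R (a' \<otimes> c') (b' \<otimes> d') = frac_class R (a \<otimes> c) (b \<otimes> d)"
    if "(a', b') \<in> frac_class R a b" "(c', d') \<in> frac_class R c d" for a' b' c' d'
  proof -
    have n: "a' \<in> carrier R" "b' \<in> carrier R - {\<zero>}" "c' \<in> carrier R" "d' \<in> carrier R - {\<zero>}"
      and e: "a \<otimes> b' = a' \<otimes> b" "c \<otimes> d' = c' \<otimes> d"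
      using that m by (auto simp: mem_frac_class_iff)
    have "(a' \<otimes> c') \<otimes> (b \<otimes> d) = (a' \<otimes> b) \<otimes> (c' \<otimes> d)" using m n by (simp add: m_ac)
    also have "\<dots> = (a \<otimes> b') \<otimes> (c \<otimes> d')" by (simp only: e)
    also have "\<dots> = (a \<otimes> c) \<otimes> (b' \<otimes> d')" using m n by (simp add: m_ac)
    finally show ?thesis using m n by (subst frac_class_eq_iff) (auto simp: integral_iff)
  qed
  have "(a, b) \<in> frac_class R a b" "(c, d) \<in> frac_class R c d" using m by (auto simp: mem_frac_class_iff)
  then have "frac_class R (a \<otimes> c) (b \<otimes> d) \<in> {frac_class R (a' \<otimes> c') (b' \<otimes> d') | a' b' c' d'.
      (a', b') \<in> frac_class R a b \<and> (c', d') \<in> frac_class R c d}" (is "?t \<in> ?S")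
    by blast
  moreover have "?S \<subseteq> {?t}" using * by auto
  ultimately have "?S = {?t}" by blast
  then show ?thesis by (simp add: quotient_field_def)
qed

lemma quotient_field_add:
  assumes m: "a \<in> carrier R" "b \<in> carrier R - {\<zero>}" "c \<in> carrier R" "d \<in> carrier R - {\<zero>}"
  shows "frac_class R a b \<oplus>\<^bsub>quotient_field R\<^esub> frac_class R c d =
    frac_class R (a \<otimes> d \<oplus> c \<otimes> b) (b \<otimes> d)"
proof -
  have *: "frac_class R (a' \<otimes> d' \<oplus> c' \<otimes> b') (b' \<otimes> d') = frac_class R (a \<otimes> d \<oplus> c \<otimes> b) (b \<otimes> d)"
    if "(a', b') \<in> frac_class R a b" "(c', d') \<in> frac_class R c d" for a' b' c' d'
  proof -
    have n: "a' \<in> carrier R" "b' \<in> carrier R - {\<zero>}" "c' \<in> carrier R" "d' \<in> carrier R - {\<zero>}"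
      and e: "a \<otimes> b' = a' \<otimes> b" "c \<otimes> d' = c' \<otimes> d"
      using that m by (auto simp: mem_frac_class_iff)
    have "(a' \<otimes> d' \<oplus> c' \<otimes> b') \<otimes> (b \<otimes> d) =
        (a' \<otimes> b) \<otimes> (d' \<otimes> d) \<oplus> (c' \<otimes> d) \<otimes> (b' \<otimes> b)"
      using m n by (simp add: l_distr r_distr m_ac)
    also have "\<dots> = (a \<otimes> b') \<otimes> (d' \<otimes> d) \<oplus> (c \<otimes> d') \<otimes> (b' \<otimes> b)" by (simp only: e)
    also have "\<dots> = (a \<otimes> d \<oplus> c \<otimes> b) \<otimes> (b' \<otimes> d')" using m n by (simp add: l_distr r_distr m_ac)
    finally show ?thesis using m n by (subst frac_class_eq_iff) (auto simp: integral_iff)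
  qed
  have "(a, b) \<in> frac_class R a b" "(c, d) \<in> frac_class R c d" using m by (auto simp: mem_frac_class_iff)
  then have "frac_class R (a \<otimes> d \<oplus> c \<otimes> b) (b \<otimes> d) \<in> {frac_class R (a' \<otimes> d' \<oplus> c' \<otimes> b') (b' \<otimes> d') | a' b' c' d'.
      (a', b') \<in> frac_class R a b \<and> (c', d') \<in> frac_class R c d}" (is "?t \<in> ?S")
    by blast
  moreover have "?S \<subseteq> {?t}" using * by auto
  ultimately have "?S = {?t}" by blast
  then show ?thesis by (simp add: quotient_field_def)
qed

lemma quotient_field_simps:
  "carrier (quotient_field R) = {frac_class R a b | a b. a \<in> carrier R \<and> b \<in> carrier R - {\<zero>}}"
  "\<one>\<^bsub>quotient_field R\<^esub> = frac_class R \<one> \<one>"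
  "\<zero>\<^bsub>quotient_field R\<^esub> = frac_class R \<zero> \<one>"
  by (simp_all add: quotient_field_def)

lemma quotient_field_cring: "cring (quotient_field R)"
proof (rule cringI)
  show "abelian_group (quotient_field R)"
  proof (rule abelian_groupI)
    fix x assume "x \<in> carrier (quotient_field R)"
    then obtain a b where x: "x = frac_class R a b" and m: "a \<in> carrier R" "b \<in> carrier R - {\<zero>}"
      by (auto simp: quotient_field_simps)
    have "\<ominus> a \<otimes> b \<oplus> a \<otimes> b = \<zero>" using m by (simp add: l_minus l_neg)
    then have "frac_class R (\<ominus> a) b \<oplus>\<^bsub>quotient_field R\<^esub> x = \<zero>\<^bsub>quotient_field R\<^esub>"
      using m by (simp add: x quotient_field_add quotient_field_simps frac_class_eq_iff integral_iff)
    moreover have "frac_class R (\<ominus> a) b \<in> carrier (quotient_field R)"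
      unfolding quotient_field_simps using m by blast
    ultimately show "\<exists>y\<in>carrier (quotient_field R).
        y \<oplus>\<^bsub>quotient_field R\<^esub> x = \<zero>\<^bsub>quotient_field R\<^esub>" by blast
  next
    fix x y assume "x \<in> carrier (quotient_field R)" "y \<in> carrier (quotient_field R)"
    then obtain a b c d where xy: "x = frac_class R a b" "y = frac_class R c d" and
      m: "a \<in> carrier R" "b \<in> carrier R - {\<zero>}" "c \<in> carrier R" "d \<in> carrier R - {\<zero>}"
      by (auto simp: quotient_field_simps)
    have "a \<otimes> d \<oplus> c \<otimes> b \<in> carrier R" "b \<otimes> d \<in> carrier R - {\<zero>}"
      using m by (auto simp: integral_iff)
    then show "x \<oplus>\<^bsub>quotient_field R\<^esub> y \<in> carrier (quotient_field R)"
      unfolding xy quotient_field_add[OF m] quotient_field_simps by blast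
    show "x \<oplus>\<^bsub>quotient_field R\<^esub> y = y \<oplus>\<^bsub>quotient_field R\<^esub> x"
      using m by (simp add: xy quotient_field_add a_comm m_comm)
  next
    fix x y z assume "x \<in> carrier (quotient_field R)" "y \<in> carrier (quotient_field R)"
      "z \<in> carrier (quotient_field R)"
    then obtain a b c d e f where xyz: "x = frac_class R a b" "y = frac_class R c d" "z = frac_class R e f" and
      m: "a \<in> carrier R" "b \<in> carrier R - {\<zero>}" "c \<in> carrier R" "d \<in> carrier R - {\<zero>}"
        "e \<in> carrier R" "f \<in> carrier R - {\<zero>}"
      by (auto simp: quotient_field_simps)
    then show "x \<oplus>\<^bsub>quotient_field R\<^esub> y \<oplus>\<^bsub>quotient_field R\<^esub> z =
        x \<oplus>\<^bsub>quotient_field R\<^esub> (y \<oplus>\<^bsub>quotient_field R\<^esub> z)"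
      by (simp add: quotient_field_add integral_iff l_distr r_distr m_ac a_ac)
  next
    fix x assume "x \<in> carrier (quotient_field R)"
    then show "\<zero>\<^bsub>quotient_field R\<^esub> \<oplus>\<^bsub>quotient_field R\<^esub> x = x"
      by (auto simp: quotient_field_simps quotient_field_add)
  next
    show "\<zero>\<^bsub>quotient_field R\<^esub> \<in> carrier (quotient_field R)"
      unfolding quotient_field_simps using one_not_zero by blast
  qed
  show "comm_monoid (quotient_field R)"
  proof (rule comm_monoidI)
    fix x y assume "x \<in> carrier (quotient_field R)" "y \<in> carrier (quotient_field R)"
    then obtain a b c d where xy: "x = frac_class R a b" "y = frac_class R c d" and
      m: "a \<in> carrier R" "b \<in> carrier R - {\<zero>}" "c \<in> carrier R" "d \<in> carrier R - {\<zero>}"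
      by (auto simp: quotient_field_simps)
    have "a \<otimes> c \<in> carrier R" "b \<otimes> d \<in> carrier R - {\<zero>}"
      using m by (auto simp: integral_iff)
    then show "x \<otimes>\<^bsub>quotient_field R\<^esub> y \<in> carrier (quotient_field R)"
      unfolding xy quotient_field_mult[OF m] quotient_field_simps by blast
    show "x \<otimes>\<^bsub>quotient_field R\<^esub> y = y \<otimes>\<^bsub>quotient_field R\<^esub> x"
      using m by (simp add: xy quotient_field_mult m_comm)
  next
    fix x y z assume "x \<in> carrier (quotient_field R)" "y \<in> carrier (quotient_field R)"
      "z \<in> carrier (quotient_field R)"
    then show "x \<otimes>\<^bsub>quotient_field R\<^esub> y \<otimes>\<^bsub>quotient_field R\<^esub> z =
        x \<otimes>\<^bsub>quotient_field R\<^esub> (y \<otimes>\<^bsub>quotient_field R\<^esub> z)"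
      by (auto simp: quotient_field_simps quotient_field_mult integral_iff m_ac)
  next
    fix x assume "x \<in> carrier (quotient_field R)"
    then show "\<one>\<^bsub>quotient_field R\<^esub> \<otimes>\<^bsub>quotient_field R\<^esub> x = x"
      by (auto simp: quotient_field_simps quotient_field_mult)
  next
    show "\<one>\<^bsub>quotient_field R\<^esub> \<in> carrier (quotient_field R)"
      unfolding quotient_field_simps using one_not_zero by blast
  qed
  fix x y z assume "x \<in> carrier (quotient_field R)" "y \<in> carrier (quotient_field R)"
    "z \<in> carrier (quotient_field R)"
  then obtain a b c d e f where xyz: "x = frac_class R a b" "y = frac_class R c d" "z = frac_class R e f" and
    m: "a \<in> carrier R" "b \<in> carrier R - {\<zero>}" "c \<in> carrier R" "d \<in> carrier R - {\<zero>}"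
      "e \<in> carrier R" "f \<in> carrier R - {\<zero>}"
    by (auto simp: quotient_field_simps)
  then show "(x \<oplus>\<^bsub>quotient_field R\<^esub> y) \<otimes>\<^bsub>quotient_field R\<^esub> z =
      x \<otimes>\<^bsub>quotient_field R\<^esub> z \<oplus>\<^bsub>quotient_field R\<^esub> y \<otimes>\<^bsub>quotient_field R\<^esub> z"
    by (simp add: quotient_field_add quotient_field_mult integral_iff frac_class_eq_iff
        l_distr r_distr m_ac a_ac)
qed

lemma quotient_field_field: "field (quotient_field R)"
proof (rule cring.cring_fieldI2[OF quotient_field_cring])
  show "\<zero>\<^bsub>quotient_field R\<^esub> \<noteq> \<one>\<^bsub>quotient_field R\<^esub>"
    by (simp add: quotient_field_simps frac_class_eq_iff)
  fix x assume "x \<in> carrier (quotient_field R)" and nz: "x \<noteq> \<zero>\<^bsub>quotient_field R\<^esub>"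
  then obtain a b where x: "x = frac_class R a b" and m: "a \<in> carrier R" "b \<in> carrier R - {\<zero>}"
    by (auto simp: quotient_field_simps)
  have a: "a \<in> carrier R - {\<zero>}"
    using nz m by (auto simp: x quotient_field_simps frac_class_eq_iff)
  have "x \<otimes>\<^bsub>quotient_field R\<^esub> frac_class R b a = \<one>\<^bsub>quotient_field R\<^esub>"
    using m a by (simp add: x quotient_field_mult quotient_field_simps frac_class_eq_iff
        integral_iff m_comm)
  moreover have "frac_class R b a \<in> carrier (quotient_field R)"
    unfolding quotient_field_simps using m a by blast
  ultimately show "\<exists>y\<in>carrier (quotient_field R).
      x \<otimes>\<^bsub>quotient_field R\<^esub> y = \<one>\<^bsub>quotient_field R\<^esub>" by blast
qed

lemma frac_embed_hom: "frac_embed R \<in> ring_hom R (quotient_field R)"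
proof (rule ring_hom_memI)
  fix a assume "a \<in> carrier R"
  then show "frac_embed R a \<in> carrier (quotient_field R)"
    unfolding quotient_field_simps frac_embed_def using one_not_zero by blast
qed (simp_all add: frac_embed_def quotient_field_simps quotient_field_mult quotient_field_add)

lemma frac_embed_inj: "inj_on (frac_embed R) (carrier R)"
  by (auto simp: inj_on_def frac_embed_def frac_class_eq_iff)

end

lemma dvr_of_field_subring:
  assumes "dvr_of_field D K"
  shows "subring D K"
proof -
  obtain v where dv: "discrete_valuation K v" and
    D: "D = {x \<in> carrier K. x = \<zero>\<^bsub>K\<^esub> \<or> v x \<ge> 0}"
    using assms unfolding dvr_of_field_def by blast
  have K: "field K" using dv by (simp add: discrete_valuation_def)
  have v: "v (x \<otimes>\<^bsub>K\<^esub> y) = v x + v y"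
    if "x \<in> carrier K - {\<zero>\<^bsub>K\<^esub>}" "y \<in> carrier K - {\<zero>\<^bsub>K\<^esub>}" for x y
    using dv that by (simp add: discrete_valuation_def)
  have v2: "v (x \<oplus>\<^bsub>K\<^esub> y) \<ge> min (v x) (v y)"
    if "x \<in> carrier K - {\<zero>\<^bsub>K\<^esub>}" "y \<in> carrier K - {\<zero>\<^bsub>K\<^esub>}" "x \<oplus>\<^bsub>K\<^esub> y \<noteq> \<zero>\<^bsub>K\<^esub>" for x y
    using dv that unfolding discrete_valuation_def by blast
  interpret K: field K by (rule K)
  have v1: "v \<one>\<^bsub>K\<^esub> = 0" using v[of "\<one>\<^bsub>K\<^esub>" "\<one>\<^bsub>K\<^esub>"] by simp
  have "\<ominus>\<^bsub>K\<^esub> \<one>\<^bsub>K\<^esub> \<noteq> \<zero>\<^bsub>K\<^esub>" using K.one_not_zero K.minus_minus[OF K.one_closed] by force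
  then have "v (\<ominus>\<^bsub>K\<^esub> \<one>\<^bsub>K\<^esub>) + v (\<ominus>\<^bsub>K\<^esub> \<one>\<^bsub>K\<^esub>) = 0"
    using v[of "\<ominus>\<^bsub>K\<^esub> \<one>\<^bsub>K\<^esub>" "\<ominus>\<^bsub>K\<^esub> \<one>\<^bsub>K\<^esub>"] v1 by (simp add: K.l_minus)
  then have vm1: "v (\<ominus>\<^bsub>K\<^esub> \<one>\<^bsub>K\<^esub>) = 0" by simp
  have mult: "x \<otimes>\<^bsub>K\<^esub> y \<in> D" if "x \<in> D" "y \<in> D" for x y
    using that v[of x y] by (cases "x = \<zero>\<^bsub>K\<^esub>"; cases "y = \<zero>\<^bsub>K\<^esub>") (auto simp: D)
  have neg: "\<ominus>\<^bsub>K\<^esub> x \<in> D" if "x \<in> D" for x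
  proof -
    have "\<ominus>\<^bsub>K\<^esub> \<one>\<^bsub>K\<^esub> \<otimes>\<^bsub>K\<^esub> x \<in> D" using that vm1 by (intro mult) (auto simp: D)
    then show ?thesis using that by (simp add: D K.l_minus)
  qed
  have add: "x \<oplus>\<^bsub>K\<^esub> y \<in> D" if "x \<in> D" "y \<in> D" for x y
    using that v2[of x y] by (cases "x = \<zero>\<^bsub>K\<^esub>"; cases "y = \<zero>\<^bsub>K\<^esub>") (auto simp: D)
  show ?thesis
    using v1 mult neg add by (intro K.subringI) (auto simp: D)
qed

lemma dvr_of_field_quotients:
  assumes "dvr_of_field D K" and x: "x \<in> carrier K"
  shows "\<exists>a\<in>D. \<exists>b\<in>D - {\<zero>\<^bsub>K\<^esub>}. x = a \<otimes>\<^bsub>K\<^esub> inv\<^bsub>K\<^esub> b"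
proof -
  obtain v where dv: "discrete_valuation K v" and
    D: "D = {x \<in> carrier K. x = \<zero>\<^bsub>K\<^esub> \<or> v x \<ge> 0}"
    using assms unfolding dvr_of_field_def by blast
  have K: "field K" using dv by (simp add: discrete_valuation_def)
  have v: "v (x \<otimes>\<^bsub>K\<^esub> y) = v x + v y"
    if "x \<in> carrier K - {\<zero>\<^bsub>K\<^esub>}" "y \<in> carrier K - {\<zero>\<^bsub>K\<^esub>}" for x y
    using dv that by (simp add: discrete_valuation_def)
  interpret K: field K by (rule K)
  have v1: "v \<one>\<^bsub>K\<^esub> = 0" using v[of "\<one>\<^bsub>K\<^esub>" "\<one>\<^bsub>K\<^esub>"] by simp
  show ?thesis
  proof (cases "x \<in> D")
    case True
    then show ?thesis using x v1 by (intro bexI[of _ x] bexI[of _ "\<one>\<^bsub>K\<^esub>"]) (auto simp: D)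
  next
    case False
    then have u: "x \<in> Units K" and n: "x \<noteq> \<zero>\<^bsub>K\<^esub>" "v x < 0" using x by (auto simp: D K.field_Units)
    have i: "inv\<^bsub>K\<^esub> x \<in> carrier K - {\<zero>\<^bsub>K\<^esub>}" using u K.Units_inv_Units K.field_Units by blast
    have "v (inv\<^bsub>K\<^esub> x) = - v x" using v[of x "inv\<^bsub>K\<^esub> x"] i x n u v1 by simp
    then show ?thesis using n i u x v1
      by (intro bexI[of _ "\<one>\<^bsub>K\<^esub>"] bexI[of _ "inv\<^bsub>K\<^esub> x"]) (auto simp: D K.Units_inv_inv)
  qed
qed

end

theory Submission
  imports Defs
begin

text \<open>
  Nonzero primes of an SP-domain are maximal. Otherwise there are adjacent primes \<open>P \<subset> Q\<close> such that
  \<open>P R\<^sub>P\<close> is generated by some \<open>a \<in> P\<close> and, locally at \<open>Q\<close>, \<open>Q = P + (u)\<close>. An ideal with radical \<open>Q\<close> is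
  locally a power of \<open>Q\<close>; for \<open>P + (u\<^sup>2)\<close> the exponent is at least 2, so \<open>P \<subseteq> Q\<^sup>2\<close> and hence \<open>P = PQ\<close>
  locally. Exactly one radical factor of \<open>P\<^sup>2 + (ua)\<close> equals \<open>P\<close> and the others are locally \<open>Q\<close>, so
  locally \<open>P = P\<^sup>2 + (ua)\<close>, contradicting \<open>a \<notin> P\<^sup>2 R\<^sub>P\<close>.

  Since \<open>C = A[1/p]\<close> and \<open>pA\<close> is a maximal ideal containing \<open>M\<close>, the primes of \<open>A\<close> are \<open>pA\<close> and the
  contractions of the primes of \<open>C\<close>, which gives the dimension. If \<open>A\<close> were h-local, every nonzero ideal of
  \<open>C\<close> would lie in finitely many maximal ideals, every nonzero radical ideal of \<open>C\<close> would be a finite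
  product of maximal ideals, and \<open>C\<close> would be Dedekind.

  For a nonzero proper ideal \<open>I\<close> of \<open>A\<close>, write \<open>IC = q\<^sup>m B\<^sub>1 \<dots> B\<^sub>k\<close> with radical ideals \<open>B\<^sub>i\<close> not contained
  in \<open>M\<close>. Then \<open>I\<close> is either \<open>q\<^sup>m\<^sup>-\<^sup>1 M \<Prod>(B\<^sub>i \<inter> A)\<close> or \<open>q\<^sup>m p\<^sup>n \<Prod>(B\<^sub>i \<inter> A)\<close> for an integer \<open>n\<close>;
  if the product in the second case is empty, \<open>pA\<close> is split off.
\<close>

section \<open>Ideals, primes and localization\<close>

text \<open>\<open>C\<close> is not Noetherian, so neither Krull's principal ideal theorem nor his
  intersection theorem is available. Their place is taken by factorization into radical ideals and a
  one-element Nakayama argument: if \<open>s x = y + q x\<close> with \<open>q\<close> in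
  \<open>Q\<close> and \<open>s\<close> outside \<open>Q\<close>, then \<open>x\<close> is locally a
  multiple of \<open>y\<close>. The decisive contradictions of the maximality proof have this form;
  for instance, exponent 1 for \<open>P + (u^2)\<close> would put \<open>u\<close> locally into
  \<open>P\<close>. Localized rings are never formed: a local inclusion is an inclusion in a
  saturation. The element \<open>p\<close> has two roles. As a unit of \<open>C\<close> it makes
  \<open>C\<close> a ring of fractions of \<open>A\<close> with powers of \<open>p\<close> as
  denominators. Having value one, it provides units of \<open>C\<close> of every integer value. The
  two shapes of \<open>I\<close> come from the values taken outside \<open>M\<close> by
  \<open>I\<close> divided by \<open>q^m\<close>. If they are unbounded below, the quotient is a
  full ideal of \<open>C\<close>, and it takes one factor \<open>q\<close>, in the form of
  \<open>M\<close>, to push it into \<open>A\<close>. Otherwise \<open>n\<close> is the least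
  value.\<close>

definition adjoin :: "('a, 'b) ring_scheme \<Rightarrow> 'a set \<Rightarrow> 'a set \<Rightarrow> 'a \<Rightarrow> 'a set" where
  "adjoin R I J x = {i \<oplus>\<^bsub>R\<^esub> j \<otimes>\<^bsub>R\<^esub> x | i j. i \<in> I \<and> j \<in> J}"

text \<open>For a prime ideal \<open>Q\<close>, this is the contraction to \<open>R\<close> of the localized ideal \<open>I R\<^sub>Q\<close>.\<close>

definition saturation :: "('a, 'b) ring_scheme \<Rightarrow> 'a set \<Rightarrow> 'a set \<Rightarrow> 'a set" where
  "saturation R Q I = {x \<in> carrier R. \<exists>s\<in>carrier R - Q. s \<otimes>\<^bsub>R\<^esub> x \<in> I}"

text \<open>For \<open>I \<subseteq> Q\<close> with \<open>Q\<close> prime: \<open>Q R\<^sub>Q\<close> is the radical of \<open>I R\<^sub>Q\<close>.\<close>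

definition locally_radical_eq :: "('a, 'b) ring_scheme \<Rightarrow> 'a set \<Rightarrow> 'a set \<Rightarrow> bool" where
  "locally_radical_eq R Q I \<longleftrightarrow>
     (\<forall>x\<in>Q. \<exists>s\<in>carrier R - Q. \<exists>n::nat. s \<otimes>\<^bsub>R\<^esub> x [^]\<^bsub>R\<^esub> n \<in> I)"

section \<open>Closure rules for ideals and products of ideals\<close>

lemma ideal_subset: "ideal I R \<Longrightarrow> I \<subseteq> carrier R"
  by (auto dest: ideal.Icarr)

lemma ideal_zero: "ideal I R \<Longrightarrow> \<zero>\<^bsub>R\<^esub> \<in> I"
  by (simp add: additive_subgroup.zero_closed ideal.axioms(1))

lemma ideal_add: "ideal I R \<Longrightarrow> x \<in> I \<Longrightarrow> y \<in> I \<Longrightarrow> x \<oplus>\<^bsub>R\<^esub> y \<in> I"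
  by (simp add: additive_subgroup.a_closed ideal.axioms(1))

lemma ideal_uminus: "ideal I R \<Longrightarrow> x \<in> I \<Longrightarrow> \<ominus>\<^bsub>R\<^esub> x \<in> I"
  by (simp add: additive_subgroup.a_inv_closed ideal.axioms)

lemma ideal_minus: "ideal I R \<Longrightarrow> x \<in> I \<Longrightarrow> y \<in> I \<Longrightarrow> x \<ominus>\<^bsub>R\<^esub> y \<in> I"
  by (simp add: a_minus_def ideal_add ideal_uminus)

lemma primeideal_ideal: "primeideal P R \<Longrightarrow> ideal P R"
  by (simp add: primeideal.axioms(1))

lemma primeideal_notone: "primeideal P R \<Longrightarrow> \<one>\<^bsub>R\<^esub> \<notin> P"
  using ideal.one_imp_carrier primeideal.I_notcarr primeideal.axioms(1) by metis

lemma primeideal_mult_notin: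
  "primeideal P R \<Longrightarrow> a \<in> carrier R - P \<Longrightarrow> b \<in> carrier R - P \<Longrightarrow> a \<otimes>\<^bsub>R\<^esub> b \<in> carrier R - P"
  by (metis DiffD1 DiffD2 DiffI primeideal.I_prime primeideal_ideal ideal.axioms(2) ring.ring_simprules(5))

lemma radical_ideal_ideal: "radical_ideal I R \<Longrightarrow> ideal I R"
  by (simp add: radical_ideal_def)

context cring
begin

lemma ideal_mult: "ideal I R \<Longrightarrow> x \<in> carrier R \<Longrightarrow> y \<in> I \<Longrightarrow> x \<otimes> y \<in> I"
  by (simp add: ideal.I_l_closed)

lemma idealI_cring:
  assumes "I \<subseteq> carrier R" "\<zero> \<in> I" "\<And>x y. x \<in> I \<Longrightarrow> y \<in> I \<Longrightarrow> x \<oplus> y \<in> I"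
    "\<And>r x. r \<in> carrier R \<Longrightarrow> x \<in> I \<Longrightarrow> r \<otimes> x \<in> I"
  shows "ideal I R"
proof (rule idealI)
  show "ring R" by (rule ring_axioms)
  have "\<ominus> x \<in> I" if "x \<in> I" for x
    using assms(4)[of "\<ominus> \<one>" x] assms(1) that by (simp add: l_minus subset_iff)
  then show "subgroup I (add_monoid R)"
    using assms by (intro add.subgroupI) auto
  fix a x assume "a \<in> I" "x \<in> carrier R"
  then show "x \<otimes> a \<in> I" "a \<otimes> x \<in> I"
    using assms(1,4) m_comm[of a x] by (auto simp: subset_iff)
qed

lemma ideal_prod_subset:
  assumes "ideal K R" "\<And>i j. i \<in> I \<Longrightarrow> j \<in> J \<Longrightarrow> i \<otimes> j \<in> K"
  shows "I \<cdot> J \<subseteq> K"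
proof
  fix x assume "x \<in> I \<cdot> J"
  then show "x \<in> K" by induct (auto simp: assms ideal_add)
qed

lemma ideal_prod_mono: "I \<subseteq> I' \<Longrightarrow> J \<subseteq> J' \<Longrightarrow> I \<cdot> J \<subseteq> I' \<cdot> J'"
proof
  fix x assume *: "I \<subseteq> I'" "J \<subseteq> J'" "x \<in> I \<cdot> J"
  from *(3) show "x \<in> I' \<cdot> J'"
    by induct (use * in \<open>auto intro: ideal_prod.intros\<close>)
qed

lemma ideal_prod_subset_left: "ideal I R \<Longrightarrow> ideal J R \<Longrightarrow> I \<cdot> J \<subseteq> I"
  using ideal_prod_inter by blast

lemma ideal_prod_subset_right: "ideal I R \<Longrightarrow> ideal J R \<Longrightarrow> I \<cdot> J \<subseteq> J"
  using ideal_prod_inter by blast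

lemma ideal_prod_list_Nil: "ideal_prod_list R [] = carrier R"
  and ideal_prod_list_Cons: "ideal_prod_list R (I # Is) = I \<cdot> ideal_prod_list R Is"
  by (simp_all add: ideal_prod_list_def)

lemma ideal_prod_list_ideal:
  "\<forall>I\<in>set Is. ideal I R \<Longrightarrow> ideal (ideal_prod_list R Is) R"
  by (induction Is) (auto simp: ideal_prod_list_Nil ideal_prod_list_Cons oneideal ideal_prod_is_ideal)

lemma ideal_prod_list_subset_prime:
  assumes P: "primeideal P R"
  shows "\<forall>I\<in>set Is. ideal I R \<Longrightarrow> ideal_prod_list R Is \<subseteq> P \<Longrightarrow> \<exists>I\<in>set Is. I \<subseteq> P"
proof (induction Is)
  case Nil
  then show ?case using primeideal_notone[OF P] by (auto simp: ideal_prod_list_Nil)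
next
  case (Cons I Is)
  show ?case
  proof (rule ccontr)
    assume c: "\<not> ?case"
    then obtain x where x: "x \<in> I" "x \<notin> P" by auto
    have "\<not> ideal_prod_list R Is \<subseteq> P" using Cons c by auto
    then obtain y where y: "y \<in> ideal_prod_list R Is" "y \<notin> P" by auto
    have "x \<otimes> y \<in> P" using Cons.prems(2) x y by (auto simp: ideal_prod_list_Cons intro: ideal_prod.prod)
    then show False
      using x y P Cons.prems(1) ideal_prod_list_ideal[of Is]
      by (metis ideal.Icarr list.set_intros primeideal.I_prime)
  qed
qed

lemma ideal_prod_list_remove1:
  "\<forall>I\<in>set Is. ideal I R \<Longrightarrow> L \<in> set Is \<Longrightarrow>
    ideal_prod_list R Is = L \<cdot> ideal_prod_list R (remove1 L Is)"
proof (induction Is)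
  case (Cons I Is)
  have id: "ideal I R" "ideal L R" using Cons.prems by auto
  show ?case
  proof (cases "I = L")
    case True
    then show ?thesis by (simp add: ideal_prod_list_Cons)
  next
    case False
    then have e: "ideal_prod_list R Is = L \<cdot> ideal_prod_list R (remove1 L Is)"
      using Cons by auto
    have r: "ideal (ideal_prod_list R (remove1 L Is)) R"
      using Cons.prems by (intro ideal_prod_list_ideal) (auto dest: notin_set_remove1)
    have "I \<cdot> (L \<cdot> ideal_prod_list R (remove1 L Is)) = L \<cdot> (I \<cdot> ideal_prod_list R (remove1 L Is))"
      using id r by (metis ideal_prod_assoc ideal_prod_commute)
    then show ?thesis using False by (simp add: ideal_prod_list_Cons e)
  qed
qed simp

lemma ideal_prod_list_subset:
  assumes "\<forall>I\<in>set Is. ideal I R" "L \<in> set Is"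
  shows "ideal_prod_list R Is \<subseteq> L"
proof -
  have "ideal (ideal_prod_list R (remove1 L Is)) R"
    using assms by (intro ideal_prod_list_ideal) (auto dest: notin_set_remove1)
  then show ?thesis
    using assms ideal_prod_subset_left by (simp add: ideal_prod_list_remove1[OF assms])
qed

text \<open>The second ideal is kept general because the Nakayama steps compare
  \<open>I + (x)\<close>, where \<open>J\<close> is the whole ring, with \<open>I + Jx\<close> for a
  smaller \<open>J\<close>.\<close>

lemma adjoin_ideal:
  assumes I: "ideal I R" and J: "ideal J R" and x: "x \<in> carrier R"
  shows "ideal (adjoin R I J x) R"
proof (rule idealI_cring)
  note c = ideal.Icarr[OF I] ideal.Icarr[OF J]
  show "adjoin R I J x \<subseteq> carrier R" using x c by (auto simp: adjoin_def)
  have "\<zero> = \<zero> \<oplus> \<zero> \<otimes> x" using x by simp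
  then show "\<zero> \<in> adjoin R I J x"
    using ideal_zero[OF I] ideal_zero[OF J] by (fastforce simp: adjoin_def)
next
  note c = ideal.Icarr[OF I] ideal.Icarr[OF J]
  fix y z assume "y \<in> adjoin R I J x" "z \<in> adjoin R I J x"
  then obtain i r j s where *: "y = i \<oplus> r \<otimes> x" "z = j \<oplus> s \<otimes> x" "i \<in> I" "j \<in> I"
    "r \<in> J" "s \<in> J" by (auto simp: adjoin_def)
  have "y \<oplus> z = (i \<oplus> j) \<oplus> (r \<oplus> s) \<otimes> x"
    unfolding * using x c(1)[OF *(3)] c(1)[OF *(4)] c(2)[OF *(5)] c(2)[OF *(6)] by algebra
  then show "y \<oplus> z \<in> adjoin R I J x"
    using * ideal_add[OF I] ideal_add[OF J] by (fastforce simp: adjoin_def)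
next
  note c = ideal.Icarr[OF I] ideal.Icarr[OF J]
  fix y z assume y: "y \<in> carrier R" and "z \<in> adjoin R I J x"
  then obtain i r where *: "z = i \<oplus> r \<otimes> x" "i \<in> I" "r \<in> J" by (auto simp: adjoin_def)
  have "y \<otimes> z = y \<otimes> i \<oplus> (y \<otimes> r) \<otimes> x"
    unfolding * using x y c(1)[OF *(2)] c(2)[OF *(3)] by algebra
  then show "y \<otimes> z \<in> adjoin R I J x"
    using * y ideal_mult[OF I] ideal_mult[OF J] by (fastforce simp: adjoin_def)
qed

lemma adjoin_mult:
  assumes "ideal I R" "j \<in> J" "j \<otimes> x \<in> carrier R"
  shows "j \<otimes> x \<in> adjoin R I J x"
proof -
  have "j \<otimes> x = \<zero> \<oplus> j \<otimes> x" using assms by simp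
  then show ?thesis using ideal_zero[OF assms(1)] assms(2) unfolding adjoin_def by blast
qed

lemma adjoin_self:
  assumes "ideal I R" "x \<in> carrier R"
  shows "x \<in> adjoin R I (carrier R) x"
  using adjoin_mult[of I \<one> "carrier R" x] assms by simp

lemma adjoin_subset:
  assumes "ideal I R" "ideal J R" "x \<in> carrier R"
  shows "I \<subseteq> adjoin R I J x"
proof
  fix i assume "i \<in> I"
  then have "i = i \<oplus> \<zero> \<otimes> x" "i \<in> I" using assms ideal.Icarr[OF assms(1)] by auto
  then show "i \<in> adjoin R I J x" using ideal_zero[OF assms(2)] unfolding adjoin_def by blast
qed

lemma adjoin_least:
  "ideal K R \<Longrightarrow> I \<subseteq> K \<Longrightarrow> (\<And>j. j \<in> J \<Longrightarrow> j \<otimes> x \<in> K) \<Longrightarrow> adjoin R I J x \<subseteq> K"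
  by (auto simp: adjoin_def intro!: ideal_add)

lemma adjoin_carrier_least:
  "ideal K R \<Longrightarrow> I \<subseteq> K \<Longrightarrow> x \<in> K \<Longrightarrow> adjoin R I (carrier R) x \<subseteq> K"
  by (rule adjoin_least) (auto intro: ideal_mult)

lemma adjoinE:
  assumes "y \<in> adjoin R I J x"
  obtains i j where "i \<in> I" "j \<in> J" "y = i \<oplus> j \<otimes> x"
  using assms by (auto simp: adjoin_def)

section \<open>Existence of prime ideals, radical ideals and minimal primes\<close>

lemma chain_Union_ideal:
  "subset.chain {I. ideal I R} C \<Longrightarrow> C \<noteq> {} \<Longrightarrow> ideal (\<Union>C) R"
  using chain_Union_is_ideal[of C] by simp

text \<open>An ideal maximal among those that contain \<open>J\<close> and avoid \<open>S\<close> is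
  prime: adjoining either of two elements outside it hits \<open>S\<close>, and the product of the
  two hits lies in \<open>S\<close> and, if the product of the elements is in the ideal, in the
  ideal as well.\<close>

lemma exists_primeideal_disjoint:
  assumes J: "ideal J R" and S: "S \<subseteq> carrier R" "\<one> \<in> S" "\<And>a b. a \<in> S \<Longrightarrow> b \<in> S \<Longrightarrow> a \<otimes> b \<in> S"
    and JS: "J \<inter> S = {}"
  shows "\<exists>P. primeideal P R \<and> J \<subseteq> P \<and> P \<inter> S = {}"
proof -
  let ?A = "{I. ideal I R \<and> J \<subseteq> I \<and> I \<inter> S = {}}"
  have "\<exists>M\<in>?A. \<forall>W\<in>?A. M \<subseteq> W \<longrightarrow> W = M"
  proof (rule subset_Zorn_nonempty)
    show "?A \<noteq> {}" using J JS by blast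
    fix C assume C: "C \<noteq> {}" "subset.chain ?A C"
    then have "subset.chain {I. ideal I R} C" by (auto simp: pred_on.chain_def)
    then have "ideal (\<Union>C) R" using C(1) chain_Union_ideal by blast
    moreover have "J \<subseteq> \<Union>C" "\<Union>C \<inter> S = {}"
    proof -
      have "J \<subseteq> W \<and> W \<inter> S = {}" if "W \<in> C" for W
        using C(2) that by (auto simp: pred_on.chain_def)
      then show "J \<subseteq> \<Union>C" "\<Union>C \<inter> S = {}" using C(1) by blast+
    qed
    ultimately show "\<Union>C \<in> ?A" by simp
  qed
  then obtain M where MA: "M \<in> ?A" and max': "\<forall>W\<in>?A. M \<subseteq> W \<longrightarrow> W = M" by (rule bexE)
  have M: "ideal M R" "J \<subseteq> M" "M \<inter> S = {}" using MA by auto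
  have max: "W = M" if "ideal W R" "J \<subseteq> W" "W \<inter> S = {}" "M \<subseteq> W" for W
    using max' that by simp
  have meet: "\<exists>i\<in>M. \<exists>r\<in>carrier R. i \<oplus> r \<otimes> a \<in> S" if a: "a \<in> carrier R" "a \<notin> M" for a
  proof (rule ccontr)
    assume "\<not> ?thesis"
    then have "adjoin R M (carrier R) a \<inter> S = {}" by (auto simp: adjoin_def)
    then have "adjoin R M (carrier R) a = M"
      using max adjoin_ideal[OF M(1) oneideal a(1)] adjoin_subset[OF M(1) oneideal a(1)] M(2) by blast
    then show False using adjoin_self[OF M(1) a(1)] a by simp
  qed
  have "primeideal M R"
  proof (rule primeidealI)
    show "ideal M R" "cring R" by (simp_all add: M is_cring)
    show "carrier R \<noteq> M" using M(3) S by blast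
    fix a b assume ab: "a \<in> carrier R" "b \<in> carrier R" "a \<otimes> b \<in> M"
    show "a \<in> M \<or> b \<in> M"
    proof (rule ccontr)
      assume "\<not> ?thesis"
      then obtain i r j s where *: "i \<in> M" "r \<in> carrier R" "i \<oplus> r \<otimes> a \<in> S"
         "j \<in> M" "s \<in> carrier R" "j \<oplus> s \<otimes> b \<in> S" using meet ab by meson
      have c: "i \<in> carrier R" "j \<in> carrier R" using * M(1) by (auto simp: ideal.Icarr)
      have "(i \<oplus> r \<otimes> a) \<otimes> (j \<oplus> s \<otimes> b) = (j \<oplus> s \<otimes> b) \<otimes> i \<oplus> ((r \<otimes> a) \<otimes> j \<oplus> (r \<otimes> s) \<otimes> (a \<otimes> b))"
        using *(2,5) ab(1,2) c by algebra
      also have "\<dots> \<in> M"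
        using * ab c ideal_mult[OF M(1) _ ab(3)] ideal_mult[OF M(1) _ *(1)] ideal_mult[OF M(1) _ *(4)]
        by (intro ideal_add[OF M(1)]) auto
      finally show False using S(3)[OF *(3,6)] M(3) by blast
    qed
  qed
  then show ?thesis using M by blast
qed

lemma exists_primeideal_superset:
  assumes "ideal J R" "J \<noteq> carrier R"
  shows "\<exists>P. primeideal P R \<and> J \<subseteq> P"
proof -
  have "\<one> \<notin> J" using assms ideal.one_imp_carrier by blast
  then show ?thesis using exists_primeideal_disjoint[OF assms(1), of "{\<one>}"] by auto
qed

lemma radical_ideal_powD:
  assumes "radical_ideal L R" "x \<in> carrier R" "x [^] (n::nat) \<in> L"
  shows "x \<in> L"
proof -
  have L: "ideal L R" using assms(1) by (rule radical_ideal_ideal)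
  \<comment> \<open>The exponent \<open>n\<close> may be 0, while \<open>radical\<close> asks for at
    least 1; one more factor \<open>x\<close> covers both cases.\<close>
  have "x [^] Suc n \<in> L" using ideal.I_r_closed[OF L assms(3,2)] by simp
  then have "x \<in> radical R L" using assms(2) by (auto simp: radical_def simp del: nat_pow_Suc intro!: exI[of _ "Suc n"])
  then show ?thesis using assms(1) by (simp add: radical_ideal_def)
qed

lemma radical_idealI:
  assumes "ideal L R" "\<And>x n. x \<in> carrier R \<Longrightarrow> n \<ge> 1 \<Longrightarrow> x [^] (n::nat) \<in> L \<Longrightarrow> x \<in> L"
  shows "radical_ideal L R"
proof -
  have "x [^] (1::nat) \<in> L" if "x \<in> L" for x using that assms(1) by (simp add: ideal.Icarr)
  then show ?thesis
    using assms unfolding radical_ideal_def radical_def by (auto simp: ideal.Icarr)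
qed

text \<open>The powers of \<open>x\<close> form a multiplicative set, which a radical ideal without
  \<open>x\<close> avoids. Hence a radical ideal is the intersection of the primes above it.\<close>

lemma radical_ideal_prime_notin:
  assumes L: "radical_ideal L R" and x: "x \<in> carrier R" "x \<notin> L"
  shows "\<exists>P. primeideal P R \<and> L \<subseteq> P \<and> x \<notin> P"
proof -
  let ?S = "range (\<lambda>n::nat. x [^] n)"
  have "\<exists>P. primeideal P R \<and> L \<subseteq> P \<and> P \<inter> ?S = {}"
  proof (rule exists_primeideal_disjoint)
    show "ideal L R" using L by (rule radical_ideal_ideal)
    show "?S \<subseteq> carrier R" using x by auto
    show "\<one> \<in> ?S" by (metis nat_pow_0 rangeI)
    show "L \<inter> ?S = {}" using radical_ideal_powD[OF L x(1)] x(2) by blast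
    show "a \<otimes> b \<in> ?S" if "a \<in> ?S" "b \<in> ?S" for a b
      using that x by (auto simp: nat_pow_mult)
  qed
  moreover have "x \<in> ?S" using x by (metis nat_pow_eone rangeI)
  ultimately show ?thesis by blast
qed

lemma primeideal_pow:
  "primeideal P R \<Longrightarrow> x \<in> carrier R \<Longrightarrow> x [^] (n::nat) \<in> P \<Longrightarrow> x \<in> P"
  by (induction n) (auto dest: primeideal_notone primeideal.I_prime)

lemma primeideal_radical: "primeideal P R \<Longrightarrow> radical_ideal P R"
  by (intro radical_idealI) (auto dest: primeideal_pow primeideal_ideal)

text \<open>Zorn's lemma is applied to complements of primes, so that a maximal complement is a
  minimal prime. The union of a chain of complements corresponds to the intersection of a chain of
  primes, which is again prime.\<close>

lemma exists_minimal_primeideal: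
  assumes N: "primeideal N R" and I: "I \<subseteq> N"
  shows "\<exists>Q. primeideal Q R \<and> I \<subseteq> Q \<and> Q \<subseteq> N \<and>
    (\<forall>P. primeideal P R \<longrightarrow> I \<subseteq> P \<longrightarrow> P \<subseteq> Q \<longrightarrow> P = Q)"
proof -
  let ?A = "{carrier R - P | P. primeideal P R \<and> I \<subseteq> P \<and> P \<subseteq> N}"
  have "\<exists>M\<in>?A. \<forall>W\<in>?A. M \<subseteq> W \<longrightarrow> W = M"
  proof (rule subset_Zorn_nonempty)
    show "?A \<noteq> {}" using N I by blast
    fix C assume C: "C \<noteq> {}" "subset.chain ?A C"
    let ?P = "carrier R - \<Union>C"
    have total: "W \<subseteq> Y \<or> Y \<subseteq> W" if "W \<in> C" "Y \<in> C" for W Y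
      using C(2) that by (simp add: subset_chain_def)
    have CA: "\<exists>P. W = carrier R - P \<and> primeideal P R \<and> I \<subseteq> P \<and> P \<subseteq> N" if "W \<in> C" for W
      using C(2) that by (auto simp: pred_on.chain_def)
    have compl: "ideal (carrier R - W) R" "primeideal (carrier R - W) R" "I \<subseteq> carrier R - W"
      "carrier R - W \<subseteq> N" if W: "W \<in> C" for W
    proof -
      obtain P where P: "W = carrier R - P" "primeideal P R" "I \<subseteq> P" "P \<subseteq> N" using CA[OF W] by blast
      have "carrier R - W = P" using P(1) ideal_subset[OF primeideal_ideal[OF P(2)]] by blast
      then show "ideal (carrier R - W) R" "primeideal (carrier R - W) R" "I \<subseteq> carrier R - W"
        "carrier R - W \<subseteq> N"
        using P primeideal_ideal by auto
    qed
    have eq: "?P = \<Inter>((\<lambda>W. carrier R - W) ` C)" using C(1) by blast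
    have "ideal ?P R" unfolding eq using C(1) compl(1) by (intro i_Intersect) auto
    have "primeideal ?P R"
    proof (rule primeidealI)
      show "ideal ?P R" "cring R" by (fact, simp add: is_cring)
      obtain W where W: "W \<in> C" using C(1) by blast
      have "\<one> \<in> W" using primeideal_notone[OF compl(2)[OF W]] by auto
      then have "\<one> \<notin> ?P" using W by blast
      then show "carrier R \<noteq> ?P" by auto
      fix a b assume ab: "a \<in> carrier R" "b \<in> carrier R" "a \<otimes> b \<in> ?P"
      show "a \<in> ?P \<or> b \<in> ?P"
      proof (rule ccontr)
        assume "\<not> ?thesis"
        then obtain W Y where XY: "W \<in> C" "Y \<in> C" "a \<in> W" "b \<in> Y" using ab by blast
        then obtain Z where Z: "Z \<in> C" "a \<in> Z" "b \<in> Z"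
          using total[OF XY(1,2)] by blast
        have "a \<otimes> b \<in> carrier R - Z" using ab Z(1) by blast
        then show False
          using primeideal.I_prime[OF compl(2)[OF Z(1)] ab(1,2)] Z by blast
      qed
    qed
    moreover have "I \<subseteq> ?P" using compl(3) C(1) unfolding eq by blast
    moreover have "?P \<subseteq> N" using compl(4) C(1) by blast
    moreover have "\<Union>C = carrier R - ?P" using CA by blast
    ultimately show "\<Union>C \<in> ?A" by (intro CollectI exI[of _ ?P]) simp
  qed
  then obtain M where MA: "M \<in> ?A" and max': "\<forall>W\<in>?A. M \<subseteq> W \<longrightarrow> W = M" by (rule bexE)
  obtain Q where Q: "M = carrier R - Q" "primeideal Q R" "I \<subseteq> Q" "Q \<subseteq> N" using MA by auto
  have max: "carrier R - P = carrier R - Q"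
    if "primeideal P R" "I \<subseteq> P" "P \<subseteq> N" "carrier R - Q \<subseteq> carrier R - P" for P
  proof -
    have "carrier R - P \<in> ?A" using that(1-3) by auto
    then show ?thesis using max' that(4) unfolding Q(1) by blast
  qed
  have "P = Q" if P: "primeideal P R" "I \<subseteq> P" "P \<subseteq> Q" for P
  proof -
    have "carrier R - P = carrier R - Q" using max[of P] P Q by auto
    then show ?thesis using ideal_subset[OF primeideal_ideal] P Q by blast
  qed
  then show ?thesis using Q by blast
qed

text \<open>If the claim fails for \<open>x\<close>, the multiplicative set of all
  \<open>s x^n\<close> with \<open>s\<close> outside \<open>Q\<close> misses \<open>I\<close>. A
  prime over \<open>I\<close> avoiding this set lies in \<open>Q\<close> (take \<open>n = 0\<close>)
  but omits \<open>x\<close>, against minimality.\<close>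

lemma minimal_primeideal_locally_radical:
  assumes Q: "primeideal Q R" and I: "ideal I R" "I \<subseteq> Q"
    and min: "\<And>P. primeideal P R \<Longrightarrow> I \<subseteq> P \<Longrightarrow> P \<subseteq> Q \<Longrightarrow> P = Q"
  shows "locally_radical_eq R Q I"
  unfolding locally_radical_eq_def
proof
  fix x assume x: "x \<in> Q"
  have xc: "x \<in> carrier R" using x Q by (meson ideal.Icarr primeideal_ideal)
  let ?S = "{s \<otimes> x [^] (n::nat) | s n. s \<in> carrier R - Q}"
  show "\<exists>s\<in>carrier R - Q. \<exists>n::nat. s \<otimes> x [^] n \<in> I"
  proof (rule ccontr)
    assume c: "\<not> ?thesis"
    have "\<exists>P. primeideal P R \<and> I \<subseteq> P \<and> P \<inter> ?S = {}"
    proof (rule exists_primeideal_disjoint)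
      show "ideal I R" by (rule I)
      show "?S \<subseteq> carrier R" using xc by auto
      have "\<one> = \<one> \<otimes> x [^] (0::nat)" by simp
      then show "\<one> \<in> ?S" using primeideal_notone[OF Q] by blast
      show "I \<inter> ?S = {}" using c by blast
      fix a b assume "a \<in> ?S" "b \<in> ?S"
      then obtain s t m n where *: "a = s \<otimes> x [^] (m::nat)" "b = t \<otimes> x [^] (n::nat)"
        "s \<in> carrier R - Q" "t \<in> carrier R - Q" by blast
      have "s \<in> carrier R" "t \<in> carrier R" "x [^] m \<in> carrier R" "x [^] n \<in> carrier R" using * xc by auto
      then have "a \<otimes> b = (s \<otimes> t) \<otimes> (x [^] m \<otimes> x [^] n)"
        unfolding * by algebra
      then have "a \<otimes> b = (s \<otimes> t) \<otimes> x [^] (m + n)"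
        using xc by (simp add: nat_pow_mult)
      then show "a \<otimes> b \<in> ?S" using primeideal_mult_notin[OF Q *(3,4)] by blast
    qed
    then obtain P where P: "primeideal P R" "I \<subseteq> P" "P \<inter> ?S = {}" by blast
    have "P \<subseteq> Q"
    proof
      fix y assume y: "y \<in> P"
      have "y = y \<otimes> x [^] (0::nat)" "y \<in> carrier R" using y P(1) by (auto simp: ideal.Icarr[OF primeideal_ideal])
      then show "y \<in> Q" using P(3) y by blast
    qed
    then have "P = Q" using min P by blast
    moreover have "x = \<one> \<otimes> x [^] (1::nat)" using xc by simp
    then have "x \<in> ?S" using primeideal_notone[OF Q] by blast
    ultimately show False using x P(3) by blast
  qed
qed

end

section \<open>Powers of an ideal and factorizations in SP-domains\<close>

definition ideal_power :: "('a, 'b) ring_scheme \<Rightarrow> 'a set \<Rightarrow> nat \<Rightarrow> 'a set" where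
  "ideal_power R I n = ideal_prod_list R (replicate n I)"

lemma sp_domain_domain: "sp_domain R \<Longrightarrow> domain R"
  by (simp add: sp_domain_def)

lemma sp_domain_factor:
  assumes "sp_domain R" "ideal I R"
  obtains Ls where "\<forall>L\<in>set Ls. radical_ideal L R" "I = ideal_prod_list R Ls"
  using assms by (auto simp: sp_domain_def)

context cring
begin

lemma ideal_power_0: "ideal_power R I 0 = carrier R"
  and ideal_power_Suc: "ideal_power R I (Suc n) = I \<cdot> ideal_power R I n"
  by (simp_all add: ideal_power_def ideal_prod_list_Nil ideal_prod_list_Cons)

lemma ideal_power_ideal: "ideal I R \<Longrightarrow> ideal (ideal_power R I n) R"
  unfolding ideal_power_def by (intro ideal_prod_list_ideal) auto

lemma ideal_power_1: "ideal I R \<Longrightarrow> ideal_power R I (Suc 0) = I"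
  by (simp add: ideal_power_0 ideal_power_Suc ideal_prod_one)

lemma ideal_power_subset_square:
  assumes "ideal I R" "n \<ge> 2"
  shows "ideal_power R I n \<subseteq> I \<cdot> I"
proof -
  obtain m where n: "n = Suc (Suc m)" using le_Suc_ex[OF assms(2)] by auto
  show ?thesis unfolding n ideal_power_Suc[of I "Suc m"] ideal_power_Suc[of I m]
    
    using ideal_prod_mono[OF order_refl ideal_prod_subset_left[OF assms(1) ideal_power_ideal[OF assms(1)]]] .
qed

lemma diff_notin: "ideal Q R \<Longrightarrow> s \<in> carrier R - Q \<Longrightarrow> q \<in> Q \<Longrightarrow> s \<ominus> q \<in> carrier R - Q"
proof
  assume *: "ideal Q R" "s \<in> carrier R - Q" "q \<in> Q"
  have q: "q \<in> carrier R" "s \<in> carrier R" using * by (auto simp: ideal.Icarr)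
  then show "s \<ominus> q \<in> carrier R" by simp
  show "s \<ominus> q \<notin> Q"
  proof
    assume "s \<ominus> q \<in> Q"
    then have "(s \<ominus> q) \<oplus> q \<in> Q" using * by (intro ideal_add)
    moreover have "(s \<ominus> q) \<oplus> q = s" using q by algebra
    ultimately show False using * by simp
  qed
qed

section \<open>Local inclusions, expressed by saturations\<close>

lemma saturationI: "x \<in> carrier R \<Longrightarrow> s \<in> carrier R - Q \<Longrightarrow> s \<otimes> x \<in> I \<Longrightarrow> x \<in> saturation R Q I"
  by (auto simp: saturation_def)

lemma saturationE:
  assumes "x \<in> saturation R Q I"
  obtains s where "x \<in> carrier R" "s \<in> carrier R" "s \<notin> Q" "s \<in> carrier R - Q" "s \<otimes> x \<in> I"
  using assms by (auto simp: saturation_def)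

lemma saturation_ideal:
  assumes Q: "primeideal Q R" and I: "ideal I R"
  shows "ideal (saturation R Q I) R"
proof (rule idealI_cring)
  show "saturation R Q I \<subseteq> carrier R" by (auto simp: saturation_def)
  show "\<zero> \<in> saturation R Q I"
    using primeideal_notone[OF Q] ideal_zero[OF I] by (intro saturationI[of _ \<one>]) auto
next
  fix x y assume "x \<in> saturation R Q I" "y \<in> saturation R Q I"
  then obtain s t where *: "x \<in> carrier R" "s \<in> carrier R - Q" "s \<otimes> x \<in> I"
    "y \<in> carrier R" "t \<in> carrier R - Q" "t \<otimes> y \<in> I" by (metis saturationE)
  have c: "s \<in> carrier R" "t \<in> carrier R" using * by auto
  have "(s \<otimes> t) \<otimes> (x \<oplus> y) = t \<otimes> (s \<otimes> x) \<oplus> s \<otimes> (t \<otimes> y)" using *(1,4) c by algebra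
  also have "\<dots> \<in> I" using ideal_mult[OF I c(2) *(3)] ideal_mult[OF I c(1) *(6)] by (rule ideal_add[OF I])
  finally show "x \<oplus> y \<in> saturation R Q I"
    using * primeideal_mult_notin[OF Q *(2,5)] by (intro saturationI[of _ "s \<otimes> t"]) auto
next
  fix r x assume r: "r \<in> carrier R" and "x \<in> saturation R Q I"
  then obtain s where *: "x \<in> carrier R" "s \<in> carrier R" "s \<in> carrier R - Q" "s \<otimes> x \<in> I"
    by (metis saturationE)
  have "s \<otimes> (r \<otimes> x) = r \<otimes> (s \<otimes> x)" using *(1,2) r by algebra
  then show "r \<otimes> x \<in> saturation R Q I"
    using * r ideal_mult[OF I r] by (intro saturationI[of _ s]) auto
qed

lemma saturation_superset:
  "primeideal Q R \<Longrightarrow> ideal I R \<Longrightarrow> I \<subseteq> saturation R Q I"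
  using primeideal_notone[of Q R] by (auto intro!: saturationI[of _ \<one>] simp: ideal.Icarr)

lemma saturation_mono: "I \<subseteq> J \<Longrightarrow> saturation R Q I \<subseteq> saturation R Q J"
  by (auto simp: saturation_def)

text \<open>Denominators multiply because \<open>Q\<close> is prime. This makes local inclusion
  transitive.\<close>

lemma saturation_least:
  assumes Q: "primeideal Q R" and "I \<subseteq> saturation R Q J"
  shows "saturation R Q I \<subseteq> saturation R Q J"
proof
  fix x assume "x \<in> saturation R Q I"
  then obtain s where s: "x \<in> carrier R" "s \<in> carrier R - Q" "s \<otimes> x \<in> I" by (metis saturationE)
  then have "s \<otimes> x \<in> saturation R Q J" using assms by blast
  then obtain t where t: "t \<in> carrier R - Q" "t \<otimes> (s \<otimes> x) \<in> J" by (metis saturationE)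
  then have "(t \<otimes> s) \<otimes> x \<in> J" using s by (simp add: m_assoc)
  then show "x \<in> saturation R Q J"
    using s primeideal_mult_notin[OF Q t(1) s(2)] by (intro saturationI[of _ "t \<otimes> s"]) auto
qed

text \<open>A denominator outside \<open>Q\<close> is outside \<open>P\<close>, so primality of
  \<open>P\<close> cancels it. Local membership in such a \<open>P\<close> is therefore genuine
  membership.\<close>

lemma saturation_prime_subset:
  assumes "primeideal P R" "P \<subseteq> Q"
  shows "saturation R Q P \<subseteq> P"
  using assms primeideal.I_prime[OF assms(1)] by (auto elim!: saturationE)

lemma saturation_prod:
  assumes Q: "primeideal Q R" and id: "ideal I' R" "ideal J' R"
    and "I \<subseteq> saturation R Q I'" "J \<subseteq> saturation R Q J'"
  shows "I \<cdot> J \<subseteq> saturation R Q (I' \<cdot> J')"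
proof (rule ideal_prod_subset)
  show "ideal (saturation R Q (I' \<cdot> J')) R" by (intro saturation_ideal Q ideal_prod_is_ideal id)
  fix x y assume "x \<in> I" "y \<in> J"
  then have "x \<in> saturation R Q I'" "y \<in> saturation R Q J'" using assms by auto
  then obtain s t where *: "x \<in> carrier R" "s \<in> carrier R - Q" "s \<otimes> x \<in> I'"
    "y \<in> carrier R" "t \<in> carrier R - Q" "t \<otimes> y \<in> J'" by (metis saturationE)
  have c: "s \<in> carrier R" "t \<in> carrier R" using * by auto
  have "(s \<otimes> t) \<otimes> (x \<otimes> y) = (s \<otimes> x) \<otimes> (t \<otimes> y)" using *(1,4) c by algebra
  then have "(s \<otimes> t) \<otimes> (x \<otimes> y) \<in> I' \<cdot> J'" using * by (simp add: ideal_prod.prod)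
  then show "x \<otimes> y \<in> saturation R Q (I' \<cdot> J')"
    using * primeideal_mult_notin[OF Q *(2,5)] by (intro saturationI[of _ "s \<otimes> t"]) auto
qed

text \<open>Nakayama in the localization at \<open>Q\<close>: \<open>s - q\<close> is a unit there.\<close>

lemma saturation_absorb:
  assumes Q: "ideal Q R" and K: "ideal K R" and x: "x \<in> carrier R" and s: "s \<in> carrier R - Q"
    and q: "q \<in> Q" and y: "y \<in> K" and eq: "s \<otimes> x = y \<oplus> q \<otimes> x"
  shows "x \<in> saturation R Q K"
proof (rule saturationI)
  have c: "s \<in> carrier R" "q \<in> carrier R" "y \<in> carrier R"
    using s q y Q K by (auto simp: ideal.Icarr)
  have "(s \<ominus> q) \<otimes> x = s \<otimes> x \<ominus> q \<otimes> x" using c x by algebra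
  also have "\<dots> = y" unfolding eq using c x by algebra
  finally show "(s \<ominus> q) \<otimes> x \<in> K" using y by simp
qed (use assms diff_notin in auto)

text \<open>From \<open>s x^n\<close> in \<open>L\<close> one gets \<open>(s x)^(n+1)\<close> in
  \<open>L\<close>, and radicality leaves \<open>s x\<close> in \<open>L\<close>.\<close>

lemma radical_ideal_locally_radical:
  assumes L: "radical_ideal L R" and Q: "ideal Q R" and "locally_radical_eq R Q L"
  shows "Q \<subseteq> saturation R Q L"
proof
  fix x assume x: "x \<in> Q"
  have xc: "x \<in> carrier R" using Q x by (simp add: ideal.Icarr)
  obtain s n where s: "s \<in> carrier R - Q" "s \<otimes> x [^] (n::nat) \<in> L"
    using assms(3) x unfolding locally_radical_eq_def by blast
  have sc: "s \<in> carrier R" using s by simp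
  have "(s \<otimes> x) [^] Suc n = (s [^] n \<otimes> x) \<otimes> (s \<otimes> x [^] n)"
    using sc xc nat_pow_closed[OF sc, of n] nat_pow_closed[OF xc, of n]
    by (simp add: nat_pow_distrib m_ac)
  also have "\<dots> \<in> L" using sc xc by (intro ideal_mult[OF radical_ideal_ideal[OF L] _ s(2)]) auto
  finally have "s \<otimes> x \<in> L" using radical_ideal_powD[OF L] sc xc by blast
  then show "x \<in> saturation R Q L" using s xc by (intro saturationI[of _ s]) auto
qed

text \<open>A factor not contained in \<open>Q\<close> contains a denominator and so becomes the
  unit ideal locally; each remaining factor contributes one power of \<open>Q\<close>.\<close>

lemma ideal_prod_list_saturation:
  assumes Q: "primeideal Q R"
  shows "\<forall>L\<in>set Ls. ideal L R \<Longrightarrow> \<forall>L\<in>set Ls. L \<subseteq> Q \<longrightarrow> Q \<subseteq> saturation R Q L \<Longrightarrow>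
    ideal_power R Q (length (filter (\<lambda>L. L \<subseteq> Q) Ls)) \<subseteq> saturation R Q (ideal_prod_list R Ls)"
proof (induction Ls)
  case Nil
  then show ?case using saturation_superset[OF Q oneideal]
    by (simp add: ideal_power_0 ideal_prod_list_Nil)
next
  case (Cons L Ls)
  let ?n = "length (filter (\<lambda>L. L \<subseteq> Q) Ls)"
  have id: "ideal L R" "ideal (ideal_prod_list R Ls) R" using Cons.prems ideal_prod_list_ideal by auto
  have IH: "ideal_power R Q ?n \<subseteq> saturation R Q (ideal_prod_list R Ls)" using Cons by auto
  show ?case
  proof (cases "L \<subseteq> Q")
    case True
    then show ?thesis using Cons.prems IH id
      by (simp add: ideal_power_Suc ideal_prod_list_Cons saturation_prod[OF Q])
  next
    case False
    then obtain s where s: "s \<in> L" "s \<notin> Q" by blast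
    have "ideal_prod_list R Ls \<subseteq> saturation R Q (L \<cdot> ideal_prod_list R Ls)"
      using s id by (auto intro!: saturationI[of _ s] ideal_prod.prod simp: ideal.Icarr)
    then have "saturation R Q (ideal_prod_list R Ls) \<subseteq> saturation R Q (L \<cdot> ideal_prod_list R Ls)"
      by (rule saturation_least[OF Q])
    then show ?thesis using False IH by (simp add: ideal_prod_list_Cons)
  qed
qed

lemma ideal_prod_list_subset_power:
  assumes Q: "ideal Q R"
  shows "\<forall>L\<in>set Ls. ideal L R \<Longrightarrow>
    ideal_prod_list R Ls \<subseteq> ideal_power R Q (length (filter (\<lambda>L. L \<subseteq> Q) Ls))"
proof (induction Ls)
  case Nil
  then show ?case by (simp add: ideal_power_0 ideal_prod_list_Nil)
next
  case (Cons L Ls)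
  have id: "ideal L R" "ideal (ideal_prod_list R Ls) R" using Cons.prems ideal_prod_list_ideal by auto
  show ?case
  proof (cases "L \<subseteq> Q")
    case True
    then show ?thesis using Cons by (simp add: ideal_power_Suc ideal_prod_list_Cons ideal_prod_mono)
  next
    case False
    then show ?thesis using Cons ideal_prod_subset_right[OF id] by (auto simp: ideal_prod_list_Cons)
  qed
qed

lemma locally_radical_eq_superset:
  assumes "locally_radical_eq R Q I" "I \<subseteq> J"
  shows "locally_radical_eq R Q J"
  using assms unfolding locally_radical_eq_def by blast

text \<open>Squaring \<open>p + r t\<close> leaves only \<open>r^2 t^2\<close> outside
  \<open>P\<close>, at the price of doubling the exponent of \<open>x\<close>.\<close>

lemma locally_radical_eq_square:
  assumes Q: "primeideal Q R" and P: "ideal P R" and t: "t \<in> carrier R"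
    and "locally_radical_eq R Q (adjoin R P (carrier R) t)"
  shows "locally_radical_eq R Q (adjoin R P (carrier R) (t \<otimes> t))"
  unfolding locally_radical_eq_def
proof
  fix x assume x: "x \<in> Q"
  have xc: "x \<in> carrier R" using Q x by (meson ideal.Icarr primeideal_ideal)
  obtain s n where s: "s \<in> carrier R - Q" "s \<otimes> x [^] (n::nat) \<in> adjoin R P (carrier R) t"
    using assms(4) x unfolding locally_radical_eq_def by blast
  then obtain p r where pr: "p \<in> P" "r \<in> carrier R" "s \<otimes> x [^] n = p \<oplus> r \<otimes> t" by (elim adjoinE)
  have c: "s \<in> carrier R" "p \<in> carrier R" "x [^] n \<in> carrier R" using s pr P xc by (auto simp: ideal.Icarr)
  have "(s \<otimes> s) \<otimes> x [^] (n + n) = (s \<otimes> s) \<otimes> (x [^] n \<otimes> x [^] n)"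
    using xc by (simp add: nat_pow_mult)
  also have "\<dots> = (s \<otimes> x [^] n) \<otimes> (s \<otimes> x [^] n)" using c by algebra
  also have "\<dots> = (p \<oplus> r \<otimes> t \<oplus> r \<otimes> t) \<otimes> p \<oplus> (r \<otimes> r) \<otimes> (t \<otimes> t)"
    unfolding pr(3) using c pr(2) t by algebra
  also have "\<dots> \<in> adjoin R P (carrier R) (t \<otimes> t)"
  proof -
    have "(p \<oplus> r \<otimes> t \<oplus> r \<otimes> t) \<otimes> p \<in> P" using c pr(2) t by (intro ideal_mult[OF P _ pr(1)]) simp
    moreover have "r \<otimes> r \<in> carrier R" using pr(2) by simp
    ultimately show ?thesis unfolding adjoin_def by blast
  qed
  finally show "\<exists>s\<in>carrier R - Q. \<exists>n::nat. s \<otimes> x [^] n \<in> adjoin R P (carrier R) (t \<otimes> t)"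
    using primeideal_mult_notin[OF Q s(1) s(1)] by blast
qed

text \<open>Every radical factor contains \<open>I\<close>, so those inside \<open>Q\<close> are
  locally equal to \<open>Q\<close> and the others are locally trivial. Some factor lies in
  \<open>Q\<close>, as the prime \<open>Q\<close> contains their product; hence
  \<open>k \<ge> 1\<close>.\<close>

lemma sp_domain_locally_power:
  assumes sp: "sp_domain R" and Q: "primeideal Q R" and I: "ideal I R" "I \<subseteq> Q"
    and loc: "locally_radical_eq R Q I"
  obtains k where "k \<ge> 1" "I \<subseteq> ideal_power R Q k" "ideal_power R Q k \<subseteq> saturation R Q I"
proof -
  obtain Ls where Ls: "\<forall>L\<in>set Ls. radical_ideal L R" "I = ideal_prod_list R Ls"
    using sp_domain_factor[OF sp I(1)] .
  have id: "\<forall>L\<in>set Ls. ideal L R" using Ls by (auto intro: radical_ideal_ideal)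
  have sub: "I \<subseteq> L" if "L \<in> set Ls" for L using that Ls(2) ideal_prod_list_subset[OF id] by simp
  let ?k = "length (filter (\<lambda>L. L \<subseteq> Q) Ls)"
  have "\<forall>L\<in>set Ls. L \<subseteq> Q \<longrightarrow> Q \<subseteq> saturation R Q L"
  proof (intro ballI impI)
    fix L assume "L \<in> set Ls" "L \<subseteq> Q"
    then show "Q \<subseteq> saturation R Q L"
      using radical_ideal_locally_radical[of L Q] Ls(1) primeideal_ideal[OF Q]
        locally_radical_eq_superset[OF loc sub] by simp
  qed
  then have "ideal_power R Q ?k \<subseteq> saturation R Q I"
    unfolding Ls(2) by (intro ideal_prod_list_saturation Q id)
  moreover have "I \<subseteq> ideal_power R Q ?k"
    unfolding Ls(2) by (intro ideal_prod_list_subset_power primeideal_ideal Q id)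
  moreover obtain L where "L \<in> set Ls" "L \<subseteq> Q"
    using ideal_prod_list_subset_prime[OF Q id] I(2) Ls(2) by blast
  then have "?k \<noteq> 0" by (auto simp: filter_empty_conv)
  ultimately show ?thesis using that[of ?k] by (simp add: Suc_le_eq)
qed

end

section \<open>Nonzero prime ideals of an SP-domain are maximal\<close>

context cring
begin

text \<open>The localization of \<open>R/P\<close> at \<open>Q/P\<close> has a principal maximal ideal.\<close>

lemma sp_domain_locally_principal:
  assumes sp: "sp_domain R" and P: "primeideal P R" and Q: "primeideal Q R" and PQ: "P \<subseteq> Q"
    and t: "t \<in> Q" "t \<notin> P" and loc: "locally_radical_eq R Q (adjoin R P (carrier R) t)"
  obtains u where "u \<in> Q" "u \<notin> P" "Q \<subseteq> saturation R Q (adjoin R P (carrier R) u)"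
proof -
  have iP: "ideal P R" and iQ: "ideal Q R" using P Q by (auto intro: primeideal_ideal)
  have tc: "t \<in> carrier R" using t iQ by (auto intro: ideal.Icarr)
  let ?T = "adjoin R P (carrier R) t"
  let ?K = "adjoin R P Q t"
  let ?Q2 = "set_add R (Q \<cdot> Q) P"
  have iT: "ideal ?T R" and iK: "ideal ?K R" using adjoin_ideal iP iQ oneideal tc by auto
  have iQQ: "ideal (Q \<cdot> Q) R" and iQ2: "ideal ?Q2 R"
    using ideal_prod_is_ideal[OF iQ iQ] add_ideals iP by auto
  have TQ: "?T \<subseteq> Q" using adjoin_carrier_least[OF iQ PQ t(1)] .
  obtain j where j: "j \<ge> 1" "?T \<subseteq> ideal_power R Q j" "ideal_power R Q j \<subseteq> saturation R Q ?T"
    using sp_domain_locally_power[OF sp Q iT TQ loc] .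
  obtain i where ji: "j = Suc i" using j(1) by (cases j) auto
  have iQi: "ideal (ideal_power R Q i) R" using ideal_power_ideal[OF iQ] .
  have PQ2: "P \<subseteq> ?Q2"
  proof
    fix p assume "p \<in> P"
    moreover then have "p = \<zero> \<oplus> p" using iP by (simp add: ideal.Icarr)
    ultimately show "p \<in> ?Q2" using ideal_zero[OF iQQ] unfolding set_add_def' by blast
  qed
  have QQ2: "Q \<cdot> Q \<subseteq> ?Q2"
  proof
    fix p assume "p \<in> Q \<cdot> Q"
    moreover then have "p = p \<oplus> \<zero>" using iQQ by (simp add: ideal.Icarr)
    ultimately show "p \<in> ?Q2" using ideal_zero[OF iP] unfolding set_add_def' by blast
  qed
  \<comment> \<open>Modulo \<open>P\<close> the prime \<open>Q\<close> is not locally idempotent.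
    Otherwise \<open>Q^j\<close>, which is locally \<open>P + (t)\<close>, would lie locally in
    \<open>P + Q^(j+1)\<close> and hence in \<open>P + Qt\<close>, and Nakayama would give
    \<open>t\<close> in \<open>P\<close>.\<close>
  have "\<not> Q \<subseteq> saturation R Q ?Q2"
  proof
    assume Q2: "Q \<subseteq> saturation R Q ?Q2"
    have PK: "P \<subseteq> saturation R Q ?K"
      using adjoin_subset[OF iP iQ tc] saturation_superset[OF Q iK] by blast
    have "Q \<cdot> ?T \<subseteq> ?K"
    proof (rule ideal_prod_subset[OF iK])
      fix x y assume x: "x \<in> Q" and "y \<in> ?T"
      then obtain p r where pr: "p \<in> P" "r \<in> carrier R" "y = p \<oplus> r \<otimes> t" by (elim adjoinE)
      have c: "x \<in> carrier R" "p \<in> carrier R" using x pr iP iQ by (auto simp: ideal.Icarr)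
      have "x \<otimes> y = x \<otimes> p \<oplus> (r \<otimes> x) \<otimes> t" unfolding pr(3) using c pr(2) tc by algebra
      moreover have "x \<otimes> p \<in> P" "r \<otimes> x \<in> Q" using ideal_mult iP iQ c pr x by auto
      ultimately show "x \<otimes> y \<in> ?K" unfolding adjoin_def by blast
    qed
    moreover have "Q \<cdot> ideal_power R Q j \<subseteq> saturation R Q (Q \<cdot> ?T)"
      using j(3) saturation_superset[OF Q iQ] by (intro saturation_prod Q iQ iT)
    ultimately have QjK: "Q \<cdot> ideal_power R Q j \<subseteq> saturation R Q ?K"
      using saturation_mono by blast
    have iS: "ideal (saturation R Q ?K) R" using saturation_ideal[OF Q iK] .
    have "?Q2 \<cdot> ideal_power R Q i \<subseteq> saturation R Q ?K"
    proof (rule ideal_prod_subset[OF iS])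
      fix x y assume "x \<in> ?Q2" and y: "y \<in> ideal_power R Q i"
      then obtain a p where ap: "a \<in> Q \<cdot> Q" "p \<in> P" "x = a \<oplus> p" unfolding set_add_def' by blast
      have c: "a \<in> carrier R" "p \<in> carrier R" "y \<in> carrier R"
        using ap y iQQ iP iQi by (auto simp: ideal.Icarr)
      have eq: "x \<otimes> y = a \<otimes> y \<oplus> y \<otimes> p" unfolding ap(3) using c by algebra
      have "a \<otimes> y \<in> (Q \<cdot> Q) \<cdot> ideal_power R Q i" using ap(1) y by (rule ideal_prod.prod)
      then have "a \<otimes> y \<in> saturation R Q ?K"
        using QjK iQ iQi by (auto simp: ji ideal_power_Suc ideal_prod_assoc)
      moreover have "y \<otimes> p \<in> saturation R Q ?K" using ideal_mult[OF iP c(3) ap(2)] PK by blast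
      ultimately show "x \<otimes> y \<in> saturation R Q ?K" unfolding eq by (rule ideal_add[OF iS])
    qed
    then have "saturation R Q (?Q2 \<cdot> ideal_power R Q i) \<subseteq> saturation R Q ?K"
      by (rule saturation_least[OF Q])
    moreover have "Q \<cdot> ideal_power R Q i \<subseteq> saturation R Q (?Q2 \<cdot> ideal_power R Q i)"
      using saturation_superset[OF Q iQi] by (intro saturation_prod Q iQ2 iQi Q2)
    ultimately have "ideal_power R Q j \<subseteq> saturation R Q ?K" unfolding ji ideal_power_Suc by blast
    then have "t \<in> saturation R Q ?K" using adjoin_self[OF iP tc] j(2) by blast
    then obtain s where s: "s \<in> carrier R - Q" "s \<otimes> t \<in> ?K" by (metis saturationE)
    then obtain p q where pq: "p \<in> P" "q \<in> Q" "s \<otimes> t = p \<oplus> q \<otimes> t" by (elim adjoinE)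
    have "t \<in> saturation R Q P" by (rule saturation_absorb[OF iQ iP tc s(1) pq(2,1,3)])
    then show False using saturation_prime_subset[OF P PQ] t(2) by blast
  qed
  then obtain u where u: "u \<in> Q" "u \<notin> saturation R Q ?Q2" by blast
  have uc: "u \<in> carrier R" using u iQ by (auto intro: ideal.Icarr)
  have unP: "u \<notin> P" using u(2) PQ2 saturation_superset[OF Q iQ2] by blast
  let ?U = "adjoin R P (carrier R) u"
  have iU: "ideal ?U R" using adjoin_ideal[OF iP oneideal uc] .
  \<comment> \<open>The extra generator \<open>t^2\<close> makes the radical locally
    \<open>Q\<close>, so \<open>?V\<close> is locally a power of \<open>Q\<close>; the choice of
    \<open>u\<close> excludes exponents above 1. The square, rather than \<open>t\<close>, leaves a
    coefficient in \<open>Q\<close> for Nakayama to remove.\<close>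
  let ?V = "adjoin R ?U (carrier R) (t \<otimes> t)"
  have iV: "ideal ?V R" using adjoin_ideal[OF iU oneideal] tc by simp
  have VQ: "?V \<subseteq> Q"
    using adjoin_carrier_least[OF iQ PQ u(1)] ideal_mult[OF iQ tc t(1)]
    by (rule adjoin_carrier_least[OF iQ])
  have "adjoin R P (carrier R) (t \<otimes> t) \<subseteq> ?V"
    using adjoin_subset[OF iP oneideal uc] by (auto simp: adjoin_def)
  then have "locally_radical_eq R Q ?V"
    using locally_radical_eq_superset[OF locally_radical_eq_square[OF Q iP tc loc]] by blast
  then obtain k where k: "k \<ge> 1" "?V \<subseteq> ideal_power R Q k" "ideal_power R Q k \<subseteq> saturation R Q ?V"
    using sp_domain_locally_power[OF sp Q iV VQ] by blast
  have UV: "?U \<subseteq> ?V" using adjoin_subset[OF iU oneideal] tc by simp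
  then have uV: "u \<in> ?V" using adjoin_self[OF iP uc] by blast
  have "\<not> k \<ge> 2"
  proof
    assume "k \<ge> 2"
    then have "?V \<subseteq> ?Q2" using k(2) ideal_power_subset_square[OF iQ] QQ2 by blast
    then show False using uV u(2) saturation_superset[OF Q iQ2] by blast
  qed
  then have "k = Suc 0" using k(1) by simp
  then have QV: "Q \<subseteq> saturation R Q ?V" using k(3) ideal_power_1[OF iQ] by simp
  have tU: "t \<in> saturation R Q ?U"
  proof -
    have "t \<in> saturation R Q ?V" using QV t(1) by blast
    then obtain s where s: "s \<in> carrier R - Q" "s \<otimes> t \<in> ?V" by (metis saturationE)
    from s(2) obtain w d where wd: "w \<in> ?U" "d \<in> carrier R" "s \<otimes> t = w \<oplus> d \<otimes> (t \<otimes> t)"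
      by (rule adjoinE)
    have "s \<otimes> t = w \<oplus> (d \<otimes> t) \<otimes> t" using wd tc by (simp add: m_assoc)
    then show ?thesis
      using saturation_absorb[OF iQ iU tc s(1) ideal_mult[OF iQ wd(2) t(1)] wd(1)] by blast
  qed
  have "?V \<subseteq> saturation R Q ?U"
    using saturation_superset[OF Q iU] ideal_mult[OF saturation_ideal[OF Q iU] tc tU]
    by (rule adjoin_carrier_least[OF saturation_ideal[OF Q iU]])
  then have "Q \<subseteq> saturation R Q ?U" using QV saturation_least[OF Q] by blast
  then show ?thesis using that u(1) unP by blast
qed

text \<open>A principal maximal ideal alone does not exclude intermediate primes, as valuation rings
  of higher rank show. Here a radical factor \<open>L\<close> of \<open>P + (x)\<close> inside
  \<open>P'\<close> satisfies \<open>L = P + Lu\<close> locally. Multiplying by the other factors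
  carries this over to \<open>P + (x)\<close>, and Nakayama puts \<open>x\<close> into
  \<open>P\<close>.\<close>

lemma sp_domain_no_primeideal_between:
  assumes sp: "sp_domain R" and P: "primeideal P R" and Q: "primeideal Q R"
    and u: "u \<in> Q" "Q \<subseteq> saturation R Q (adjoin R P (carrier R) u)"
    and P': "primeideal P' R" "P \<subset> P'" "P' \<subseteq> Q"
  shows "P' = Q"
proof (rule ccontr)
  assume "P' \<noteq> Q"
  have iP: "ideal P R" and iQ: "ideal Q R" and iP': "ideal P' R"
    using P Q P' by (auto intro: primeideal_ideal)
  have uc: "u \<in> carrier R" using u iQ by (auto intro: ideal.Icarr)
  have uP': "u \<notin> P'"
  proof
    assume "u \<in> P'"
    then have "adjoin R P (carrier R) u \<subseteq> P'" using P'(2) by (intro adjoin_carrier_least iP') auto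
    then have "Q \<subseteq> P'" using u(2) saturation_mono saturation_prime_subset[OF P'(1,3)] by blast
    then show False using P'(3) \<open>P' \<noteq> Q\<close> by blast
  qed
  obtain x where x: "x \<in> P'" "x \<notin> P" using P'(2) by blast
  have xc: "x \<in> carrier R" using x iP' by (auto intro: ideal.Icarr)
  let ?X = "adjoin R P (carrier R) x"
  have iX: "ideal ?X R" using adjoin_ideal[OF iP oneideal xc] .
  obtain Ls where Ls: "\<forall>L\<in>set Ls. radical_ideal L R" "?X = ideal_prod_list R Ls"
    using sp_domain_factor[OF sp iX] .
  have id: "\<forall>L\<in>set Ls. ideal L R" using Ls by (auto intro: radical_ideal_ideal)
  have "?X \<subseteq> P'" using P'(2) x by (intro adjoin_carrier_least iP') auto
  then obtain L where L: "L \<in> set Ls" "L \<subseteq> P'"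
    using ideal_prod_list_subset_prime[OF P'(1) id] Ls(2) by auto
  let ?L' = "ideal_prod_list R (remove1 L Ls)"
  have iL: "ideal L R" and rL: "radical_ideal L R" using id L Ls(1) by auto
  have iL': "ideal ?L' R" using id by (intro ideal_prod_list_ideal) (auto dest: notin_set_remove1)
  have XL: "?X = L \<cdot> ?L'" unfolding Ls(2) using ideal_prod_list_remove1[OF id L(1)] .
  have PL: "P \<subseteq> L"
    using adjoin_subset[OF iP oneideal xc] ideal_prod_subset_left[OF iL iL'] XL by blast
  have iK: "ideal (adjoin R P L u) R" using adjoin_ideal[OF iP iL uc] .
  have LK: "L \<subseteq> saturation R Q (adjoin R P L u)"
  proof
    fix y assume y: "y \<in> L"
    have yc: "y \<in> carrier R" using y iL by (auto intro: ideal.Icarr)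
    \<comment> \<open>Since \<open>u\<close> is outside the prime \<open>P'\<close>, the coefficient
      of \<open>u\<close> falls into \<open>P'\<close> again, so the decomposition can be
      repeated.\<close>
    have loc: "\<exists>s p r. s \<in> carrier R - Q \<and> p \<in> P \<and> r \<in> carrier R \<and> r \<in> P' \<and> s \<otimes> z = p \<oplus> r \<otimes> u"
      if z: "z \<in> P'" for z
    proof -
      have zc: "z \<in> carrier R" using z iP' by (auto intro: ideal.Icarr)
      have "z \<in> saturation R Q (adjoin R P (carrier R) u)" using z P'(3) u(2) by blast
      then obtain s where s: "s \<in> carrier R - Q" "s \<otimes> z \<in> adjoin R P (carrier R) u"
        by (metis saturationE)
      then obtain p r where pr: "p \<in> P" "r \<in> carrier R" "s \<otimes> z = p \<oplus> r \<otimes> u" by (elim adjoinE)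
      have c: "s \<in> carrier R" "p \<in> carrier R" using s pr iP by (auto intro: ideal.Icarr)
      have "r \<otimes> u = s \<otimes> z \<ominus> p" unfolding pr(3) using c pr(2) uc by algebra
      also have "\<dots> \<in> P'" using ideal_mult[OF iP' c(1) z] pr(1) P'(2) by (intro ideal_minus[OF iP']) auto
      finally have "r \<in> P'" using primeideal.I_prime[OF P'(1)] pr(2) uc uP' by blast
      then show ?thesis using s pr by blast
    qed
    obtain s p r where 1: "s \<in> carrier R - Q" "p \<in> P" "r \<in> carrier R" "r \<in> P'" "s \<otimes> y = p \<oplus> r \<otimes> u"
      using loc L(2) y by blast
    obtain s' p' r' where 2: "s' \<in> carrier R - Q" "p' \<in> P" "r' \<in> carrier R" "s' \<otimes> r = p' \<oplus> r' \<otimes> u"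
      using loc 1(4) by blast
    have c: "s \<in> carrier R" "s' \<in> carrier R" "p \<in> carrier R" "p' \<in> carrier R"
      using 1 2 iP by (auto intro: ideal.Icarr)
    let ?p = "s' \<otimes> p \<oplus> u \<otimes> p'"
    have pP: "?p \<in> P" using ideal_mult[OF iP c(2) 1(2)] ideal_mult[OF iP uc 2(2)] by (rule ideal_add[OF iP])
    have pc: "?p \<in> carrier R" using c uc by simp
    have "(s' \<otimes> s) \<otimes> y = s' \<otimes> (s \<otimes> y)" using c yc by algebra
    also have "\<dots> = s' \<otimes> p \<oplus> (s' \<otimes> r) \<otimes> u" unfolding 1(5) using c 1(3) uc by algebra
    also have "\<dots> = ?p \<oplus> (r' \<otimes> u) \<otimes> u" unfolding 2(4) using c 2(3) uc by algebra
    finally have eq: "(s' \<otimes> s) \<otimes> y = ?p \<oplus> (r' \<otimes> u) \<otimes> u" .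
    have "(r' \<otimes> u) \<otimes> u = (?p \<oplus> (r' \<otimes> u) \<otimes> u) \<ominus> ?p" using pc 2(3) uc by algebra
    also have "\<dots> = (s' \<otimes> s) \<otimes> y \<ominus> ?p" unfolding eq ..
    also have "\<dots> \<in> L" using ideal_mult[OF iL _ y, of "s' \<otimes> s"] c pP PL by (intro ideal_minus[OF iL]) auto
    finally have "r' \<otimes> ((r' \<otimes> u) \<otimes> u) \<in> L" using ideal_mult[OF iL 2(3)] by blast
    \<comment> \<open>Two rounds of \<open>loc\<close> produce \<open>u^2\<close>: as
      \<open>r' u^2\<close> is in \<open>L\<close>, so is the square of \<open>r' u\<close>, and
      radicality gives \<open>r' u\<close> itself. This is the coefficient required in
      \<open>P + Lu\<close>.\<close>
    moreover have "(r' \<otimes> u) [^] (2::nat) = r' \<otimes> ((r' \<otimes> u) \<otimes> u)"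
      using 2(3) uc by (simp add: numeral_2_eq_2 m_ac)
    ultimately have ruL: "r' \<otimes> u \<in> L"
      using radical_ideal_powD[OF rL, of "r' \<otimes> u" "2"] 2(3) uc by simp
    have "(s' \<otimes> s) \<otimes> y \<in> adjoin R P L u" unfolding eq adjoin_def using pP ruL by blast
    then show "y \<in> saturation R Q (adjoin R P L u)"
      using yc primeideal_mult_notin[OF Q 2(1) 1(1)] by (intro saturationI[of _ "s' \<otimes> s"]) auto
  qed
  have iKX: "ideal (adjoin R P ?X u) R" using adjoin_ideal[OF iP iX uc] .
  have "adjoin R P L u \<cdot> ?L' \<subseteq> adjoin R P ?X u"
  proof (rule ideal_prod_subset[OF iKX])
    fix a b assume "a \<in> adjoin R P L u" and b: "b \<in> ?L'"
    then obtain p l where pl: "p \<in> P" "l \<in> L" "a = p \<oplus> l \<otimes> u" by (elim adjoinE)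
    have c: "p \<in> carrier R" "l \<in> carrier R" "b \<in> carrier R"
      using pl b iP iL iL' by (auto intro: ideal.Icarr)
    have "a \<otimes> b = b \<otimes> p \<oplus> (l \<otimes> b) \<otimes> u" unfolding pl(3) using c uc by algebra
    moreover have "l \<otimes> b \<in> ?X" unfolding XL using pl(2) b by (rule ideal_prod.prod)
    ultimately show "a \<otimes> b \<in> adjoin R P ?X u"
      using ideal_mult[OF iP c(3) pl(1)] unfolding adjoin_def by blast
  qed
  moreover have "?X \<subseteq> saturation R Q (adjoin R P L u \<cdot> ?L')"
    unfolding XL using LK saturation_superset[OF Q iL'] by (intro saturation_prod Q iK iL')
  ultimately have "?X \<subseteq> saturation R Q (adjoin R P ?X u)" using saturation_mono by blast
  then have "x \<in> saturation R Q (adjoin R P ?X u)" using adjoin_self[OF iP xc] by blast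
  then obtain s where s: "s \<in> carrier R - Q" "s \<otimes> x \<in> adjoin R P ?X u" by (metis saturationE)
  from s(2) obtain p y where py: "p \<in> P" "y \<in> ?X" "s \<otimes> x = p \<oplus> y \<otimes> u" by (rule adjoinE)
  obtain p' r where pr: "p' \<in> P" "r \<in> carrier R" "y = p' \<oplus> r \<otimes> x" using py(2) by (elim adjoinE)
  have c: "p \<in> carrier R" "p' \<in> carrier R" using py pr iP by (auto intro: ideal.Icarr)
  have "s \<otimes> x = (p \<oplus> u \<otimes> p') \<oplus> (r \<otimes> u) \<otimes> x" unfolding py(3) pr(3) using c pr(2) uc xc by algebra
  moreover have "p \<oplus> u \<otimes> p' \<in> P" using py(1) ideal_mult[OF iP uc pr(1)] by (rule ideal_add[OF iP])
  ultimately have "x \<in> saturation R Q P"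
    using saturation_absorb[OF iQ iP xc s(1) ideal_mult[OF iQ pr(2) u(1)]] by blast
  then show False using saturation_prime_subset[OF P] P'(2,3) x(2) by blast
qed

end

theorem sp_domain_primeideal_maximal:
  fixes R (structure)
  assumes sp: "sp_domain R" and N0: "primeideal N R" "N \<noteq> {\<zero>}"
  shows "maximalideal N R"
proof (rule ccontr)
  interpret domain R using sp by (rule sp_domain_domain)
  assume "\<not> maximalideal N R"
  then obtain J where J: "ideal J R" "N \<subseteq> J" "J \<noteq> N" "J \<noteq> carrier R"
    using maximalidealI[OF primeideal_ideal[OF N0(1)] primeideal.I_notcarr[OF N0(1)]] by blast
  obtain Z where Z: "primeideal Z R" "J \<subseteq> Z" using exists_primeideal_superset J by blast
  \<comment> \<open>Minimality of \<open>P\<close> over a nonzero \<open>a0\<close> makes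
    \<open>P\<close> locally the radical of \<open>(a0)\<close>, so that the zero ideal can serve as
    the smaller prime in \<open>sp_domain_locally_principal\<close>.\<close>
  obtain a0 where a0: "a0 \<in> N" "a0 \<noteq> \<zero>" using N0 ideal_zero[OF primeideal_ideal[OF N0(1)]] by blast
  have a0c: "a0 \<in> carrier R" using a0 N0 by (auto intro: ideal.Icarr primeideal_ideal)
  let ?I0 = "adjoin R {\<zero>} (carrier R) a0"
  have iI0: "ideal ?I0 R" using adjoin_ideal[OF zeroideal oneideal a0c] .
  have "?I0 \<subseteq> N" using a0(1) ideal_zero[OF primeideal_ideal[OF N0(1)]]
    by (intro adjoin_carrier_least primeideal_ideal N0) auto
  then obtain P where P: "primeideal P R" "?I0 \<subseteq> P" "P \<subseteq> N"
    and Pmin: "\<And>P'. primeideal P' R \<Longrightarrow> ?I0 \<subseteq> P' \<Longrightarrow> P' \<subseteq> P \<Longrightarrow> P' = P"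
    using exists_minimal_primeideal[OF N0(1)] by metis
  have iP: "ideal P R" using P by (auto intro: primeideal_ideal)
  have iPP: "ideal (P \<cdot> P) R" using ideal_prod_is_ideal[OF iP iP] .
  have "a0 \<in> P" using adjoin_self[OF zeroideal a0c] P(2) by blast
  then obtain a where a: "a \<in> P" "a \<noteq> \<zero>" and
    Pa: "P \<subseteq> saturation R P (adjoin R {\<zero>} (carrier R) a)"
    using sp_domain_locally_principal[OF sp zeroprimeideal P(1), of a0] a0(2) ideal_zero[OF iP]
      minimal_primeideal_locally_radical[OF P(1) iI0 P(2) Pmin] by auto
  have ac: "a \<in> carrier R" using a iP by (auto intro: ideal.Icarr)
  \<comment> \<open>At \<open>P\<close> the square of \<open>P\<close> is \<open>Pa\<close>. If it
    contained \<open>a\<close>, Nakayama would put \<open>a\<close> into the zero ideal.\<close>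
  have aPP: "a \<notin> saturation R P (P \<cdot> P)"
  proof
    assume "a \<in> saturation R P (P \<cdot> P)"
    moreover have "P \<cdot> P \<subseteq> saturation R P (P \<cdot> adjoin R {\<zero>} (carrier R) a)"
      using saturation_superset[OF P(1) iP] Pa adjoin_ideal[OF zeroideal oneideal ac]
      by (intro saturation_prod P iP)
    moreover have "P \<cdot> adjoin R {\<zero>} (carrier R) a \<subseteq> adjoin R {\<zero>} P a"
    proof (rule ideal_prod_subset[OF adjoin_ideal[OF zeroideal iP ac]])
      fix x y assume x: "x \<in> P" and "y \<in> adjoin R {\<zero>} (carrier R) a"
      then obtain r where r: "r \<in> carrier R" "y = \<zero> \<oplus> r \<otimes> a" by (auto elim: adjoinE)
      have xc: "x \<in> carrier R" using x iP by (auto intro: ideal.Icarr)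
      have "x \<otimes> y = (r \<otimes> x) \<otimes> a" unfolding r(2) using r(1) xc ac by algebra
      then show "x \<otimes> y \<in> adjoin R {\<zero>} P a"
        using adjoin_mult[OF zeroideal ideal_mult[OF iP r(1) x], of a] r(1) xc ac by simp
    qed
    ultimately have "a \<in> saturation R P (adjoin R {\<zero>} P a)"
      using saturation_mono saturation_least[OF P(1)] by blast
    then obtain s where s: "s \<in> carrier R - P" "s \<otimes> a \<in> adjoin R {\<zero>} P a" by (metis saturationE)
    then obtain p where p: "p \<in> P" "s \<otimes> a = \<zero> \<oplus> p \<otimes> a" by (auto elim: adjoinE)
    have "a \<in> saturation R P {\<zero>}"
      using saturation_absorb[OF iP zeroideal ac s(1) p(1) _ p(2)] by simp
    then show False using saturation_prime_subset[OF zeroprimeideal, of P] ideal_zero[OF iP] a(2) by auto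
  qed
  \<comment> \<open>This \<open>t\<close> shows that \<open>Z\<close> is strictly above
    \<open>P\<close>. A minimal prime \<open>Q\<close> over \<open>P + (t)\<close> inside
    \<open>Z\<close> gives the adjacent pair.\<close>
  obtain t where t: "t \<in> Z" "t \<notin> P" using J(2,3) Z(2) P(3) by blast
  have tc: "t \<in> carrier R" using t Z by (auto intro: ideal.Icarr primeideal_ideal)
  let ?I1 = "adjoin R P (carrier R) t"
  have iI1: "ideal ?I1 R" using adjoin_ideal[OF iP oneideal tc] .
  have "?I1 \<subseteq> Z" using t(1) J(2) Z(2) P(3) by (intro adjoin_carrier_least primeideal_ideal Z) auto
  then obtain Q where Q: "primeideal Q R" "?I1 \<subseteq> Q"
    and Qmin: "\<And>P'. primeideal P' R \<Longrightarrow> ?I1 \<subseteq> P' \<Longrightarrow> P' \<subseteq> Q \<Longrightarrow> P' = Q"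
    using exists_minimal_primeideal[OF Z(1)] by metis
  have iQ: "ideal Q R" using Q by (auto intro: primeideal_ideal)
  have PQ: "P \<subseteq> Q" using adjoin_subset[OF iP oneideal tc] Q(2) by blast
  have tQ: "t \<in> Q" using adjoin_self[OF iP tc] Q(2) by blast
  obtain u where u: "u \<in> Q" "u \<notin> P" and Qu: "Q \<subseteq> saturation R Q (adjoin R P (carrier R) u)"
    using sp_domain_locally_principal[OF sp P(1) Q(1) PQ tQ t(2)
      minimal_primeideal_locally_radical[OF Q(1) iI1 Q(2) Qmin]] by blast
  have uc: "u \<in> carrier R" using u iQ by (auto intro: ideal.Icarr)
  have uuc: "u \<otimes> u \<in> carrier R" using uc by simp
  let ?U = "adjoin R P (carrier R) u"
  have iU: "ideal ?U R" using adjoin_ideal[OF iP oneideal uc] .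
  let ?U2 = "adjoin R P (carrier R) (u \<otimes> u)"
  have iU2: "ideal ?U2 R" using adjoin_ideal[OF iP oneideal uuc] .
  have U2Q: "?U2 \<subseteq> Q" using ideal_mult[OF iQ uc u(1)] by (intro adjoin_carrier_least iQ PQ)
  have "locally_radical_eq R Q ?U"
    unfolding locally_radical_eq_def
  proof
    fix x assume x: "x \<in> Q"
    then obtain s where s: "s \<in> carrier R - Q" "s \<otimes> x \<in> ?U" using Qu by (metis saturationE subsetD)
    have "x \<in> carrier R" using x iQ by (auto intro: ideal.Icarr)
    then have "s \<otimes> x [^] (1::nat) \<in> ?U" using s by simp
    then show "\<exists>s\<in>carrier R - Q. \<exists>n::nat. s \<otimes> x [^] n \<in> ?U" using s(1) by blast
  qed
  then obtain k where k: "k \<ge> 1" "?U2 \<subseteq> ideal_power R Q k" "ideal_power R Q k \<subseteq> saturation R Q ?U2"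
    using sp_domain_locally_power[OF sp Q(1) iU2 U2Q] locally_radical_eq_square[OF Q(1) iP uc] by blast
  have "k \<noteq> 1"
  proof
    assume "k = 1"
    then have "u \<in> saturation R Q ?U2" using k(3) u(1) ideal_power_1[OF iQ] by auto
    then obtain s where s: "s \<in> carrier R - Q" "s \<otimes> u \<in> ?U2" by (metis saturationE)
    then obtain p r where pr: "p \<in> P" "r \<in> carrier R" "s \<otimes> u = p \<oplus> r \<otimes> (u \<otimes> u)" by (elim adjoinE)
    have "s \<otimes> u = p \<oplus> (r \<otimes> u) \<otimes> u" using pr uc by (simp add: m_assoc)
    then have "u \<in> saturation R Q P"
      using saturation_absorb[OF iQ iP uc s(1) ideal_mult[OF iQ pr(2) u(1)] pr(1)] by blast
    then show False using saturation_prime_subset[OF P(1) PQ] u(2) by blast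
  qed
  then have "ideal_power R Q k \<subseteq> Q \<cdot> Q" using k(1) by (intro ideal_power_subset_square iQ) simp
  then have PQQ: "P \<subseteq> Q \<cdot> Q" using k(2) adjoin_subset[OF iP oneideal uuc] by blast
  let ?W = "adjoin R (P \<cdot> P) P u"
  have iW: "ideal ?W R" using adjoin_ideal[OF iPP iP uc] .
  have WPQ: "?W \<subseteq> P \<cdot> Q"
    using ideal_prod_mono[OF order_refl PQ] u(1)
    by (intro adjoin_least ideal_prod_is_ideal iP iQ ideal_prod.prod)
  have WP: "?W \<subseteq> P" using WPQ ideal_prod_subset_left[OF iP iQ] by blast
  let ?W2 = "adjoin R ?W (carrier R) (u \<otimes> u)"
  have iW2: "ideal ?W2 R" using adjoin_ideal[OF iW oneideal uuc] .
  have "?U \<cdot> ?U \<subseteq> ?W2"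
  proof (rule ideal_prod_subset[OF iW2])
    fix x y assume "x \<in> ?U" "y \<in> ?U"
    then obtain p r p' r' where pr: "p \<in> P" "r \<in> carrier R" "x = p \<oplus> r \<otimes> u"
      "p' \<in> P" "r' \<in> carrier R" "y = p' \<oplus> r' \<otimes> u" by (metis adjoinE)
    have c: "p \<in> carrier R" "p' \<in> carrier R" using pr iP by (auto intro: ideal.Icarr)
    have "x \<otimes> y = (p \<otimes> p' \<oplus> (r' \<otimes> p \<oplus> r \<otimes> p') \<otimes> u) \<oplus> (r \<otimes> r') \<otimes> (u \<otimes> u)"
      unfolding pr(3,6) using c pr(2,5) uc by algebra
    moreover have "r' \<otimes> p \<oplus> r \<otimes> p' \<in> P"
      using ideal_mult[OF iP pr(5,1)] ideal_mult[OF iP pr(2,4)] by (rule ideal_add[OF iP])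
    moreover have "p \<otimes> p' \<in> P \<cdot> P" using pr(1,4) by (rule ideal_prod.prod)
    moreover have "r \<otimes> r' \<in> carrier R" using pr by simp
    ultimately show "x \<otimes> y \<in> ?W2" unfolding adjoin_def by blast
  qed
  moreover have "Q \<cdot> Q \<subseteq> saturation R Q (?U \<cdot> ?U)" by (intro saturation_prod Q iU Qu)
  ultimately have PW2: "P \<subseteq> saturation R Q ?W2" using PQQ saturation_mono by blast
  \<comment> \<open>In \<open>s x = w + r u^2\<close> both \<open>s x\<close> and \<open>w\<close>
    are in \<open>P\<close>. As \<open>u\<close> is not, \<open>r\<close> must be in
    \<open>P\<close>, which moves \<open>r u^2\<close> into \<open>?W\<close>.\<close>
  have "P \<subseteq> saturation R Q ?W"
  proof
    fix x assume x: "x \<in> P"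
    have xc: "x \<in> carrier R" using x iP by (auto intro: ideal.Icarr)
    have "x \<in> saturation R Q ?W2" using PW2 x by blast
    then obtain s where s: "s \<in> carrier R - Q" "s \<otimes> x \<in> ?W2" by (metis saturationE)
    obtain w r where wr: "w \<in> ?W" "r \<in> carrier R" "s \<otimes> x = w \<oplus> r \<otimes> (u \<otimes> u)"
      using s(2) by (rule adjoinE)
    have c: "w \<in> carrier R" "s \<in> carrier R" using wr iW s by (auto intro: ideal.Icarr)
    have "r \<otimes> (u \<otimes> u) = s \<otimes> x \<ominus> w" unfolding wr(3) using c wr(2) uc by algebra
    also have "\<dots> \<in> P" using ideal_mult[OF iP c(2) x] wr(1) WP by (intro ideal_minus[OF iP]) auto
    finally have "r \<in> P" using primeideal.I_prime[OF P(1)] wr(2) uc uuc u(2) by blast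
    then have "r \<otimes> u \<in> P" using iP uc by (simp add: ideal.I_r_closed)
    then have "(r \<otimes> u) \<otimes> u \<in> ?W" using wr(2) uc by (intro adjoin_mult iPP) auto
    then have "r \<otimes> (u \<otimes> u) \<in> ?W" using wr(2) uc by (simp add: m_assoc)
    then have "s \<otimes> x \<in> ?W" unfolding wr(3) using wr(1) ideal_add[OF iW] by blast
    then show "x \<in> saturation R Q ?W" using xc s by (intro saturationI)
  qed
  then have PPQ: "P \<subseteq> saturation R Q (P \<cdot> Q)" using saturation_mono[OF WPQ] by blast
  have uac: "u \<otimes> a \<in> carrier R" using uc ac by simp
  \<comment> \<open>Containing the square of \<open>P\<close> forces every radical factor above
    \<open>P\<close>. The generator \<open>u a\<close> keeps \<open>?I\<close> from lying in the
    square of \<open>P\<close>, because \<open>u\<close> is invertible at \<open>P\<close>; so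
    \<open>P\<close> can occur only once.\<close>
  let ?I = "adjoin R (P \<cdot> P) (carrier R) (u \<otimes> a)"
  have iI: "ideal ?I R" using adjoin_ideal[OF iPP oneideal uac] .
  have IP: "?I \<subseteq> P" using ideal_prod_subset_left[OF iP iP] ideal_mult[OF iP uc a(1)]
    by (intro adjoin_carrier_least iP)
  obtain Ls where Ls: "\<forall>L\<in>set Ls. radical_ideal L R" "?I = ideal_prod_list R Ls"
    using sp_domain_factor[OF sp iI] .
  have id: "\<forall>L\<in>set Ls. ideal L R" using Ls by (auto intro: radical_ideal_ideal)
  have PL: "P \<subseteq> L" if L: "L \<in> set Ls" for L
  proof
    fix x assume x: "x \<in> P"
    have xc: "x \<in> carrier R" using x iP by (auto intro: ideal.Icarr)
    have "x [^] (2::nat) = x \<otimes> x" using xc by (simp add: numeral_2_eq_2)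
    also have "\<dots> \<in> P \<cdot> P" using x x by (rule ideal_prod.prod)
    also have "\<dots> \<subseteq> ?I" using adjoin_subset[OF iPP oneideal uac] .
    also have "\<dots> \<subseteq> L" unfolding Ls(2) using ideal_prod_list_subset[OF id L] .
    finally show "x \<in> L" using radical_ideal_powD Ls(1) L xc by blast
  qed
  have PLs: "P \<in> set Ls"
    using ideal_prod_list_subset_prime[OF P(1) id] IP Ls(2) PL by (metis subset_antisym)
  let ?Ls' = "remove1 P Ls"
  have id': "\<forall>L\<in>set ?Ls'. ideal L R" using id by (auto dest: notin_set_remove1)
  let ?L' = "ideal_prod_list R ?Ls'"
  have iL': "ideal ?L' R" using id' by (rule ideal_prod_list_ideal)
  have IPL: "?I = P \<cdot> ?L'" unfolding Ls(2) using ideal_prod_list_remove1[OF id PLs] .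
  have PnLs: "P \<notin> set ?Ls'"
  proof
    assume "P \<in> set ?Ls'"
    then have "?I \<subseteq> P \<cdot> P"
      unfolding IPL using ideal_prod_list_subset[OF id'] by (intro ideal_prod_mono order_refl)
    then have "u \<otimes> a \<in> P \<cdot> P" using adjoin_self[OF iPP uac] by blast
    then show False using saturationI[OF ac, of u P] uc u(2) aPP by blast
  qed
  have "\<forall>L\<in>set ?Ls'. L \<subseteq> Q \<longrightarrow> Q \<subseteq> saturation R Q L"
  proof (intro ballI impI)
    fix L assume L: "L \<in> set ?Ls'" and LQ: "L \<subseteq> Q"
    have LLs: "L \<in> set Ls" using L notin_set_remove1[of L Ls P] by blast
    have PsL: "P \<subset> L" using PL[OF LLs] PnLs L by blast
    \<comment> \<open>A prime between \<open>L\<close> and \<open>Q\<close> lies strictly above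
      \<open>P\<close>, hence equals \<open>Q\<close> by adjacency.\<close>
    have "locally_radical_eq R Q L"
    proof (rule minimal_primeideal_locally_radical[OF Q(1) _ LQ])
      show "ideal L R" using id LLs by blast
      fix P' assume "primeideal P' R" "L \<subseteq> P'" "P' \<subseteq> Q"
      then show "P' = Q" using sp_domain_no_primeideal_between[OF sp P(1) Q(1) u(1) Qu] PsL by blast
    qed
    then show "Q \<subseteq> saturation R Q L" using radical_ideal_locally_radical iQ Ls(1) LLs by blast
  qed
  then obtain m where m: "ideal_power R Q m \<subseteq> saturation R Q ?L'"
    using ideal_prod_list_saturation[OF Q(1) id'] by blast
  have PQm: "P \<subseteq> saturation R Q (P \<cdot> ideal_power R Q n)" for n
  proof (induction n)
    case 0
    then show ?case using saturation_superset[OF Q(1) iP] ideal_prod_one[OF iP] by (simp add: ideal_power_0)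
  next
    case (Suc n)
    have iQn: "ideal (ideal_power R Q n) R" using ideal_power_ideal[OF iQ] .
    have "P \<cdot> ideal_power R Q n \<subseteq> saturation R Q ((P \<cdot> Q) \<cdot> ideal_power R Q n)"
      using saturation_superset[OF Q(1) iQn] by (intro saturation_prod Q ideal_prod_is_ideal iP iQ iQn PPQ)
    then have "saturation R Q (P \<cdot> ideal_power R Q n) \<subseteq> saturation R Q (P \<cdot> ideal_power R Q (Suc n))"
      unfolding ideal_power_Suc ideal_prod_assoc[OF iP iQ iQn] by (rule saturation_least[OF Q(1)])
    then show ?case using Suc by blast
  qed
  have "P \<cdot> ideal_power R Q m \<subseteq> saturation R Q ?I"
    unfolding IPL using saturation_superset[OF Q(1) iP] m by (intro saturation_prod Q iP iL')
  then have "P \<subseteq> saturation R Q ?I" using PQm[of m] saturation_least[OF Q(1)] by blast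
  then have "a \<in> saturation R Q ?I" using a(1) by blast
  then obtain s where s: "s \<in> carrier R - Q" "s \<otimes> a \<in> ?I" by (metis saturationE)
  then obtain y r where yr: "y \<in> P \<cdot> P" "r \<in> carrier R" "s \<otimes> a = y \<oplus> r \<otimes> (u \<otimes> a)" by (elim adjoinE)
  have "s \<otimes> a = y \<oplus> (r \<otimes> u) \<otimes> a" using yr uc ac by (simp add: m_assoc)
  then have "a \<in> saturation R Q (P \<cdot> P)"
    using saturation_absorb[OF iQ iPP ac s(1) ideal_mult[OF iQ yr(2) u(1)] yr(1)] by blast
  \<comment> \<open>Denominators outside \<open>Q\<close> are also outside \<open>P\<close>, so this
    local membership at \<open>Q\<close> contradicts the one excluded at \<open>P\<close>.\<close>
  then show False using aPP PQ by (auto simp: saturation_def)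
qed

section \<open>Factorization at a principal maximal ideal\<close>

definition scale :: "('a, 'b) ring_scheme \<Rightarrow> 'a \<Rightarrow> 'a set \<Rightarrow> 'a set" where
  "scale R a I = (\<lambda>x. a \<otimes>\<^bsub>R\<^esub> x) ` I"

lemma maximalideal_ideal: "maximalideal N R \<Longrightarrow> ideal N R"
  by (simp add: maximalideal.axioms(1))

section \<open>Products of maximal ideals and multiples of ideals by an element\<close>

context cring
begin

lemma maximalideal_eq:
  assumes "maximalideal N R" "ideal J R" "N \<subseteq> J" "\<one> \<notin> J"
  shows "J = N"
  using maximalideal.I_maximal[OF assms(1,2,3) ideal_subset[OF assms(2)]] assms(4) by auto

lemma maximalideal_primeideal: "maximalideal N R \<Longrightarrow> primeideal N R"
  by (rule maximalideal_prime)

lemma ideal_prod_list_append: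
  assumes "\<forall>I\<in>set Is. ideal I R" "\<forall>J\<in>set Js. ideal J R"
  shows "ideal_prod_list R (Is @ Js) = ideal_prod_list R Is \<cdot> ideal_prod_list R Js"
  using assms
proof (induction Is)
  case Nil
  then show ?case
    using ideal_prod_one ideal_prod_commute[OF oneideal] ideal_prod_list_ideal[of Js]
    by (simp add: ideal_prod_list_Nil)
next
  case (Cons I Is)
  then show ?case using ideal_prod_list_ideal[of Is] ideal_prod_list_ideal[of Js]
    by (simp add: ideal_prod_list_Cons ideal_prod_assoc)
qed

text \<open>Chinese remainder argument: \<open>N\<close> is comaximal with the product of the
  others, since otherwise it would contain, and hence equal, one of them. Intersecting with
  \<open>carrier R\<close> gives the empty list its correct value.\<close>

lemma ideal_prod_list_maximalideals:
  "distinct Ns \<Longrightarrow> \<forall>N\<in>set Ns. maximalideal N R \<Longrightarrow>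
    ideal_prod_list R Ns = carrier R \<inter> \<Inter>(set Ns)"
proof (induction Ns)
  case Nil
  then show ?case by (simp add: ideal_prod_list_Nil)
next
  case (Cons N Ns)
  have N: "maximalideal N R" "ideal N R" using Cons.prems by (auto intro: maximalideal_ideal)
  let ?J = "ideal_prod_list R Ns"
  have id: "\<forall>I\<in>set Ns. ideal I R" using Cons.prems by (auto intro: maximalideal_ideal)
  have J: "ideal ?J R" using id by (rule ideal_prod_list_ideal)
  have S: "ideal (set_add R N ?J) R" using add_ideals N J by blast
  have NS: "N \<subseteq> set_add R N ?J"
  proof
    fix x assume x: "x \<in> N"
    then have "x = x \<oplus> \<zero>" using N by (simp add: ideal.Icarr)
    then show "x \<in> set_add R N ?J" using x ideal_zero[OF J] unfolding set_add_def' by blast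
  qed
  have JS: "?J \<subseteq> set_add R N ?J"
  proof
    fix x assume x: "x \<in> ?J"
    then have "x = \<zero> \<oplus> x" using J by (simp add: ideal.Icarr)
    then show "x \<in> set_add R N ?J" using x ideal_zero[OF N(2)] unfolding set_add_def' by blast
  qed
  have "\<not> ?J \<subseteq> N"
  proof
    assume "?J \<subseteq> N"
    then obtain I where I: "I \<in> set Ns" "I \<subseteq> N"
      using ideal_prod_list_subset_prime[OF maximalideal_primeideal[OF N(1)] id] by blast
    then have "N = I"
      using maximalideal_eq[of I N] N primeideal_notone[OF maximalideal_primeideal[OF N(1)]] Cons.prems
      by auto
    then show False using I Cons.prems by simp
  qed
  then have "set_add R N ?J = carrier R"
    using maximalideal.I_maximal[OF N(1) S NS ideal_subset[OF S]] JS by blast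
  then have "N \<cdot> ?J = N \<inter> ?J" by (rule ideal_prod_eq_inter[OF N(2) J])
  then show ?case using Cons ideal_subset[OF N(2)] by (auto simp: ideal_prod_list_Cons)
qed

lemma ideal_prod_list_refine:
  "\<forall>L\<in>set Ls. \<exists>Ps. (\<forall>P\<in>set Ps. primeideal P R) \<and> L = ideal_prod_list R Ps \<Longrightarrow>
    \<exists>Ps. (\<forall>P\<in>set Ps. primeideal P R) \<and> ideal_prod_list R Ls = ideal_prod_list R Ps"
proof (induction Ls)
  case Nil
  show ?case by (rule exI[of _ "[]"]) simp
next
  case (Cons L Ls)
  then obtain Ps Ps' where *: "\<forall>P\<in>set Ps. primeideal P R" "L = ideal_prod_list R Ps"
    "\<forall>P\<in>set Ps'. primeideal P R" "ideal_prod_list R Ls = ideal_prod_list R Ps'" by auto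
  then have "ideal_prod_list R (L # Ls) = ideal_prod_list R (Ps @ Ps')"
    by (simp add: ideal_prod_list_Cons ideal_prod_list_append primeideal_ideal)
  then show ?case using * by (intro exI[of _ "Ps @ Ps'"]) auto
qed

lemma scale_ideal:
  assumes a: "a \<in> carrier R" and I: "ideal I R"
  shows "ideal (scale R a I) R"
proof (rule idealI_cring)
  note c = ideal.Icarr[OF I]
  show "scale R a I \<subseteq> carrier R" using a c by (auto simp: scale_def)
  have "\<zero> = a \<otimes> \<zero>" using a by simp
  then show "\<zero> \<in> scale R a I" using ideal_zero[OF I] by (auto simp: scale_def)
next
  note c = ideal.Icarr[OF I]
  fix x y assume "x \<in> scale R a I" "y \<in> scale R a I"
  then obtain x' y' where *: "x = a \<otimes> x'" "y = a \<otimes> y'" "x' \<in> I" "y' \<in> I" by (auto simp: scale_def)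
  then have "x \<oplus> y = a \<otimes> (x' \<oplus> y')" using a c by (simp add: r_distr)
  then show "x \<oplus> y \<in> scale R a I" using ideal_add[OF I *(3,4)] by (auto simp: scale_def)
next
  note c = ideal.Icarr[OF I]
  fix r x assume r: "r \<in> carrier R" and "x \<in> scale R a I"
  then obtain x' where *: "x = a \<otimes> x'" "x' \<in> I" by (auto simp: scale_def)
  then have "r \<otimes> x = a \<otimes> (r \<otimes> x')" using a c r by (simp add: m_ac)
  then show "r \<otimes> x \<in> scale R a I" using ideal_mult[OF I r *(2)] by (auto simp: scale_def)
qed

lemma scale_scale:
  "a \<in> carrier R \<Longrightarrow> b \<in> carrier R \<Longrightarrow> I \<subseteq> carrier R \<Longrightarrow> scale R a (scale R b I) = scale R (a \<otimes> b) I"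
  unfolding scale_def image_image by (intro image_cong) (auto simp: m_assoc)

lemma scale_one: "I \<subseteq> carrier R \<Longrightarrow> scale R \<one> I = I"
  by (force simp: scale_def)

lemma scale_prod_left:
  assumes a: "a \<in> carrier R" and I: "ideal I R" and J: "ideal J R"
  shows "scale R a I \<cdot> J = scale R a (I \<cdot> J)"
proof
  note c = ideal.Icarr[OF I] ideal.Icarr[OF J]
  show "scale R a I \<cdot> J \<subseteq> scale R a (I \<cdot> J)"
  proof (rule ideal_prod_subset)
    show "ideal (scale R a (I \<cdot> J)) R" by (intro scale_ideal a ideal_prod_is_ideal I J)
    fix x y assume "x \<in> scale R a I" and y: "y \<in> J"
    then obtain x' where x: "x = a \<otimes> x'" "x' \<in> I" by (auto simp: scale_def)
    then have "x \<otimes> y = a \<otimes> (x' \<otimes> y)" using a c y by (simp add: m_assoc)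
    then show "x \<otimes> y \<in> scale R a (I \<cdot> J)" using ideal_prod.prod[OF x(2) y] by (auto simp: scale_def)
  qed
  have "a \<otimes> z \<in> scale R a I \<cdot> J" if "z \<in> I \<cdot> J" for z
    using that
  proof induct
    case (prod i j)
    then have "a \<otimes> (i \<otimes> j) = (a \<otimes> i) \<otimes> j" using a c by (simp add: m_assoc)
    moreover have "a \<otimes> i \<in> scale R a I" using prod by (simp add: scale_def)
    ultimately show ?case using prod by (simp add: ideal_prod.prod)
  next
    case (sum x y)
    then have "x \<in> carrier R" "y \<in> carrier R" using ideal_prod_in_carrier[OF I J] by auto
    then have "a \<otimes> (x \<oplus> y) = a \<otimes> x \<oplus> a \<otimes> y" using a by (simp add: r_distr)
    then show ?case using sum by (simp add: ideal_prod.sum)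
  qed
  then show "scale R a (I \<cdot> J) \<subseteq> scale R a I \<cdot> J" by (auto simp: scale_def)
qed

lemma scale_prod_right:
  "a \<in> carrier R \<Longrightarrow> ideal I R \<Longrightarrow> ideal J R \<Longrightarrow> I \<cdot> scale R a J = scale R a (I \<cdot> J)"
  by (metis ideal_prod_commute scale_ideal scale_prod_left)

lemma cgenideal_eq_scale: "a \<in> carrier R \<Longrightarrow> PIdl a = scale R a (carrier R)"
  by (auto simp: cgenideal_def scale_def m_comm)

lemma cgenideal_prod_eq_scale:
  assumes "a \<in> carrier R" "ideal J R"
  shows "(PIdl a) \<cdot> J = scale R a J"
  using assms ideal_prod_one[OF assms(2)] ideal_prod_commute[OF assms(2) oneideal]
  by (simp add: cgenideal_eq_scale scale_prod_left oneideal)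

end

section \<open>Invertibility of principal ideals and a criterion for Dedekind domains\<close>

context domain
begin

lemma cgenideal_invertible:
  assumes a: "a \<in> carrier R" "a \<noteq> \<zero>"
  shows "invertible_ideal (PIdl a) R"
proof -
  let ?K = "quotient_field R" and ?e = "frac_embed R"
  interpret K: field ?K by (rule quotient_field_field)
  interpret e: ring_hom_ring R ?K ?e
    using ring_axioms K.ring_axioms frac_embed_hom by (rule ring_hom_ringI2)
  \<comment> \<open>The fraction \<open>1/a\<close>; its multiples \<open>F\<close> form the inverse
    of the principal ideal, with \<open>a\<close> as common denominator.\<close>
  define c where "c = frac_class R \<one> a"
  have cK: "c \<in> carrier ?K" unfolding c_def quotient_field_simps using a one_not_zero by blast
  have ec: "?e a \<otimes>\<^bsub>?K\<^esub> c = \<one>\<^bsub>?K\<^esub>"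
    using a by (simp add: c_def frac_embed_def quotient_field_mult quotient_field_simps frac_class_eq_iff)
  define F where "F = (\<lambda>r. ?e r \<otimes>\<^bsub>?K\<^esub> c) ` carrier R"
  have aF: "?e a \<otimes>\<^bsub>?K\<^esub> (?e r \<otimes>\<^bsub>?K\<^esub> c) = ?e r" if "r \<in> carrier R" for r
  proof -
    have "?e a \<otimes>\<^bsub>?K\<^esub> (?e r \<otimes>\<^bsub>?K\<^esub> c) = ?e r \<otimes>\<^bsub>?K\<^esub> (?e a \<otimes>\<^bsub>?K\<^esub> c)"
      using that a cK by (intro K.m_lcomm) auto
    then show ?thesis using that ec by simp
  qed
  have "subgroup F (add_monoid ?K)"
  proof (rule K.add.subgroupI)
    show "F \<subseteq> carrier ?K" "F \<noteq> {}" using cK by (auto simp: F_def)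
    fix x y assume "x \<in> F" "y \<in> F"
    then obtain r s where *: "r \<in> carrier R" "s \<in> carrier R" "x = ?e r \<otimes>\<^bsub>?K\<^esub> c" "y = ?e s \<otimes>\<^bsub>?K\<^esub> c"
      by (auto simp: F_def)
    then have "x \<oplus>\<^bsub>?K\<^esub> y = ?e (r \<oplus> s) \<otimes>\<^bsub>?K\<^esub> c" using cK by (simp add: K.l_distr)
    then show "x \<oplus>\<^bsub>?K\<^esub> y \<in> F" using * unfolding F_def by blast
    have "\<ominus>\<^bsub>?K\<^esub> x = ?e (\<ominus> r) \<otimes>\<^bsub>?K\<^esub> c" using * cK by (simp add: K.l_minus)
    then show "\<ominus>\<^bsub>?K\<^esub> x \<in> F" using * unfolding F_def by blast
  qed
  then have "additive_subgroup F ?K" by (rule additive_subgroupI)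
  moreover have "?e r \<otimes>\<^bsub>?K\<^esub> x \<in> F" if "r \<in> carrier R" "x \<in> F" for r x
  proof -
    obtain s where s: "s \<in> carrier R" "x = ?e s \<otimes>\<^bsub>?K\<^esub> c" using \<open>x \<in> F\<close> by (auto simp: F_def)
    then have "?e r \<otimes>\<^bsub>?K\<^esub> x = ?e (r \<otimes> s) \<otimes>\<^bsub>?K\<^esub> c" using \<open>r \<in> carrier R\<close> cK by (simp add: K.m_assoc)
    then show ?thesis using s \<open>r \<in> carrier R\<close> unfolding F_def by blast
  qed
  moreover have "\<forall>x\<in>F. ?e a \<otimes>\<^bsub>?K\<^esub> x \<in> ?e ` carrier R" using aF by (auto simp: F_def)
  ultimately have "fractional_ideal F R" unfolding fractional_ideal_def using a by blast
  moreover have "ideal_prod ?K (?e ` (PIdl a)) F = ?e ` carrier R"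
  proof
    show "ideal_prod ?K (?e ` (PIdl a)) F \<subseteq> ?e ` carrier R"
    proof
      fix z assume "z \<in> ideal_prod ?K (?e ` (PIdl a)) F"
      then show "z \<in> ?e ` carrier R"
      proof induct
        case (prod i j)
        then obtain x r where *: "x \<in> carrier R" "i = ?e (x \<otimes> a)" "r \<in> carrier R" "j = ?e r \<otimes>\<^bsub>?K\<^esub> c"
          by (auto simp: F_def cgenideal_def)
        then have "i \<otimes>\<^bsub>?K\<^esub> j = ?e x \<otimes>\<^bsub>?K\<^esub> ?e r" using a cK by (simp add: K.m_assoc aF)
        also have "\<dots> = ?e (x \<otimes> r)" using * by simp
        finally show ?case using * by blast
      next
        case (sum x y)
        then obtain r s where "r \<in> carrier R" "s \<in> carrier R" "x = ?e r" "y = ?e s" by blast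
        then have "x \<oplus>\<^bsub>?K\<^esub> y = ?e (r \<oplus> s)" "r \<oplus> s \<in> carrier R" by auto
        then show ?case by blast
      qed
    qed
    show "?e ` carrier R \<subseteq> ideal_prod ?K (?e ` (PIdl a)) F"
    proof
      fix z assume "z \<in> ?e ` carrier R"
      then obtain r where r: "r \<in> carrier R" "z = ?e r" by blast
      then have "z = ?e a \<otimes>\<^bsub>?K\<^esub> (?e r \<otimes>\<^bsub>?K\<^esub> c)" by (simp add: aF)
      moreover have "?e a \<in> ?e ` (PIdl a)" "?e r \<otimes>\<^bsub>?K\<^esub> c \<in> F"
        using r a cgenideal_self by (auto simp: F_def)
      ultimately show "z \<in> ideal_prod ?K (?e ` (PIdl a)) F" using ideal_prod.prod by metis
    qed
  qed
  ultimately show ?thesis unfolding invertible_ideal_def using cgenideal_ideal a by blast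
qed

text \<open>A nonzero radical ideal is the intersection of the primes above it. These are maximal,
  so finiteness turns the intersection into a product. The zero ideal is prime and factors as
  itself.\<close>

lemma dedekind_domainI:
  assumes sp: "sp_domain R"
    and fin: "\<And>I. ideal I R \<Longrightarrow> I \<noteq> {\<zero>} \<Longrightarrow> finite {N. maximalideal N R \<and> I \<subseteq> N}"
  shows "dedekind_domain R"
  unfolding dedekind_domain_def
proof (intro conjI allI impI)
  show "domain R" by (rule domain_axioms)
  fix I assume I: "ideal I R"
  show "\<exists>Ps. (\<forall>P\<in>set Ps. primeideal P R) \<and> I = ideal_prod_list R Ps"
  proof (cases "I = {\<zero>}")
    case True
    then show ?thesis
      by (intro exI[of _ "[{\<zero>}]"])
        (simp add: zeroprimeideal ideal_prod_list_Cons ideal_prod_list_Nil ideal_prod_one[OF zeroideal])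
  next
    case False
    obtain Ls where Ls: "\<forall>L\<in>set Ls. radical_ideal L R" "I = ideal_prod_list R Ls"
      using sp_domain_factor[OF sp I] .
    have id: "\<forall>L\<in>set Ls. ideal L R" using Ls by (auto intro: radical_ideal_ideal)
    have "\<exists>Ps. (\<forall>P\<in>set Ps. primeideal P R) \<and> L = ideal_prod_list R Ps" if L: "L \<in> set Ls" for L
    proof -
      have iL: "ideal L R" and rL: "radical_ideal L R" using L Ls id by auto
      have L0: "L \<noteq> {\<zero>}"
        using ideal_prod_list_subset[OF id L] Ls(2) False ideal_zero[OF I] by auto
      obtain Ns where Ns: "set Ns = {N. maximalideal N R \<and> L \<subseteq> N}" "distinct Ns"
        using finite_distinct_list[OF fin[OF iL L0]] by auto
      have "carrier R \<inter> \<Inter>(set Ns) \<subseteq> L"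
      proof
        fix x assume x: "x \<in> carrier R \<inter> \<Inter>(set Ns)"
        show "x \<in> L"
        proof (rule ccontr)
          assume "x \<notin> L"
          then obtain P where P: "primeideal P R" "L \<subseteq> P" "x \<notin> P"
            using radical_ideal_prime_notin[OF rL] x by blast
          then have "P \<noteq> {\<zero>}" using L0 ideal_zero[OF iL] by blast
          then have "P \<in> set Ns" using P sp_domain_primeideal_maximal[OF sp P(1)] Ns(1) by simp
          then show False using x P(3) by blast
        qed
      qed
      then have "L = ideal_prod_list R Ns"
        using ideal_prod_list_maximalideals[OF Ns(2)] Ns(1) ideal_subset[OF iL] by auto
      then show ?thesis using Ns(1) maximalideal_primeideal by (intro exI[of _ Ns]) auto
    qed
    then show ?thesis using ideal_prod_list_refine Ls(2) by simp
  qed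
qed

end

locale sp_domain_principal_maximal = domain +
  fixes q
  assumes sp: "sp_domain R" and q: "q \<in> carrier R" and maximal: "maximalideal (PIdl q) R"
    and q0: "q \<noteq> \<zero>"
begin

lemma mem_cgenideal: "x \<in> PIdl a \<longleftrightarrow> (\<exists>y\<in>carrier R. x = y \<otimes> a)"
  by (auto simp: cgenideal_def)

lemma primeideal_q: "primeideal (PIdl q) R"
  using maximal by (rule maximalideal_primeideal)

text \<open>The intersection of the powers of \<open>(q)\<close> is prime, by adding the exact
  \<open>q\<close>-orders of two elements outside it. Were it nonzero, it would be maximal and so
  equal to \<open>(q)\<close>; then \<open>q\<close> would be divisible by its square and hence a
  unit.\<close>

lemma Inter_power_q:
  assumes x: "x \<in> carrier R" and "\<And>n::nat. x \<in> PIdl (q [^] n)"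
  shows "x = \<zero>"
proof (rule ccontr)
  assume x0: "x \<noteq> \<zero>"
  let ?K = "{x \<in> carrier R. \<forall>n::nat. x \<in> PIdl (q [^] n)}"
  have iK: "ideal ?K R"
    using q by (intro idealI_cring)
      (auto intro: ideal_zero ideal_add ideal_mult cgenideal_ideal)
  have nK: "\<exists>n. \<exists>y\<in>carrier R. y \<notin> PIdl q \<and> x = y \<otimes> q [^] (n::nat)" if "x \<in> carrier R" "x \<notin> ?K" for x
  proof -
    have "\<exists>n::nat. x \<notin> PIdl (q [^] n)" using that by blast
    then have "\<exists>n::nat. x \<notin> PIdl (q [^] n) \<and> (\<forall>m<n. x \<in> PIdl (q [^] m))"
      using exists_least_iff[of "\<lambda>n. x \<notin> PIdl (q [^] (n::nat))"] by simp
    then obtain n where n: "x \<notin> PIdl (q [^] (n::nat))" "\<forall>m<n. x \<in> PIdl (q [^] m)" by blast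
    have "x \<in> PIdl (q [^] (0::nat))" using that(1) by (auto simp: mem_cgenideal)
    then obtain m where m: "n = Suc m" using n(1) by (cases n) auto
    then obtain y where y: "y \<in> carrier R" "x = y \<otimes> q [^] m" using n(2) mem_cgenideal by auto
    have "y \<notin> PIdl q"
    proof
      assume "y \<in> PIdl q"
      then obtain z where "z \<in> carrier R" "y = z \<otimes> q" using mem_cgenideal by auto
      then have "x = z \<otimes> q [^] n" using y q by (simp add: m m_ac)
      then show False using n(1) \<open>z \<in> carrier R\<close> mem_cgenideal by auto
    qed
    then show ?thesis using y by blast
  qed
  have "primeideal ?K R"
  proof (rule primeidealI[OF iK is_cring])
    have "\<one> \<notin> PIdl (q [^] (1::nat))" using primeideal_notone[OF primeideal_q] q by simp
    then show "carrier R \<noteq> ?K" by blast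
    fix a b assume ab: "a \<in> carrier R" "b \<in> carrier R" "a \<otimes> b \<in> ?K"
    show "a \<in> ?K \<or> b \<in> ?K"
    proof (rule ccontr)
      assume "\<not> ?thesis"
      then have "a \<notin> ?K" "b \<notin> ?K" by blast+
      then obtain m n y z where *: "y \<in> carrier R" "y \<notin> PIdl q" "a = y \<otimes> q [^] (m::nat)"
        "z \<in> carrier R" "z \<notin> PIdl q" "b = z \<otimes> q [^] (n::nat)" using nK ab(1,2) by meson
      have "a \<otimes> b \<in> PIdl (q [^] Suc (m + n))" using ab(3) by blast
      then obtain w where w: "w \<in> carrier R" "a \<otimes> b = w \<otimes> q [^] Suc (m + n)" using mem_cgenideal by auto
      have "a \<otimes> b = (y \<otimes> z) \<otimes> (q [^] m \<otimes> q [^] n)" unfolding *(3,6) using *(1,4) q by (simp add: m_ac)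
      then have "a \<otimes> b = (y \<otimes> z) \<otimes> q [^] (m + n)" using q by (simp add: nat_pow_mult)
      moreover have "a \<otimes> b = (w \<otimes> q) \<otimes> q [^] (m + n)" unfolding w(2) using w(1) q by (simp add: m_ac)
      moreover have "q [^] (m + n) \<noteq> \<zero>" using primeideal_pow[OF zeroprimeideal q, of "m + n"] q0 by auto
      ultimately have "y \<otimes> z = w \<otimes> q" using *(1,4) w(1) q by (metis m_rcancel m_closed nat_pow_closed)
      then have "y \<otimes> z \<in> PIdl q" using w(1) mem_cgenideal by auto
      then show False using primeideal.I_prime[OF primeideal_q *(1,4)] *(2,5) by blast
    qed
  qed
  moreover have "?K \<noteq> {\<zero>}" using x x0 assms(2) by blast
  ultimately have "maximalideal ?K R" using sp_domain_primeideal_maximal[OF sp] by blast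
  moreover have "?K \<subseteq> PIdl q"
  proof
    fix x assume "x \<in> ?K"
    then have "x \<in> PIdl (q [^] (1::nat))" by blast
    then show "x \<in> PIdl q" using q by simp
  qed
  ultimately have "PIdl q = ?K"
    by (rule maximalideal_eq[OF _ cgenideal_ideal[OF q] _ primeideal_notone[OF primeideal_q]])
  then have "q \<in> PIdl (q [^] (2::nat))" using cgenideal_self[OF q] by blast
  then obtain y where y: "y \<in> carrier R" "q = y \<otimes> q [^] (2::nat)" using mem_cgenideal by auto
  then have "\<one> \<otimes> q = (y \<otimes> q) \<otimes> q" using q by (simp add: numeral_2_eq_2 m_assoc)
  then have "\<one> = y \<otimes> q" using q0 q y(1) by (metis m_rcancel m_closed one_closed)
  then have "\<one> \<in> PIdl q" using y(1) mem_cgenideal by auto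
  then show False using primeideal_notone[OF primeideal_q] by blast
qed

text \<open>\<open>B\<close> is the quotient of \<open>L\<close> by \<open>q\<close>. A radical
  ideal contains at most one factor \<open>q\<close>: if \<open>B\<close> were inside
  \<open>(q)\<close>, then \<open>x = y q^(n+1)\<close> in \<open>L\<close> would give
  \<open>(q y)^(n+1)\<close> in \<open>L\<close>, so \<open>y\<close> in \<open>B\<close> and
  \<open>x\<close> divisible by \<open>q^(n+2)\<close>. Then \<open>L\<close> would be zero by
  \<open>Inter_power_q\<close>.\<close>

lemma radical_ideal_divide_q:
  assumes L: "radical_ideal L R" "L \<noteq> {\<zero>}" "L \<subseteq> PIdl q"
  obtains B where "radical_ideal B R" "\<not> B \<subseteq> PIdl q" "L = scale R q B"
proof -
  have iL: "ideal L R" using L(1) by (rule radical_ideal_ideal)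
  let ?B = "{x \<in> carrier R. q \<otimes> x \<in> L}"
  have iB: "ideal ?B R"
    using q ideal_zero[OF iL] ideal_add[OF iL] ideal_mult[OF iL]
    by (intro idealI_cring) (auto simp: r_distr m_lcomm)
  have "radical_ideal ?B R"
  proof (rule radical_idealI[OF iB])
    fix x and n :: nat assume x: "x \<in> carrier R" "n \<ge> 1" "x [^] n \<in> ?B"
    have qL: "q \<otimes> x [^] n \<in> L" using x(3) by simp
    obtain m where n: "n = Suc m" using x(2) by (cases n) auto
    have "(q \<otimes> x) [^] n = q [^] m \<otimes> (q \<otimes> x [^] n)"
      using q x by (simp add: n nat_pow_distrib m_ac)
    also have "\<dots> \<in> L" using x(1) q by (intro ideal_mult[OF iL _ qL]) auto
    finally have "q \<otimes> x \<in> L" using radical_ideal_powD[OF L(1)] q x(1) by blast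
    then show "x \<in> ?B" using x by blast
  qed
  moreover have "L = scale R q ?B"
  proof
    show "L \<subseteq> scale R q ?B"
    proof
      fix x assume x: "x \<in> L"
      then obtain y where y: "y \<in> carrier R" "x = y \<otimes> q" using L(3) mem_cgenideal by blast
      then have "x = q \<otimes> y" using q by (simp add: m_comm)
      then show "x \<in> scale R q ?B" using x y by (auto simp: scale_def)
    qed
  qed (auto simp: scale_def)
  moreover have "\<not> ?B \<subseteq> PIdl q"
  proof
    assume BM: "?B \<subseteq> PIdl q"
    have Lq: "L \<subseteq> PIdl (q [^] Suc n)" for n
    proof (induction n)
      case 0
      then show ?case using L(3) q by simp
    next
      case (Suc n)
      show ?case
      proof
        fix x assume x: "x \<in> L"
        then obtain y where y: "y \<in> carrier R" "x = y \<otimes> q [^] Suc n" using Suc mem_cgenideal by blast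
        have "(q \<otimes> y) [^] Suc n = y [^] n \<otimes> x"
          unfolding y(2) using q y(1) by (simp add: nat_pow_distrib m_ac)
        also have "\<dots> \<in> L" using y(1) by (intro ideal_mult[OF iL _ x]) simp
        finally have "q \<otimes> y \<in> L" using radical_ideal_powD[OF L(1)] q y(1) by blast
        then have "y \<in> PIdl q" using BM y(1) by blast
        then obtain z where z: "z \<in> carrier R" "y = z \<otimes> q" using mem_cgenideal by blast
        then have "x = z \<otimes> q [^] Suc (Suc n)" unfolding y(2) using q by (simp add: m_ac)
        then show "x \<in> PIdl (q [^] Suc (Suc n))" using z(1) mem_cgenideal by blast
      qed
    qed
    have "x = \<zero>" if x: "x \<in> L" for x
    proof (rule Inter_power_q)
      show xc: "x \<in> carrier R" using iL x by (rule ideal.Icarr)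
      fix n :: nat
      show "x \<in> PIdl (q [^] n)"
      proof (cases n)
        case 0
        then show ?thesis using xc by (auto simp: mem_cgenideal)
      next
        case (Suc m)
        then show ?thesis using Lq[of m] x by blast
      qed
    qed
    then show False using L(2) ideal_zero[OF iL] by blast
  qed
  ultimately show ?thesis using that by blast
qed

text \<open>The exponent \<open>m\<close> counts the radical factors inside \<open>(q)\<close>, each
  of which gives up exactly one \<open>q\<close>.\<close>

lemma ideal_factor_q:
  assumes I: "ideal I R" "I \<noteq> {\<zero>}"
  obtains m Bs where "\<forall>B\<in>set Bs. radical_ideal B R \<and> \<not> B \<subseteq> PIdl q"
    "I = scale R (q [^] (m::nat)) (ideal_prod_list R Bs)"
proof -
  obtain Ls where Ls: "\<forall>L\<in>set Ls. radical_ideal L R" "I = ideal_prod_list R Ls"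
    using sp_domain_factor[OF sp I(1)] .
  have id: "\<forall>L\<in>set Ls. ideal L R" using Ls by (auto intro: radical_ideal_ideal)
  have "\<forall>L\<in>set Ls. radical_ideal L R \<and> L \<noteq> {\<zero>}"
    using Ls ideal_prod_list_subset[OF id] I(2) ideal_zero[OF I(1)] by blast
  then have "\<exists>m Bs. (\<forall>B\<in>set Bs. radical_ideal B R \<and> \<not> B \<subseteq> PIdl q) \<and>
    ideal_prod_list R Ls = scale R (q [^] (m::nat)) (ideal_prod_list R Bs)"
  proof (induction Ls)
    case Nil
    show ?case using scale_one by (intro exI[of _ "0::nat"] exI[of _ "[]"]) (simp add: ideal_prod_list_Nil)
  next
    case (Cons L Ls)
    then obtain m Bs where Bs: "\<forall>B\<in>set Bs. radical_ideal B R \<and> \<not> B \<subseteq> PIdl q"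
      "ideal_prod_list R Ls = scale R (q [^] (m::nat)) (ideal_prod_list R Bs)" by auto
    have iBs: "ideal (ideal_prod_list R Bs) R"
      using Bs(1) by (intro ideal_prod_list_ideal) (auto intro: radical_ideal_ideal)
    have L: "radical_ideal L R" "ideal L R" "L \<noteq> {\<zero>}" using Cons.prems by (auto intro: radical_ideal_ideal)
    have LLs: "ideal_prod_list R (L # Ls) = scale R (q [^] m) (L \<cdot> ideal_prod_list R Bs)"
      using Bs(2) q L(2) iBs by (simp add: ideal_prod_list_Cons scale_prod_right)
    show ?case
    proof (cases "L \<subseteq> PIdl q")
      case False
      then show ?thesis using Bs(1) L LLs
        by (intro exI[of _ m] exI[of _ "L # Bs"]) (auto simp: ideal_prod_list_Cons)
    next
      case True
      then obtain B where B: "radical_ideal B R" "\<not> B \<subseteq> PIdl q" "L = scale R q B"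
        using radical_ideal_divide_q L by blast
      have iB: "ideal B R" using B(1) by (rule radical_ideal_ideal)
      have "L \<cdot> ideal_prod_list R Bs = scale R q (B \<cdot> ideal_prod_list R Bs)"
        unfolding B(3) using q iB iBs by (rule scale_prod_left)
      then have "ideal_prod_list R (L # Ls) = scale R (q [^] Suc m) (ideal_prod_list R (B # Bs))"
        using LLs q ideal_prod_in_carrier[OF iB iBs]
        by (simp add: ideal_prod_list_Cons scale_scale)
      then show ?thesis using Bs(1) B by (intro exI[of _ "Suc m"] exI[of _ "B # Bs"]) auto
    qed
  qed
  then show ?thesis using that Ls(2) by blast
qed

end

section \<open>The pull-back\<close>

text \<open>\<open>R\<close> is the ring \<open>C\<close>, \<open>A0\<close> the pull-back, and
  \<open>w\<close> the valuation of the residue field composed with the canonical map, so that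
  cosets disappear. On \<open>M\<close> the valuation has no meaning, hence the restrictions to its
  complement. The ultrametric inequality enters through \<open>subring\<close>;
  \<open>w_cong\<close> says that \<open>w\<close> depends on the coset only.\<close>

locale valuation_pullback = sp_domain_principal_maximal +
  fixes p :: 'a and w :: "'a \<Rightarrow> int" and A0 :: "'a set"
  assumes A0_def: "A0 = {x \<in> carrier R. x \<in> PIdl q \<or> w x \<ge> 0}"
    and subring: "subring A0 R"
    and w_mult: "\<lbrakk>x \<in> carrier R - PIdl q; y \<in> carrier R - PIdl q\<rbrakk> \<Longrightarrow> w (x \<otimes> y) = w x + w y"
    and w_cong: "\<lbrakk>x \<in> carrier R - PIdl q; m \<in> PIdl q\<rbrakk> \<Longrightarrow> w (x \<oplus> m) = w x"
    and p: "p \<in> Units R" and w_p: "w p = 1"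
begin

abbreviation M where "M \<equiv> PIdl q"
abbreviation A where "A \<equiv> R\<lparr>carrier := A0\<rparr>"

lemma M_ideal: "ideal M R" by (rule cgenideal_ideal[OF q])

lemma M_carrier: "m \<in> M \<Longrightarrow> m \<in> carrier R" using M_ideal by (rule ideal.Icarr)

lemma one_notin_M: "\<one> \<notin> M" using primeideal_notone[OF primeideal_q] .

lemma M_prime: "a \<in> carrier R \<Longrightarrow> b \<in> carrier R \<Longrightarrow> a \<otimes> b \<in> M \<longleftrightarrow> a \<in> M \<or> b \<in> M"
  using primeideal.I_prime[OF primeideal_q] ideal_mult[OF M_ideal] ideal.I_r_closed[OF M_ideal] by blast

lemma A0_carrier: "x \<in> A0 \<Longrightarrow> x \<in> carrier R" by (simp add: A0_def)

lemma M_A0: "M \<subseteq> A0" using ideal_subset[OF M_ideal] by (auto simp: A0_def)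

lemmas A0_subring = subringE[OF subring]

lemma A0_pow: "x \<in> A0 \<Longrightarrow> x [^] (n::nat) \<in> A0"
  by (induction n) (auto simp: A0_subring)

lemma A_domain: "domain A" by (rule subring_is_domain[OF subring])

lemma A_cring: "cring A" using A_domain by (rule domain.axioms)

lemma A_ideal_iff:
  "ideal I A \<longleftrightarrow> I \<subseteq> A0 \<and> \<zero> \<in> I \<and> (\<forall>x\<in>I. \<forall>y\<in>I. x \<oplus> y \<in> I) \<and> (\<forall>r\<in>A0. \<forall>x\<in>I. r \<otimes> x \<in> I)"
proof
  assume I: "ideal I A"
  show "I \<subseteq> A0 \<and> \<zero> \<in> I \<and> (\<forall>x\<in>I. \<forall>y\<in>I. x \<oplus> y \<in> I) \<and> (\<forall>r\<in>A0. \<forall>x\<in>I. r \<otimes> x \<in> I)"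
    using ideal_subset[OF I] ideal_zero[OF I] ideal_add[OF I] cring.ideal_mult[OF A_cring I] by auto
next
  assume *: "I \<subseteq> A0 \<and> \<zero> \<in> I \<and> (\<forall>x\<in>I. \<forall>y\<in>I. x \<oplus> y \<in> I) \<and> (\<forall>r\<in>A0. \<forall>x\<in>I. r \<otimes> x \<in> I)"
  show "ideal I A" by (rule cring.idealI_cring[OF A_cring]) (use * in auto)
qed

text \<open>A product of ideals is the closure of the elementwise products under sums; the carrier
  does not enter.\<close>

lemma A_ideal_prod: "ideal_prod A I J = I \<cdot> J"
proof
  show "ideal_prod A I J \<subseteq> I \<cdot> J"
  proof
    fix x assume "x \<in> ideal_prod A I J"
    then show "x \<in> I \<cdot> J" by induct (auto intro: ideal_prod.intros)
  qed
  show "I \<cdot> J \<subseteq> ideal_prod A I J"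
  proof
    fix x assume "x \<in> I \<cdot> J"
    then show "x \<in> ideal_prod A I J"
    proof induct
      case (prod i j)
      then show ?case using ideal_prod.prod[of i I j J A] by simp
    next
      case (sum x y)
      then show ?case using ideal_prod.sum[of x A I J y] by simp
    qed
  qed
qed

lemma A_pow: "x [^]\<^bsub>A\<^esub> (n::nat) = x [^] n"
  using nat_pow_consistent[of x n A0] by simp

lemma A_scale: "scale A a I = scale R a I"
  by (simp add: scale_def)

lemma p_carrier: "p \<in> carrier R" and inv_p_carrier: "inv p \<in> carrier R"
  and p_inv: "p \<otimes> inv p = \<one>"
  using p by auto

lemma p_notin_M: "p \<notin> M" and inv_p_notin_M: "inv p \<notin> M"
  using one_notin_M M_prime[OF p_carrier inv_p_carrier] p_inv by auto

lemma w_one: "w \<one> = 0"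
  using w_mult[of \<one> \<one>] one_notin_M by simp

lemma w_pow: "x \<in> carrier R - M \<Longrightarrow> x [^] n \<notin> M \<and> w (x [^] (n::nat)) = int n * w x"
proof (induction n)
  case 0
  then show ?case using one_notin_M w_one by simp
next
  case (Suc n)
  then show ?case using w_mult[of "x [^] n" x] M_prime[of "x [^] n" x] by (simp add: algebra_simps)
qed

lemma p_A0: "p \<in> A0" using p_carrier w_p by (simp add: A0_def)

lemma p_pow_unit: "p [^] (n::nat) \<otimes> inv p [^] n = \<one>" "inv p [^] n \<otimes> p [^] n = \<one>"
  using p_carrier inv_p_carrier p_inv nat_pow_distrib[of p "inv p" n] by (simp_all add: m_comm)

lemma p_pow_closed: "p [^] (n::nat) \<in> carrier R" "inv p [^] n \<in> carrier R"
  using p_carrier inv_p_carrier by auto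

lemma p_pow_cancel: "x \<in> carrier R \<Longrightarrow> inv p [^] n \<otimes> (p [^] (n::nat) \<otimes> x) = x"
  using p_pow_unit(2) p_pow_closed by (simp flip: m_assoc)

lemma exists_unit_with_value:
  obtains g g' where "g \<in> carrier R" "g' \<in> carrier R" "g \<otimes> g' = \<one>" "g \<notin> M" "g' \<notin> M"
    "w g = k" "w g' = - k"
proof -
  have w': "w (inv p) = -1"
    using w_mult[of p "inv p"] p_carrier inv_p_carrier p_notin_M inv_p_notin_M p_inv w_one w_p by simp
  have *: "p [^] n \<notin> M" "w (p [^] n) = int n" "inv p [^] n \<notin> M" "w (inv p [^] n) = - int n" for n :: nat
    using w_pow[of p n] w_pow[of "inv p" n] p_carrier inv_p_carrier p_notin_M inv_p_notin_M w' w_p by auto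
  show ?thesis
  proof (cases k rule: int_cases2)
    case (nonneg n)
    then show ?thesis using that[of "p [^] n" "inv p [^] n"] * p_pow_closed p_pow_unit by simp
  next
    case (nonpos n)
    then show ?thesis using that[of "inv p [^] n" "p [^] n"] * p_pow_closed p_pow_unit by simp
  qed
qed

text \<open>This is the statement that \<open>R\<close> arises from \<open>A\<close> by inverting
  \<open>p\<close>: a high power of \<open>p\<close> makes any value nonnegative.\<close>

lemma p_pow_mult_A0:
  assumes x: "x \<in> carrier R"
  obtains n :: nat where "p [^] n \<otimes> x \<in> A0"
proof (cases "x \<in> M")
  case True
  then show ?thesis using that[of 0] M_A0 x by auto
next
  case False
  let ?n = "nat (- w x)"
  have "w (p [^] ?n \<otimes> x) = int ?n + w x"
    using w_mult[of "p [^] ?n" x] w_pow[of p ?n] x False p_carrier p_notin_M w_p by simp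
  then show ?thesis using that[of ?n] x p_carrier by (simp add: A0_def)
qed

lemma mod_inverse:
  assumes u: "u \<in> carrier R - M"
  obtains d m where "d \<in> carrier R" "m \<in> M" "u \<otimes> d = \<one> \<oplus> m"
proof -
  have uc: "u \<in> carrier R" using u by simp
  let ?J = "adjoin R M (carrier R) u"
  have J: "ideal ?J R" using adjoin_ideal[OF M_ideal oneideal uc] .
  have "?J = M \<or> ?J = carrier R"
    using maximalideal.I_maximal[OF maximal J adjoin_subset[OF M_ideal oneideal uc] ideal_subset[OF J]] .
  then have "\<one> \<in> ?J" using adjoin_self[OF M_ideal uc] u by auto
  then obtain m r where mr: "m \<in> M" "r \<in> carrier R" "\<one> = m \<oplus> r \<otimes> u" by (rule adjoinE)
  have mc: "m \<in> carrier R" using mr(1) by (rule M_carrier)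
  have "u \<otimes> r = (m \<oplus> r \<otimes> u) \<oplus> \<ominus> m" using mc mr(2) uc by algebra
  then have "u \<otimes> r = \<one> \<oplus> \<ominus> m" using mr(3) by simp
  then show ?thesis using that mr(2) ideal_uminus[OF M_ideal mr(1)] by blast
qed

text \<open>In the residue field, \<open>w u \<le> w x\<close> says that the quotient of the
  residues of \<open>x\<close> and \<open>u\<close> lies in the valuation ring. Lifting this
  quotient to \<open>A0\<close> leaves an error in \<open>M\<close>.\<close>

lemma A0_multiple_mod:
  assumes u: "u \<in> carrier R - M" and x: "x \<in> carrier R - M" and le: "w u \<le> w x"
  obtains e m where "e \<in> A0" "m \<in> M" "e \<otimes> u = x \<oplus> m"
proof -
  obtain d m where d: "d \<in> carrier R" "m \<in> M" "u \<otimes> d = \<one> \<oplus> m" using mod_inverse[OF u] .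
  have c: "m \<in> carrier R" "u \<in> carrier R" "x \<in> carrier R" using d u x M_carrier by auto
  have "u \<otimes> d \<notin> M"
  proof
    assume "u \<otimes> d \<in> M"
    then have "(\<one> \<oplus> m) \<ominus> m \<in> M" using d by (intro ideal_minus[OF M_ideal]) auto
    moreover have "(\<one> \<oplus> m) \<ominus> m = \<one>" using c by algebra
    ultimately show False using one_notin_M by simp
  qed
  then have dM: "d \<notin> M" using M_prime c d(1) by blast
  have "w u + w d = 0" using w_mult[of u d] w_cong[of \<one> m] u d dM w_one one_notin_M by simp
  then have "w (x \<otimes> d) \<ge> 0" using w_mult[of x d] x d dM le by simp
  then have "x \<otimes> d \<in> A0" using c d by (simp add: A0_def)
  moreover have "(x \<otimes> d) \<otimes> u = x \<otimes> (u \<otimes> d)" using c d(1) by algebra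
  then have "(x \<otimes> d) \<otimes> u = x \<oplus> x \<otimes> m" using c d(1) by (simp add: d(3) r_distr)
  ultimately show ?thesis using that ideal_mult[OF M_ideal c(3) d(2)] by blast
qed

lemma comaximal_M:
  assumes "ideal B R" "\<not> B \<subseteq> M"
  obtains m where "m \<in> M" "\<one> \<oplus> m \<in> B"
proof -
  obtain u where u: "u \<in> B" "u \<in> carrier R - M" using assms by (auto intro: ideal.Icarr)
  obtain d m where "d \<in> carrier R" "m \<in> M" "u \<otimes> d = \<one> \<oplus> m" using mod_inverse[OF u(2)] .
  then show ?thesis using that ideal.I_r_closed[OF assms(1) u(1)] by metis
qed

text \<open>Since \<open>m = p^n (p^{-n} m)\<close> and \<open>p^{-n} m \<in> M \<subseteq> A0\<close>, the elements \<open>1 + m\<close> and \<open>p^n\<close>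
  are comaximal in the pull-back.\<close>

lemma submodule_mem_local:
  assumes K: "\<And>x y. x \<in> K \<Longrightarrow> y \<in> K \<Longrightarrow> x \<oplus> y \<in> K" "\<And>r x. r \<in> A0 \<Longrightarrow> x \<in> K \<Longrightarrow> r \<otimes> x \<in> K"
    and x: "x \<in> carrier R" and m: "m \<in> M" and mx: "(\<one> \<oplus> m) \<otimes> x \<in> K" and px: "p [^] (n::nat) \<otimes> x \<in> K"
  shows "x \<in> K"
proof -
  let ?i = "inv p [^] n" and ?P = "p [^] n"
  have c: "m \<in> carrier R" "?i \<in> carrier R" "?P \<in> carrier R" using m M_carrier p_pow_closed by auto
  have "\<ominus> (?i \<otimes> m) \<in> A0" using ideal_uminus[OF M_ideal ideal_mult[OF M_ideal c(2) m]] M_A0 by blast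
  then have "(\<one> \<oplus> m) \<otimes> x \<oplus> \<ominus> (?i \<otimes> m) \<otimes> (?P \<otimes> x) \<in> K" using K mx px by blast
  moreover have "\<ominus> (?i \<otimes> m) \<otimes> (?P \<otimes> x) = \<ominus> (m \<otimes> (?i \<otimes> (?P \<otimes> x)))" using c x by algebra
  moreover have "(\<one> \<oplus> m) \<otimes> x \<oplus> \<ominus> (m \<otimes> x) = x" using c x by algebra
  ultimately show ?thesis using p_pow_cancel[OF x] by simp
qed

lemma p_pow_increase:
  assumes "\<And>r x. r \<in> A0 \<Longrightarrow> x \<in> K \<Longrightarrow> r \<otimes> x \<in> K" "p [^] (n::nat) \<otimes> x \<in> K" "x \<in> carrier R" "n \<le> k"
  shows "p [^] k \<otimes> x \<in> K"
proof -
  obtain j where j: "k = j + n" using assms(4) by (metis le_add_diff_inverse2)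
  have "p [^] j \<otimes> (p [^] n \<otimes> x) \<in> K" using assms(1)[OF A0_pow[OF p_A0] assms(2)] .
  then show ?thesis using assms(3) p_carrier by (simp add: j nat_pow_mult flip: m_assoc)
qed

section \<open>Contraction to the pull-back and extension to the larger ring\<close>

lemma contraction_ideal: "ideal J R \<Longrightarrow> ideal (J \<inter> A0) A"
  using A0_subring by (auto simp: A_ideal_iff ideal_zero ideal_add ideal_mult A0_carrier)

lemma contraction_radical: "radical_ideal J R \<Longrightarrow> radical_ideal (J \<inter> A0) A"
  by (rule cring.radical_idealI[OF A_cring])
    (auto simp: A_pow A0_carrier contraction_ideal radical_ideal_ideal intro: radical_ideal_powD)

lemma contraction_M: "M \<inter> A0 = M" using M_A0 by blast

lemma M_ideal_A: "ideal M A" using contraction_ideal[OF M_ideal] by (simp add: contraction_M)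

lemma A_PIdl: "a \<in> A0 \<Longrightarrow> PIdl\<^bsub>A\<^esub> a = scale R a A0"
  using cring.cgenideal_eq_scale[OF A_cring, of a] by (simp add: A_scale)

lemma primeideal_A_iff:
  "primeideal P A \<longleftrightarrow> ideal P A \<and> \<one> \<notin> P \<and> (\<forall>a\<in>A0. \<forall>b\<in>A0. a \<otimes> b \<in> P \<longrightarrow> a \<in> P \<or> b \<in> P)"
proof
  assume P: "primeideal P A"
  show "ideal P A \<and> \<one> \<notin> P \<and> (\<forall>a\<in>A0. \<forall>b\<in>A0. a \<otimes> b \<in> P \<longrightarrow> a \<in> P \<or> b \<in> P)"
    using primeideal_ideal[OF P] primeideal_notone[OF P] primeideal.I_prime[OF P] by auto
next
  assume *: "ideal P A \<and> \<one> \<notin> P \<and> (\<forall>a\<in>A0. \<forall>b\<in>A0. a \<otimes> b \<in> P \<longrightarrow> a \<in> P \<or> b \<in> P)"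
  show "primeideal P A"
    by (rule primeidealI) (use * A_cring A0_subring(3) in auto)
qed

text \<open>The nontrivial inclusion is checked on two comaximal elements. A power of
  \<open>p\<close> moves the factors of each summand into \<open>A0\<close>. Since neither ideal
  lies in \<open>M\<close>, both contain elements congruent to 1 modulo \<open>M\<close>, and the
  product of these is some \<open>1 + m\<close> in the left side. \<open>submodule_mem_local\<close>
  combines the two.\<close>

lemma contraction_prod:
  assumes B: "ideal B R" "\<not> B \<subseteq> M" and B': "ideal B' R" "\<not> B' \<subseteq> M"
  shows "(B \<inter> A0) \<cdot> (B' \<inter> A0) = B \<cdot> B' \<inter> A0"
proof
  let ?K = "(B \<inter> A0) \<cdot> (B' \<inter> A0)"
  have iK: "ideal ?K A"
    using ring.ideal_prod_is_ideal[OF cring.axioms(1)[OF A_cring] contraction_ideal[OF B(1)] contraction_ideal[OF B'(1)]]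
    by (simp add: A_ideal_prod)
  then show "?K \<subseteq> B \<cdot> B' \<inter> A0"
    using ideal_prod_mono[of "B \<inter> A0" B "B' \<inter> A0" B'] by (auto simp: A_ideal_iff)
  have K: "\<And>x y. x \<in> ?K \<Longrightarrow> y \<in> ?K \<Longrightarrow> x \<oplus> y \<in> ?K" "\<And>r x. r \<in> A0 \<Longrightarrow> x \<in> ?K \<Longrightarrow> r \<otimes> x \<in> ?K"
    using iK by (auto simp: A_ideal_iff)
  note c = ideal.Icarr[OF B(1)] ideal.Icarr[OF B'(1)]
  obtain m m' where m: "m \<in> M" "\<one> \<oplus> m \<in> B" "m' \<in> M" "\<one> \<oplus> m' \<in> B'"
    using comaximal_M[OF B] comaximal_M[OF B'] by metis
  have mc: "m \<in> carrier R" "m' \<in> carrier R" using m M_carrier by auto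
  have "\<one> \<oplus> m \<in> A0" "\<one> \<oplus> m' \<in> A0" using m M_A0 A0_subring(3,7) by auto
  then have "(\<one> \<oplus> m) \<otimes> (\<one> \<oplus> m') \<in> ?K" using m by (intro ideal_prod.prod) auto
  moreover have "(\<one> \<oplus> m) \<otimes> (\<one> \<oplus> m') = \<one> \<oplus> (m \<oplus> (\<one> \<oplus> m) \<otimes> m')" using mc by algebra
  ultimately have mK: "\<one> \<oplus> (m \<oplus> (\<one> \<oplus> m) \<otimes> m') \<in> ?K" by simp
  have mM: "m \<oplus> (\<one> \<oplus> m) \<otimes> m' \<in> M" using m mc by (intro ideal_add[OF M_ideal] ideal_mult[OF M_ideal]) auto
  show "B \<cdot> B' \<inter> A0 \<subseteq> ?K"
  proof
    fix x assume x: "x \<in> B \<cdot> B' \<inter> A0"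
    have "\<exists>n::nat. p [^] n \<otimes> x \<in> ?K" if "x \<in> B \<cdot> B'" for x
      using that
    proof induct
      case (prod i j)
      then have ij: "i \<in> carrier R" "j \<in> carrier R" using c by auto
      obtain k l :: nat where "p [^] k \<otimes> i \<in> A0" "p [^] l \<otimes> j \<in> A0"
        using p_pow_mult_A0[OF ij(1)] p_pow_mult_A0[OF ij(2)] by metis
      then have "(p [^] k \<otimes> i) \<otimes> (p [^] l \<otimes> j) \<in> ?K"
        using prod B(1) B'(1) p_pow_closed by (intro ideal_prod.prod) (auto intro: ideal_mult)
      moreover have "(p [^] k \<otimes> i) \<otimes> (p [^] l \<otimes> j) = (p [^] k \<otimes> p [^] l) \<otimes> (i \<otimes> j)"
        using ij p_pow_closed by (simp add: m_ac)
      ultimately show ?case using p_carrier nat_pow_mult by metis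
    next
      case (sum x y)
      then obtain k l :: nat where kl: "p [^] k \<otimes> x \<in> ?K" "p [^] l \<otimes> y \<in> ?K" by blast
      have xy: "x \<in> carrier R" "y \<in> carrier R" using sum ideal_prod_in_carrier[OF B(1) B'(1)] by auto
      have "p [^] (k + l) \<otimes> x \<oplus> p [^] (k + l) \<otimes> y \<in> ?K"
        using p_pow_increase[OF K(2) kl(1) xy(1)] p_pow_increase[OF K(2) kl(2) xy(2)] by (intro K(1)) auto
      then show ?case using xy p_pow_closed by (metis r_distr)
    qed
    then obtain n :: nat where n: "p [^] n \<otimes> x \<in> ?K" using x by blast
    have "x \<otimes> (\<one> \<oplus> (m \<oplus> (\<one> \<oplus> m) \<otimes> m')) \<in> ?K" using K(2) mK x by blast
    then have "(\<one> \<oplus> (m \<oplus> (\<one> \<oplus> m) \<otimes> m')) \<otimes> x \<in> ?K" using x mc A0_carrier by (simp add: m_comm)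
    then show "x \<in> ?K"
      using submodule_mem_local[of ?K x "m \<oplus> (\<one> \<oplus> m) \<otimes> m'" n] K mM n x A0_carrier by blast
  qed
qed

lemma contraction_prod_list:
  "\<forall>B\<in>set Bs. ideal B R \<and> \<not> B \<subseteq> M \<Longrightarrow>
    ideal_prod_list A (map (\<lambda>B. B \<inter> A0) Bs) = ideal_prod_list R Bs \<inter> A0"
proof (induction Bs)
  case Nil
  then show ?case using A0_carrier by (auto simp: ideal_prod_list_def)
next
  case (Cons B Bs)
  have "\<not> ideal_prod_list R Bs \<subseteq> M"
    using ideal_prod_list_subset_prime[OF primeideal_q, of Bs] Cons.prems by auto
  then have "(B \<inter> A0) \<cdot> (ideal_prod_list R Bs \<inter> A0) = B \<cdot> ideal_prod_list R Bs \<inter> A0"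
    using Cons.prems ideal_prod_list_ideal[of Bs] by (intro contraction_prod) auto
  then show ?case using Cons by (simp add: ideal_prod_list_def A_ideal_prod)
qed

text \<open>For an ideal \<open>I\<close> of \<open>A\<close> this is the ideal \<open>IR\<close>,
  given by denominators.\<close>

definition extension :: "'a set \<Rightarrow> 'a set" where
  "extension I = {x \<in> carrier R. \<exists>n::nat. p [^] n \<otimes> x \<in> I}"

lemma extension_ideal:
  assumes I: "ideal I A"
  shows "ideal (extension I) R"
proof (rule idealI_cring)
  have K: "\<And>x y. x \<in> I \<Longrightarrow> y \<in> I \<Longrightarrow> x \<oplus> y \<in> I" "\<And>r x. r \<in> A0 \<Longrightarrow> x \<in> I \<Longrightarrow> r \<otimes> x \<in> I" "\<zero> \<in> I"
    using I by (auto simp: A_ideal_iff)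
  show "extension I \<subseteq> carrier R" by (auto simp: extension_def)
  show "\<zero> \<in> extension I" using K(3) by (auto simp: extension_def intro!: exI[of _ "0::nat"])
  show "x \<oplus> y \<in> extension I" if xy: "x \<in> extension I" "y \<in> extension I" for x y
  proof -
    obtain k l :: nat where kl: "p [^] k \<otimes> x \<in> I" "p [^] l \<otimes> y \<in> I" "x \<in> carrier R" "y \<in> carrier R"
      using xy by (auto simp: extension_def)
    have "p [^] (k + l) \<otimes> x \<oplus> p [^] (k + l) \<otimes> y \<in> I"
      using p_pow_increase[OF K(2) kl(1,3)] p_pow_increase[OF K(2) kl(2,4)] by (intro K(1)) auto
    then have "p [^] (k + l) \<otimes> (x \<oplus> y) \<in> I" using kl p_pow_closed by (metis r_distr)
    then show ?thesis using kl by (auto simp: extension_def)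
  qed
  show "r \<otimes> x \<in> extension I" if rx: "r \<in> carrier R" "x \<in> extension I" for r x
  proof -
    obtain k :: nat where k: "p [^] k \<otimes> x \<in> I" "x \<in> carrier R" using rx by (auto simp: extension_def)
    obtain l :: nat where l: "p [^] l \<otimes> r \<in> A0" using p_pow_mult_A0 rx(1) by blast
    have "(p [^] l \<otimes> r) \<otimes> (p [^] k \<otimes> x) \<in> I" using K(2) l k by blast
    moreover have "(p [^] l \<otimes> r) \<otimes> (p [^] k \<otimes> x) = (p [^] l \<otimes> p [^] k) \<otimes> (r \<otimes> x)"
      using rx(1) k(2) p_pow_closed by (simp add: m_ac)
    ultimately have "p [^] (l + k) \<otimes> (r \<otimes> x) \<in> I" using p_carrier by (simp add: nat_pow_mult)
    then show ?thesis using rx(1) k(2) unfolding extension_def by blast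
  qed
qed

lemma extension_superset: "I \<subseteq> A0 \<Longrightarrow> I \<subseteq> extension I"
  using A0_carrier by (auto simp: extension_def intro!: exI[of _ "0::nat"])

lemma extension_mono: "I \<subseteq> J \<Longrightarrow> extension I \<subseteq> extension J"
  by (auto simp: extension_def)

text \<open>Clearing and restoring powers of \<open>p\<close>. In particular contraction is
  injective on ideals, which allows maximal ideals to be counted in \<open>A\<close>.\<close>

lemma extension_contraction:
  assumes J: "ideal J R"
  shows "extension (J \<inter> A0) = J"
proof
  show "extension (J \<inter> A0) \<subseteq> J"
  proof
    fix x assume "x \<in> extension (J \<inter> A0)"
    then obtain n :: nat where n: "x \<in> carrier R" "p [^] n \<otimes> x \<in> J" by (auto simp: extension_def)
    then show "x \<in> J" using ideal_mult[OF J p_pow_closed(2) n(2), of n] p_pow_cancel by simp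
  qed
  show "J \<subseteq> extension (J \<inter> A0)"
  proof
    fix x assume x: "x \<in> J"
    then have xc: "x \<in> carrier R" by (rule ideal.Icarr[OF J])
    obtain n :: nat where "p [^] n \<otimes> x \<in> A0" using p_pow_mult_A0[OF xc] .
    then show "x \<in> extension (J \<inter> A0)"
      using xc ideal_mult[OF J _ x] p_pow_closed by (auto simp: extension_def)
  qed
qed

end

section \<open>Primes, dimension and maximal ideals of the pull-back\<close>

context valuation_pullback
begin

text \<open>\<open>M\<close> is absorbed because it is an ideal of \<open>R\<close>, so it stays in
  \<open>A0\<close> after division by \<open>p\<close>. Outside \<open>M\<close>, division by
  \<open>p\<close> lowers the value by one.\<close>

lemma PIdl_p_eq: "PIdl\<^bsub>A\<^esub> p = {x \<in> carrier R. x \<in> M \<or> w x \<ge> 1}"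
proof -
  have "scale R p A0 \<subseteq> {x \<in> carrier R. x \<in> M \<or> w x \<ge> 1}"
  proof
    fix x assume "x \<in> scale R p A0"
    then obtain y where y: "y \<in> A0" "x = p \<otimes> y" by (auto simp: scale_def)
    then show "x \<in> {x \<in> carrier R. x \<in> M \<or> w x \<ge> 1}"
      using w_mult[of p y] p_carrier p_notin_M w_p M_prime[of p y] by (auto simp: A0_def)
  qed
  moreover have "{x \<in> carrier R. x \<in> M \<or> w x \<ge> 1} \<subseteq> scale R p A0"
  proof
    fix x assume x: "x \<in> {x \<in> carrier R. x \<in> M \<or> w x \<ge> 1}"
    have e: "x = p \<otimes> (inv p \<otimes> x)"
      using x p_carrier inv_p_carrier p_inv by (simp flip: m_assoc)
    have "w x = 1 + w (inv p \<otimes> x)" if "x \<notin> M"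
      using w_mult[of p "inv p \<otimes> x"] that x p_carrier p_notin_M w_p M_prime[of "inv p" x]
        inv_p_carrier inv_p_notin_M e by auto
    then have "inv p \<otimes> x \<in> A0" using x inv_p_carrier M_prime[of "inv p" x] by (auto simp: A0_def)
    then show "x \<in> scale R p A0" using e by (auto simp: scale_def)
  qed
  ultimately show ?thesis by (simp add: A_PIdl p_A0)
qed

text \<open>An element of \<open>A0\<close> outside this ideal has value 0, so it has an inverse in
  \<open>A0\<close> modulo \<open>M\<close>, and \<open>M\<close> lies in the ideal.\<close>

lemma PIdl_p_maximal: "maximalideal (PIdl\<^bsub>A\<^esub> p) A"
proof (rule maximalidealI)
  show "ideal (PIdl\<^bsub>A\<^esub> p) A" using cring.cgenideal_ideal[OF A_cring] p_A0 by simp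
  have "\<one> \<notin> PIdl\<^bsub>A\<^esub> p" using one_notin_M w_one by (simp add: PIdl_p_eq)
  then show "carrier A \<noteq> PIdl\<^bsub>A\<^esub> p" using A0_subring(3) by auto
  fix J assume J: "ideal J A" "PIdl\<^bsub>A\<^esub> p \<subseteq> J" "J \<subseteq> carrier A"
  show "J = PIdl\<^bsub>A\<^esub> p \<or> J = carrier A"
  proof (rule disjCI)
    assume "J \<noteq> carrier A"
    then have 1: "\<one> \<notin> J" using ideal.one_imp_carrier[OF J(1)] by auto
    have "J \<subseteq> PIdl\<^bsub>A\<^esub> p"
    proof (rule ccontr)
      assume "\<not> ?thesis"
      then obtain x where x: "x \<in> J" "x \<notin> PIdl\<^bsub>A\<^esub> p" by blast
      then have "x \<in> A0" using J(3) by auto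
      then have x': "x \<in> carrier R - M" "w x \<le> w \<one>"
        using x(2) w_one unfolding PIdl_p_eq by (auto simp: A0_def)
      obtain e m where e: "e \<in> A0" "m \<in> M" "e \<otimes> x = \<one> \<oplus> m"
        using A0_multiple_mod[OF x'(1) _ x'(2)] one_notin_M by blast
      have mc: "m \<in> carrier R" using e(2) M_carrier by blast
      have "\<ominus> m \<in> M" using ideal_uminus[OF M_ideal e(2)] .
      then have "\<ominus> m \<in> J" using J(2) ideal_subset[OF M_ideal] by (auto simp: PIdl_p_eq)
      moreover have "\<one> \<oplus> m \<in> J" using J(1) e x(1) by (auto simp: A_ideal_iff simp flip: e(3))
      ultimately have "(\<one> \<oplus> m) \<oplus> \<ominus> m \<in> J" using J(1) by (auto simp: A_ideal_iff)
      moreover have "(\<one> \<oplus> m) \<oplus> \<ominus> m = \<one>" using mc by algebra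
      ultimately show False using 1 by simp
    qed
    then show "J = PIdl\<^bsub>A\<^esub> p" using J(2) by blast
  qed
qed

lemma PIdl_p_prime: "primeideal (PIdl\<^bsub>A\<^esub> p) A"
  by (rule cring.maximalideal_primeideal[OF A_cring PIdl_p_maximal])

lemma M_prime_A: "primeideal M A"
  unfolding primeideal_A_iff using M_ideal_A one_notin_M M_prime A0_carrier by blast

text \<open>The correspondence of primes for the localization inverting \<open>p\<close>: a prime
  without \<open>p\<close> contains no power of \<open>p\<close>, so denominators cancel.\<close>

lemma prime_extension:
  assumes P: "primeideal P A" and p: "p \<notin> P"
  shows "primeideal (extension P) R" "extension P \<inter> A0 = P"
proof -
  have P': "ideal P A" "\<one> \<notin> P" "\<And>a b. a \<in> A0 \<Longrightarrow> b \<in> A0 \<Longrightarrow> a \<otimes> b \<in> P \<Longrightarrow> a \<in> P \<or> b \<in> P"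
    using P unfolding primeideal_A_iff by auto
  have pn: "p [^] (n::nat) \<notin> P" for n
  proof (induction n)
    case (Suc n)
    then show ?case using P'(3)[of "p [^] n" p] A0_pow[OF p_A0] p_A0 p by auto
  qed (use P'(2) in simp)
  have eP: "x \<in> P" if x: "x \<in> A0" "x \<in> extension P" for x
  proof -
    obtain n :: nat where "p [^] n \<otimes> x \<in> P" using x(2) by (auto simp: extension_def)
    then show ?thesis using P'(3)[of "p [^] n" x] pn A0_pow[OF p_A0] x(1) by blast
  qed
  then show eq: "extension P \<inter> A0 = P"
    using extension_superset[of P] P'(1) by (auto simp: A_ideal_iff)
  show "primeideal (extension P) R"
  proof (rule primeidealI[OF extension_ideal[OF P'(1)] is_cring])
    have "\<one> \<notin> extension P" using eq P'(2) A0_subring(3) by blast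
    then show "carrier R \<noteq> extension P" by auto
    fix a b assume ab: "a \<in> carrier R" "b \<in> carrier R" "a \<otimes> b \<in> extension P"
    obtain k l :: nat where kl: "p [^] k \<otimes> a \<in> A0" "p [^] l \<otimes> b \<in> A0"
      using p_pow_mult_A0[OF ab(1)] p_pow_mult_A0[OF ab(2)] by metis
    have "(p [^] k \<otimes> a) \<otimes> (p [^] l \<otimes> b) = (p [^] k \<otimes> p [^] l) \<otimes> (a \<otimes> b)"
      using ab p_pow_closed by (simp add: m_ac)
    also have "\<dots> \<in> extension P" using p_pow_closed by (intro ideal_mult[OF extension_ideal[OF P'(1)] _ ab(3)]) auto
    finally have "(p [^] k \<otimes> a) \<otimes> (p [^] l \<otimes> b) \<in> P" using eP A0_subring(6)[OF kl] by blast
    then have "p [^] k \<otimes> a \<in> P \<or> p [^] l \<otimes> b \<in> P" using P'(3) kl by blast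
    then show "a \<in> extension P \<or> b \<in> extension P" using ab by (auto simp: extension_def)
  qed
qed

lemma prime_containing_p:
  assumes P: "primeideal P A" and p: "p \<in> P"
  shows "P = PIdl\<^bsub>A\<^esub> p"
proof -
  have "PIdl\<^bsub>A\<^esub> p \<subseteq> P" using ring.cgenideal_minimal[OF cring.axioms(1)[OF A_cring] primeideal_ideal[OF P] p] .
  then show ?thesis
    using cring.maximalideal_eq[OF A_cring PIdl_p_maximal primeideal_ideal[OF P]] primeideal_notone[OF P] by simp
qed

lemma krull_dim_A: "krull_dim A = 2"
  unfolding krull_dim_def
proof (rule antisym)
  show "Sup {enat n |n. \<exists>P. (\<forall>i\<le>n. primeideal (P i) A) \<and> (\<forall>i<n. P i \<subset> P (Suc i))} \<le> 2" (is "Sup ?S \<le> 2")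
  proof (rule Sup_least)
    fix d assume "d \<in> ?S"
    then obtain n P where d: "d = enat n" and P: "\<forall>i\<le>n. primeideal (P i) A" "\<forall>i<n. P i \<subset> P (Suc i)"
      by blast
    show "d \<le> 2"
    proof (rule ccontr)
      assume "\<not> d \<le> 2"
      then have n: "n \<ge> 3" using d by (simp add: numeral_eq_enat)
      have pr: "primeideal (P 0) A" "primeideal (P 1) A" "primeideal (P 2) A" "primeideal (P 3) A"
        using P(1) n by auto
      have ss: "P 0 \<subset> P 1" "P 1 \<subset> P 2" "P 2 \<subset> P 3"
        using P(2)[rule_format, of 0] P(2)[rule_format, of 1] P(2)[rule_format, of 2] n
        by (auto simp: numeral_2_eq_2 numeral_3_eq_3)
      have notp: "p \<notin> S" if S: "primeideal S A" "S \<subset> T" and T: "primeideal T A" for S T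
      proof
        assume "p \<in> S"
        then have "S = PIdl\<^bsub>A\<^esub> p" "T = PIdl\<^bsub>A\<^esub> p" using prime_containing_p S T by blast+
        then show False using S by blast
      qed
      have "p \<notin> P 1" "p \<notin> P 2" using notp pr ss by blast+
      then have e1: "primeideal (extension (P 1)) R" "extension (P 1) \<inter> A0 = P 1"
        and e2: "primeideal (extension (P 2)) R" "extension (P 2) \<inter> A0 = P 2"
        using prime_extension pr by auto
      have "\<zero> \<in> P 0" using ideal_zero[OF primeideal_ideal[OF pr(1)]] by simp
      then have "P 1 \<noteq> {\<zero>}" using ss(1) by auto
      then have "extension (P 1) \<noteq> {\<zero>}" using e1(2) A0_subring(2) by auto
      then have "maximalideal (extension (P 1)) R" using sp_domain_primeideal_maximal[OF sp e1(1)] by blast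
      \<comment> \<open>The first extension is a nonzero prime of \<open>R\<close> and hence
        maximal. Contracting then identifies \<open>P 1\<close> with \<open>P 2\<close>.\<close>
      then have "extension (P 2) = extension (P 1)"
        using maximalideal_eq primeideal_ideal[OF e2(1)] primeideal_notone[OF e2(1)]
          extension_mono[of "P 1" "P 2"] ss(2) by blast
      then show False using e1(2) e2(2) ss(2) by blast
    qed
  qed
  let ?P = "\<lambda>i::nat. if i = 0 then {\<zero>} else if i = 1 then M else PIdl\<^bsub>A\<^esub> p"
  have "primeideal {\<zero>} A" using domain.zeroprimeideal[OF A_domain] by simp
  then have "\<forall>i\<le>2. primeideal (?P i) A" using M_prime_A PIdl_p_prime by simp
  moreover have "{\<zero>} \<subset> M" using ideal_zero[OF M_ideal] cgenideal_self[OF q] q0 by blast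
  moreover have "M \<subset> PIdl\<^bsub>A\<^esub> p" using ideal_subset[OF M_ideal] p_carrier p_notin_M w_p by (auto simp: PIdl_p_eq)
  ultimately have "(\<forall>i\<le>2. primeideal (?P i) A) \<and> (\<forall>i<2. ?P i \<subset> ?P (Suc i))"
  proof -
    assume *: "\<forall>i\<le>2. primeideal (?P i) A" "{\<zero>} \<subset> M" "M \<subset> PIdl\<^bsub>A\<^esub> p"
    have "?P i \<subset> ?P (Suc i)" if "i < 2" for i
    proof -
      have "i = 0 \<or> i = 1" using that by linarith
      then show ?thesis using *(2,3) by (elim disjE) simp_all
    qed
    then show ?thesis using *(1) by blast
  qed
  then have "\<exists>P. (\<forall>i\<le>2. primeideal (P i) A) \<and> (\<forall>i<2. P i \<subset> P (Suc i))" by (rule exI[of _ ?P])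
  then have "enat 2 \<in> ?S" by (intro CollectI exI[of _ "2::nat"] conjI refl)
  then show "2 \<le> Sup ?S" unfolding numeral_eq_enat by (intro Sup_upper) simp
qed

text \<open>A strictly larger ideal of \<open>A\<close> extends to the whole of \<open>R\<close>, so
  it contains a power of \<open>p\<close>; it also contains an element \<open>1 + m\<close> coming
  from \<open>N\<close>. These are comaximal. The exception is real: \<open>M\<close> itself lies
  strictly inside \<open>pA\<close>.\<close>

lemma contraction_maximal:
  assumes N: "maximalideal N R" "N \<noteq> M"
  shows "maximalideal (N \<inter> A0) A"
proof (rule maximalidealI)
  have iN: "ideal N R" using N by (simp add: maximalideal_ideal)
  have N1: "\<one> \<notin> N" using primeideal_notone[OF maximalideal_primeideal[OF N(1)]] .
  show "ideal (N \<inter> A0) A" using contraction_ideal[OF iN] .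
  show "carrier A \<noteq> N \<inter> A0" using N1 A0_subring(3) by auto
  have "\<not> N \<subseteq> M" using maximalideal_eq[OF N(1) M_ideal _ one_notin_M] N(2) by blast
  then obtain m where m: "m \<in> M" "\<one> \<oplus> m \<in> N" using comaximal_M[OF iN] by blast
  have mA: "\<one> \<oplus> m \<in> A0" using m M_A0 A0_subring(3,7) by blast
  have mc: "m \<in> carrier R" using m M_carrier by blast
  fix J assume J: "ideal J A" "N \<inter> A0 \<subseteq> J" "J \<subseteq> carrier A"
  show "J = N \<inter> A0 \<or> J = carrier A"
  proof (cases "J = N \<inter> A0")
    case False
    then obtain x where x: "x \<in> J" "x \<notin> N" "x \<in> A0" using J by auto
    have xc: "x \<in> carrier R" using x A0_carrier by blast
    have K: "\<And>x y. x \<in> J \<Longrightarrow> y \<in> J \<Longrightarrow> x \<oplus> y \<in> J" "\<And>r x. r \<in> A0 \<Longrightarrow> x \<in> J \<Longrightarrow> r \<otimes> x \<in> J"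
      using J(1) by (auto simp: A_ideal_iff)
    let ?E = "extension J"
    have iE: "ideal ?E R" using extension_ideal[OF J(1)] .
    have NE: "N \<subseteq> ?E" using extension_mono[OF J(2)] extension_contraction[OF iN] by simp
    have xE: "x \<in> ?E" using extension_superset[of J] J(3) x(1) by auto
    have "\<one> \<in> ?E" using maximalideal_eq[OF N(1) iE NE] xE x(2) by blast
    then obtain n :: nat where n: "p [^] n \<otimes> \<one> \<in> J" by (auto simp: extension_def)
    have "(\<one> \<oplus> m) \<otimes> \<one> \<in> J" using m(2) mA J(2) mc by auto
    then have "\<one> \<in> J" using submodule_mem_local[of J \<one> m n] K m(1) n by blast
    then show ?thesis using ideal.one_imp_carrier[OF J(1)] by simp
  qed simp
qed

end

text \<open>\<open>h_local\<close> counts maximal ideals of a quotient; this moves those of the ring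
  above \<open>J\<close> there.\<close>

lemma (in ring) maximalideal_Quot:
  assumes J: "ideal J R" and N: "maximalideal N R" "J \<subseteq> N"
  shows "maximalideal ((+>) J ` N) (R Quot J)"
proof (rule maximalidealI)
  have iN: "ideal N R" using N(1) by (simp add: maximalideal.axioms(1))
  show "ideal ((+>) J ` N) (R Quot J)" using ring_ideal_imp_quot_ideal[OF J iN] .
  note bij = quot_ideal_correspondence[OF J]
  have carr: "carrier (R Quot J) = (+>) J ` carrier R"
    by (auto simp: FactRing_def A_RCOSETS_def')
  have inj: "I = I'" if "ideal I R" "J \<subseteq> I" "ideal I' R" "J \<subseteq> I'" "(+>) J ` I = (+>) J ` I'" for I I'
    using bij_betw_imp_inj_on[OF bij] that unfolding inj_on_def by blast
  show "carrier (R Quot J) \<noteq> (+>) J ` N"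
    using inj[OF oneideal _ iN N(2)] ideal.Icarr[OF J] maximalideal.I_notcarr[OF N(1)] carr by auto
  fix W assume W: "ideal W (R Quot J)" "(+>) J ` N \<subseteq> W" "W \<subseteq> carrier (R Quot J)"
  then have "W \<in> (\<lambda>I. (+>) J ` I) ` {I. ideal I R \<and> J \<subseteq> I}"
    using bij_betw_imp_surj_on[OF bij] by blast
  then obtain I where I: "ideal I R" "J \<subseteq> I" "W = (+>) J ` I" by blast
  have "N \<subseteq> I"
  proof
    fix x assume x: "x \<in> N"
    then have xc: "x \<in> carrier R" using iN by (simp add: ideal.Icarr)
    have "J +> x \<in> (+>) J ` I" using x W(2) I(3) by blast
    then obtain y where y: "y \<in> I" "J +> x = J +> y" by blast
    have "y \<in> carrier R" using y I by (simp add: ideal.Icarr)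
    then have "x \<ominus> y \<in> J" using quotient_eq_iff_same_a_r_cos[OF J xc] y(2) by blast
    then have "(x \<ominus> y) \<oplus> y \<in> I" using I y by (intro ideal_add[OF I(1)]) auto
    moreover have "(x \<ominus> y) \<oplus> y = x" using xc \<open>y \<in> carrier R\<close> by (simp add: a_minus_def a_assoc l_neg)
    ultimately show "x \<in> I" by simp
  qed
  then have "I = N \<or> I = carrier R"
    using maximalideal.I_maximal[OF N(1) I(1)] ideal.Icarr[OF I(1)] by blast
  then show "W = (+>) J ` N \<or> W = carrier (R Quot J)" using I(3) carr by blast
qed

section \<open>Failure of h-locality\<close>

context valuation_pullback
begin

lemma not_h_local_A:
  assumes nd: "\<not> dedekind_domain R"
  shows "\<not> h_local A"
proof
  assume h: "h_local A"
  have "dedekind_domain R"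
  proof (rule dedekind_domainI[OF sp])
    fix I assume I: "ideal I R" "I \<noteq> {\<zero>}"
    let ?J = "I \<inter> A0"
    have iJ: "ideal ?J A" using contraction_ideal[OF I(1)] .
    have "?J \<noteq> {\<zero>}"
    proof
      assume J0: "?J = {\<zero>}"
      obtain x where x: "x \<in> I" "x \<noteq> \<zero>" using I ideal_zero[OF I(1)] by blast
      have xc: "x \<in> carrier R" using x I by (auto intro: ideal.Icarr)
      obtain n :: nat where "p [^] n \<otimes> x \<in> ?J"
        using extension_contraction[OF I(1)] x(1) by (auto simp: extension_def)
      then have "p [^] n \<otimes> x = \<zero>" using J0 by simp
      then have "inv p [^] n \<otimes> \<zero> = x" using p_pow_cancel[OF xc, of n] by simp
      then show False using x(2) p_pow_closed by simp
    qed
    then have fin: "finite {N. maximalideal N (A Quot ?J)}"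
      using h iJ unfolding h_local_def by simp
    let ?f = "\<lambda>N. (+>\<^bsub>A\<^esub>) ?J ` (N \<inter> A0)"
    \<comment> \<open>\<open>M\<close> is left out because its contraction is not maximal; one
      further ideal does not affect finiteness.\<close>
    let ?S = "{N. maximalideal N R \<and> I \<subseteq> N} - {M}"
    have rA: "ring A" using A_cring by (rule cring.axioms)
    have "?f ` ?S \<subseteq> {N. maximalideal N (A Quot ?J)}"
      using ring.maximalideal_Quot[OF rA iJ] contraction_maximal by auto
    then have "finite (?f ` ?S)" using fin finite_subset by blast
    moreover have "inj_on ?f ?S"
    proof (rule inj_onI)
      fix N N' assume N: "N \<in> ?S" "N' \<in> ?S" "?f N = ?f N'"
      then have id: "ideal N R" "ideal N' R" by (auto simp: maximalideal_ideal)
      have "N \<inter> A0 = N' \<inter> A0"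
        by (rule inj_onD[OF bij_betw_imp_inj_on[OF ring.quot_ideal_correspondence[OF rA iJ]] N(3)])
          (use N contraction_ideal id in auto)
      then show "N = N'" using extension_contraction id by metis
    qed
    ultimately have "finite ?S" using finite_imageD by blast
    then show "finite {N. maximalideal N R \<and> I \<subseteq> N}" by simp
  qed
  then show False using nd by blast
qed

end

section \<open>Factorization of ideals of the pull-back\<close>

context valuation_pullback
begin

lemma isp_factorI:
  assumes a: "a \<in> A0" "a \<noteq> \<zero>" and Qs: "Qs \<noteq> []" "\<forall>Q\<in>set Qs. radical_ideal Q A \<and> Q \<noteq> carrier A"
    and I: "I = scale R a (ideal_prod_list A Qs)"
  shows "\<exists>J Qs. invertible_ideal J A \<and> length Qs \<ge> 1 \<and>
           (\<forall>Q\<in>set Qs. radical_ideal Q A \<and> Q \<noteq> carrier A) \<and>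
           I = ideal_prod A J (ideal_prod_list A Qs)"
proof (intro exI conjI)
  show "invertible_ideal (PIdl\<^bsub>A\<^esub> a) A" using domain.cgenideal_invertible[OF A_domain] a by simp
  show "length Qs \<ge> 1" using Qs(1) by (simp add: Suc_le_eq)
  have "ideal (ideal_prod_list A Qs) A"
    using Qs(2) by (intro cring.ideal_prod_list_ideal[OF A_cring]) (auto intro: radical_ideal_ideal)
  then show "I = ideal_prod A (PIdl\<^bsub>A\<^esub> a) (ideal_prod_list A Qs)"
    using cring.cgenideal_prod_eq_scale[OF A_cring, of a] a(1) I by (simp add: A_scale)
qed (use Qs(2) in auto)

text \<open>Locally at \<open>pA\<close>, the pull-back is a rank two valuation domain: dividing the ideal by the
  part \<open>q^m\<close> of its extension, the result \<open>I'\<close> is determined by its extension \<open>B\<close> and the set of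
  values \<open>w\<close> of \<open>I'\<close>, which is either all of the integers or bounded below.\<close>

lemma isp_domain_A: "isp_domain A"
  unfolding isp_domain_def
proof (intro conjI allI impI)
  show "domain A" by (rule A_domain)
  fix I assume I': "ideal I A \<and> I \<noteq> {\<zero>\<^bsub>A\<^esub>} \<and> I \<noteq> carrier A"
  have iI: "ideal I A" and I0: "I \<noteq> {\<zero>}" and I1: "I \<noteq> A0" using I' by auto
  have I: "I \<subseteq> A0" "\<zero> \<in> I" "\<And>x y. x \<in> I \<Longrightarrow> y \<in> I \<Longrightarrow> x \<oplus> y \<in> I"
    "\<And>r x. r \<in> A0 \<Longrightarrow> x \<in> I \<Longrightarrow> r \<otimes> x \<in> I"
    using iI unfolding A_ideal_iff by auto
  have one_notin: "\<one> \<notin> I" using ideal.one_imp_carrier[OF iI] I1 by auto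
  have iE: "ideal (extension I) R" by (rule extension_ideal[OF iI])
  have "extension I \<noteq> {\<zero>}" using extension_superset[OF I(1)] I0 I(2) by blast
  then obtain m Bs where Bs: "\<forall>B\<in>set Bs. radical_ideal B R \<and> \<not> B \<subseteq> M"
    "extension I = scale R (q [^] (m::nat)) (ideal_prod_list R Bs)"
    using ideal_factor_q[OF iE] by metis
  have id: "\<forall>B\<in>set Bs. ideal B R" using Bs(1) by (auto intro: radical_ideal_ideal)
  define B where "B = ideal_prod_list R Bs"
  have iB: "ideal B R" unfolding B_def using id by (rule ideal_prod_list_ideal)
  have BM: "\<not> B \<subseteq> M" unfolding B_def
    using ideal_prod_list_subset_prime[OF primeideal_q id] Bs(1) by blast
  \<comment> \<open>Unit factors are dropped, as the radical factors of an ISP factorization must be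
    proper.\<close>
  define Cs where "Cs = filter (\<lambda>B. B \<noteq> carrier R) Bs"
  have "ideal_prod_list R (filter (\<lambda>B. B \<noteq> carrier R) Bs) = ideal_prod_list R Bs"
    using id
  proof (induction Bs)
    case (Cons L Ls)
    have "ideal (ideal_prod_list R Ls) R" using Cons.prems by (intro ideal_prod_list_ideal) auto
    then have "carrier R \<cdot> ideal_prod_list R Ls = ideal_prod_list R Ls"
      using ideal_prod_one ideal_prod_commute oneideal by metis
    then show ?case using Cons by (auto simp: ideal_prod_list_Cons)
  qed simp
  then have BCs: "B = ideal_prod_list R Cs" by (simp add: B_def Cs_def)
  let ?Ds = "map (\<lambda>B. B \<inter> A0) Cs"
  have Ds: "ideal_prod_list A ?Ds = B \<inter> A0"
    unfolding BCs using id Bs(1) by (intro contraction_prod_list) (auto simp: Cs_def)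
  have radDs: "\<forall>Q\<in>set ?Ds. radical_ideal Q A \<and> Q \<noteq> carrier A"
  proof
    fix Q assume "Q \<in> set ?Ds"
    then obtain L where L: "L \<in> set Bs" "L \<noteq> carrier R" "Q = L \<inter> A0" by (auto simp: Cs_def)
    then have "\<one> \<notin> L" using id ideal.one_imp_carrier by blast
    then show "radical_ideal Q A \<and> Q \<noteq> carrier A"
      using L contraction_radical Bs(1) A0_subring(3) by auto
  qed
  let ?q = "q [^] m"
  have qc: "?q \<in> carrier R" using q by simp
  have qn0: "?q \<noteq> \<zero>" using primeideal_pow[OF zeroprimeideal q, of m] q0 by auto
  \<comment> \<open>For \<open>m > 0\<close> this need not be contained in \<open>A0\<close>, as
    multiplying by \<open>q^m\<close> sends all of \<open>R\<close> into \<open>M\<close>. It is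
    still closed under sums and multiplication by \<open>A0\<close>.\<close>
  define I' where "I' = {x \<in> carrier R. ?q \<otimes> x \<in> I}"
  have I'c: "x \<in> carrier R" if "x \<in> I'" for x using that by (simp add: I'_def)
  have K: "\<And>x y. x \<in> I' \<Longrightarrow> y \<in> I' \<Longrightarrow> x \<oplus> y \<in> I'" "\<And>r x. r \<in> A0 \<Longrightarrow> x \<in> I' \<Longrightarrow> r \<otimes> x \<in> I'"
  proof -
    fix x y assume "x \<in> I'" "y \<in> I'"
    then show "x \<oplus> y \<in> I'" using I(3)[of "?q \<otimes> x" "?q \<otimes> y"] qc by (simp add: I'_def r_distr)
  next
    fix r x assume r: "r \<in> A0" and "x \<in> I'"
    then have "r \<otimes> (?q \<otimes> x) \<in> I" "x \<in> carrier R" using I(4) by (auto simp: I'_def)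
    then show "r \<otimes> x \<in> I'" using qc A0_carrier[OF r] by (simp add: I'_def m_lcomm)
  qed
  have Bext: "x \<in> B \<longleftrightarrow> x \<in> carrier R \<and> ?q \<otimes> x \<in> extension I" for x
  proof
    assume "x \<in> B"
    then show "x \<in> carrier R \<and> ?q \<otimes> x \<in> extension I"
      using iB Bs(2) by (auto simp: B_def scale_def ideal.Icarr)
  next
    assume x: "x \<in> carrier R \<and> ?q \<otimes> x \<in> extension I"
    then obtain b where b: "b \<in> B" "?q \<otimes> x = ?q \<otimes> b" using Bs(2) by (auto simp: B_def scale_def)
    then have "x = b" using x qc qn0 m_lcancel[OF qn0 qc, of x b] ideal.Icarr[OF iB] by simp
    then show "x \<in> B" using b by simp
  qed
  have I'B: "I' \<subseteq> B" using extension_superset[OF I(1)] by (auto simp: Bext I'_def)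
  have Bp: "\<exists>n::nat. p [^] n \<otimes> x \<in> I'" if "x \<in> B" for x
  proof -
    have x: "x \<in> carrier R" "?q \<otimes> x \<in> extension I" using that Bext by auto
    then obtain n :: nat where "p [^] n \<otimes> (?q \<otimes> x) \<in> I" by (auto simp: extension_def)
    then have "?q \<otimes> (p [^] n \<otimes> x) \<in> I" using x qc p_pow_closed by (simp add: m_lcomm)
    then show ?thesis using x p_pow_closed unfolding I'_def by blast
  qed
  have II': "I = scale R ?q I'"
  proof
    show "I \<subseteq> scale R ?q I'"
    proof
      fix x assume x: "x \<in> I"
      then have "x \<in> scale R ?q B" using extension_superset[OF I(1)] Bs(2) by (auto simp: B_def)
      then obtain b where "b \<in> B" "x = ?q \<otimes> b" by (auto simp: scale_def)
      then show "x \<in> scale R ?q I'" using x ideal.Icarr[OF iB] by (auto simp: I'_def scale_def)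
    qed
  qed (auto simp: scale_def I'_def)
  obtain u0 where u0: "u0 \<in> I'" "u0 \<notin> M"
  proof -
    obtain b where b: "b \<in> B" "b \<notin> M" using BM by blast
    have bc: "b \<in> carrier R" using b iB by (auto intro: ideal.Icarr)
    obtain n :: nat where n: "p [^] n \<otimes> b \<in> I'" using Bp b by blast
    have "p [^] n \<otimes> b \<notin> M"
      using M_prime[OF p_pow_closed(1) bc] w_pow[of p n] p_carrier p_notin_M b(2) by auto
    then show ?thesis using that n by blast
  qed
  \<comment> \<open>Some power of \<open>p\<close> takes \<open>x\<close> into \<open>I'\<close>, so
    a multiple \<open>(1 + m) x\<close> with \<open>m\<close> in \<open>M\<close> suffices. Write
    \<open>e u0 = g + k\<close> with \<open>g\<close> a unit of \<open>R\<close>. As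
    \<open>x g'\<close> is in \<open>M\<close>, hence in \<open>A0\<close>, the product
    \<open>(x g')(e u0) = (1 + k g') x\<close> is in \<open>I'\<close>.\<close>
  have BMI': "B \<inter> M \<subseteq> I'"
  proof
    fix x assume x: "x \<in> B \<inter> M"
    have xc: "x \<in> carrier R" using x M_carrier by blast
    obtain g g' where g: "g \<in> carrier R" "g' \<in> carrier R" "g \<otimes> g' = \<one>" "g \<notin> M" "w g = w u0"
      using exists_unit_with_value[of "w u0"] by metis
    obtain e k where e: "e \<in> A0" "k \<in> M" "e \<otimes> u0 = g \<oplus> k"
      using A0_multiple_mod[of u0 g] u0 I'c g by auto
    have kc: "k \<in> carrier R" using e M_carrier by blast
    have "x \<otimes> g' \<in> A0" using x g M_A0 ideal.I_r_closed[OF M_ideal] by blast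
    then have "(x \<otimes> g') \<otimes> (e \<otimes> u0) \<in> I'" using K(2) e(1) u0(1) by blast
    moreover have "(x \<otimes> g') \<otimes> (g \<oplus> k) = (g \<otimes> g' \<oplus> k \<otimes> g') \<otimes> x"
      using xc g(1,2) kc by algebra
    ultimately have "(\<one> \<oplus> k \<otimes> g') \<otimes> x \<in> I'" by (simp only: e(3) g(3))
    moreover have "k \<otimes> g' \<in> M" using ideal.I_r_closed[OF M_ideal e(2) g(2)] .
    moreover obtain n :: nat where "p [^] n \<otimes> x \<in> I'" using Bp x by blast
    ultimately show "x \<in> I'" using submodule_mem_local[of I' x "k \<otimes> g'" n] K xc by blast
  qed
  \<comment> \<open>Here \<open>x = e u - k\<close>, and the error \<open>k\<close> lies in both
    \<open>B\<close> and \<open>M\<close>, so \<open>BMI'\<close> handles it.\<close>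
  have dominate: "x \<in> I'" if x: "x \<in> B" "x \<notin> M" and u: "u \<in> I'" "u \<notin> M" "w u \<le> w x" for x u
  proof -
    have xc: "x \<in> carrier R" using x iB by (auto intro: ideal.Icarr)
    have uc: "u \<in> carrier R" using u I'c by blast
    obtain e k where e: "e \<in> A0" "k \<in> M" "e \<otimes> u = x \<oplus> k"
      using A0_multiple_mod[of u x] x u xc uc by auto
    have kc: "k \<in> carrier R" using e M_carrier by blast
    have eu: "e \<otimes> u \<in> I'" using K(2) e u by blast
    have "k = (x \<oplus> k) \<ominus> x" using xc kc by algebra
    also have "\<dots> \<in> B" using e(3) eu I'B x by (intro ideal_minus[OF iB]) auto
    finally have "k \<in> B" .
    then have "\<ominus> k \<in> I'" using BMI' ideal_uminus[OF iB] ideal_uminus[OF M_ideal e(2)] by blast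
    then have "e \<otimes> u \<oplus> \<ominus> k \<in> I'" using K(1) eu by blast
    moreover have "(x \<oplus> k) \<oplus> \<ominus> k = x" using xc kc by algebra
    ultimately show ?thesis using e(3) by simp
  qed
  have I'I: "I' = I" if "m = 0" using that I(1) A0_carrier by (auto simp: I'_def)
  have qM: "q [^] Suc k \<in> M" for k :: nat
    using ideal_mult[OF M_ideal, of "q [^] k" q] cgenideal_self[OF q] q by simp
  show "\<exists>J Qs. invertible_ideal J A \<and> length Qs \<ge> 1 \<and>
           (\<forall>Q\<in>set Qs. radical_ideal Q A \<and> Q \<noteq> carrier A) \<and>
           I = ideal_prod A J (ideal_prod_list A Qs)"
  proof (cases "\<forall>k. \<exists>u\<in>I' - M. w u \<le> k")
    case True
    \<comment> \<open>Values unbounded below let \<open>dominate\<close> reach every element of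
      \<open>B\<close> outside \<open>M\<close>.\<close>
    have "B \<subseteq> I'" using BMI' dominate True by blast
    then have I'eq: "I' = B" using I'B by blast
    \<comment> \<open>Without a factor \<open>q\<close>, the ideal \<open>I\<close> itself would
      have elements of negative value, which \<open>A0\<close> excludes.\<close>
    have "m \<noteq> 0"
    proof
      assume "m = 0"
      obtain u where "u \<in> I' - M" "w u \<le> -1" using True by blast
      then show False using I'I[OF \<open>m = 0\<close>] I(1) by (auto simp: A0_def)
    qed
    then obtain k where k: "m = Suc k" by (cases m) auto
    have qk: "q [^] k \<in> A0" "q [^] k \<noteq> \<zero>"
      using A0_pow[of q k] M_A0 cgenideal_self[OF q] primeideal_pow[OF zeroprimeideal q, of k] q0 by auto
    have qkc: "q [^] k \<in> carrier R" using q by simp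
    have iBA: "ideal (B \<inter> A0) A" by (rule contraction_ideal[OF iB])
    \<comment> \<open>The factor \<open>M\<close> absorbs negative powers of \<open>p\<close>, so
      contracting \<open>B\<close> loses nothing once it is multiplied by \<open>M\<close>.\<close>
    have MB: "M \<cdot> (B \<inter> A0) = scale R q B"
    proof
      show "M \<cdot> (B \<inter> A0) \<subseteq> scale R q B"
      proof (rule ideal_prod_subset[OF scale_ideal[OF q iB]])
        fix i j assume "i \<in> M" and j: "j \<in> B \<inter> A0"
        then obtain c where c: "c \<in> carrier R" "i = c \<otimes> q" by (auto simp: cgenideal_def)
        have "i \<otimes> j = q \<otimes> (c \<otimes> j)" using c q j A0_carrier by (simp add: m_ac)
        then show "i \<otimes> j \<in> scale R q B" using ideal_mult[OF iB c(1)] j by (auto simp: scale_def)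
      qed
      show "scale R q B \<subseteq> M \<cdot> (B \<inter> A0)"
      proof
        fix x assume "x \<in> scale R q B"
        then obtain b where b: "b \<in> B" "x = q \<otimes> b" by (auto simp: scale_def)
        have bc: "b \<in> carrier R" using b iB by (auto intro: ideal.Icarr)
        obtain n :: nat where n: "p [^] n \<otimes> b \<in> A0" using p_pow_mult_A0[OF bc] .
        have "(inv p [^] n \<otimes> q) \<otimes> (p [^] n \<otimes> b) = q \<otimes> (inv p [^] n \<otimes> (p [^] n \<otimes> b))"
          using q bc p_pow_closed by (simp add: m_ac)
        then have "x = (inv p [^] n \<otimes> q) \<otimes> (p [^] n \<otimes> b)" using b(2) p_pow_cancel[OF bc] by simp
        moreover have "inv p [^] n \<otimes> q \<in> M"
          using ideal_mult[OF M_ideal p_pow_closed(2) cgenideal_self[OF q]] .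
        moreover have "p [^] n \<otimes> b \<in> B \<inter> A0" using n ideal_mult[OF iB p_pow_closed(1) b(1)] by blast
        ultimately show "x \<in> M \<cdot> (B \<inter> A0)" by (simp add: ideal_prod.prod)
      qed
    qed
    have "I = scale R (q [^] k) (scale R q B)"
      using II' qkc q ideal_subset[OF iB] by (simp add: I'eq k scale_scale)
    then have "I = scale R (q [^] k) (ideal_prod_list A (M # ?Ds))"
      using Ds MB by (simp add: ideal_prod_list_def A_ideal_prod)
    moreover have "radical_ideal M A"
      using contraction_radical[OF primeideal_radical[OF primeideal_q]] by (simp add: contraction_M)
    moreover have "M \<noteq> carrier A" using one_notin_M A0_subring(3) by auto
    ultimately show ?thesis using radDs by (intro isp_factorI[OF qk, of "M # ?Ds"]) auto
  next
    case False
    then obtain k where "\<not> (\<exists>u\<in>I' - M. w u \<le> k)" by (rule exE[OF iffD1[OF not_all]])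
    then have k: "k < w u" if "u \<in> I' - M" for u using that by (meson not_less)
    \<comment> \<open>The integers \<open>w u\<close> exceed \<open>k\<close>; shifting by
      \<open>k\<close> gives natural numbers and thus a least value.\<close>
    obtain u where u: "u \<in> I' - M" and min: "\<And>u'. u' \<in> I' - M \<Longrightarrow> w u \<le> w u'"
    proof -
      obtain u where u: "u \<in> I' - M" "\<And>u'. u' \<in> I' - M \<Longrightarrow> nat (w u - k) \<le> nat (w u' - k)"
        using ex_has_least_nat[of "\<lambda>u. u \<in> I' - M" u0 "\<lambda>u. nat (w u - k)"] u0 by blast
      show ?thesis
      proof (rule that[OF u(1)])
        fix u' assume "u' \<in> I' - M"
        then show "w u \<le> w u'" using u(2)[of u'] k[of u'] k[OF u(1)] by linarith
      qed
    qed
    obtain g g' where g: "g \<in> carrier R" "g' \<in> carrier R" "g \<otimes> g' = \<one>" "g \<notin> M" "g' \<notin> M"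
      "w g = w u" "w g' = - w u" by (rule exists_unit_with_value)
    \<comment> \<open>Division by \<open>g\<close>, of minimal value, makes all values nonnegative;
      conversely \<open>dominate\<close> recovers all of \<open>B\<close> from the value
      \<open>w u\<close> upwards.\<close>
    have I'eq: "I' = scale R g (B \<inter> A0)"
    proof
      show "I' \<subseteq> scale R g (B \<inter> A0)"
      proof
        fix x assume x: "x \<in> I'"
        have xc: "x \<in> carrier R" using x I'c by blast
        have "x = g \<otimes> (g' \<otimes> x)" using g xc by (simp flip: m_assoc)
        moreover have "g' \<otimes> x \<in> B" using ideal_mult[OF iB g(2)] x I'B by blast
        moreover have "g' \<otimes> x \<in> A0"
        proof (cases "x \<in> M")
          case True
          then show ?thesis using ideal_mult[OF M_ideal g(2)] M_A0 by blast
        next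
          case False
          then have "w (g' \<otimes> x) \<ge> 0" using w_mult[of g' x] g xc min[of x] x by simp
          then show ?thesis using g xc by (simp add: A0_def)
        qed
        ultimately show "x \<in> scale R g (B \<inter> A0)" by (auto simp: scale_def)
      qed
      show "scale R g (B \<inter> A0) \<subseteq> I'"
      proof
        fix x assume "x \<in> scale R g (B \<inter> A0)"
        then obtain y where y: "y \<in> B" "y \<in> A0" "x = g \<otimes> y" by (auto simp: scale_def)
        have yc: "y \<in> carrier R" using y A0_carrier by blast
        have xB: "x \<in> B" using ideal_mult[OF iB g(1) y(1)] y(3) by simp
        show "x \<in> I'"
        proof (cases "x \<in> M")
          case True
          then show ?thesis using xB BMI' by blast
        next
          case False
          then have "y \<notin> M" using M_prime[OF g(1) yc] y(3) by blast
          then have "w u \<le> w x" using w_mult[of g y] g yc y by (auto simp: A0_def)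
          then show ?thesis using dominate[OF xB False] u by blast
        qed
      qed
    qed
    let ?a = "?q \<otimes> g"
    have g0: "g \<noteq> \<zero>" using g(4) ideal_zero[OF M_ideal] by blast
    have Ia: "I = scale R ?a (B \<inter> A0)"
      using II' qc g(1) ideal_subset[OF iB] by (subst II', subst I'eq, subst scale_scale) auto
    have an0: "?a \<noteq> \<zero>" using integral_iff[OF qc g(1)] qn0 g0 by blast
    have aM: "?a \<otimes> c \<in> M" if m: "m \<noteq> 0" and c: "c \<in> carrier R" for c
    proof -
      obtain j where "m = Suc j" using m by (cases m) auto
      then have "?q \<in> M" using qM by simp
      then show ?thesis using ideal.I_r_closed[OF M_ideal] g(1) c by blast
    qed
    have w_g: "w g \<ge> 0" if "m = 0" using u I'I[OF that] I(1) g(6) by (auto simp: A0_def)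
    show ?thesis
    proof (cases "Cs = []")
      case False
      have "?a \<in> A0"
      proof (cases "m = 0")
        case True
        then show ?thesis using w_g g(1) by (simp add: A0_def)
      next
        case False
        then show ?thesis using aM[OF False one_closed] M_A0 qc g(1) by auto
      qed
      then show ?thesis
        using Ia Ds radDs an0 False by (intro isp_factorI[of ?a ?Ds]) auto
    next
      case True
      then have BR: "B = carrier R" using BCs by (simp add: ideal_prod_list_Nil)
      then have IaA: "I = scale R ?a A0" using Ia A0_carrier by (simp add: Int_absorb1 subsetI)
      \<comment> \<open>Now \<open>I\<close> is principal, but at least one proper radical factor is
        required. Dividing the generator by \<open>p\<close> splits off the maximal ideal
        \<open>pA\<close>.\<close>
      let ?b = "?a \<otimes> inv p"
      have ac: "?a \<in> carrier R" using qc g(1) by simp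
      have "?b \<in> A0"
      proof (cases "m = 0")
        case True
        \<comment> \<open>Value 0 would make \<open>g\<close> a unit of \<open>A\<close>, and
          \<open>I\<close> would not be proper.\<close>
        have "w g \<noteq> 0"
        proof
          assume "w g = 0"
          then have "g' \<in> A0" using g by (simp add: A0_def)
          then have "?a \<otimes> g' \<in> I" unfolding IaA by (simp add: scale_def)
          then show False using one_notin True g by simp
        qed
        then have "w g \<ge> 1" using w_g[OF True] by simp
        moreover have "w (inv p) = -1"
          using w_mult[of p "inv p"] p_carrier inv_p_carrier p_notin_M inv_p_notin_M p_inv w_one w_p by simp
        ultimately have "w (g \<otimes> inv p) \<ge> 0" using w_mult[of g "inv p"] g inv_p_carrier inv_p_notin_M by simp
        then show ?thesis using True g(1) inv_p_carrier by (simp add: A0_def)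
      next
        case False
        then show ?thesis using aM[OF False inv_p_carrier] M_A0 by blast
      qed
      moreover have "?b \<noteq> \<zero>" using integral_iff[OF ac inv_p_carrier] an0 inv_p_notin_M ideal_zero[OF M_ideal] by auto
      moreover have "I = scale R ?b (ideal_prod_list A [PIdl\<^bsub>A\<^esub> p])"
      proof -
        have "ideal_prod_list A [PIdl\<^bsub>A\<^esub> p] = PIdl\<^bsub>A\<^esub> p"
          using ring.ideal_prod_one[OF cring.axioms(1)[OF A_cring] maximalideal_ideal[OF PIdl_p_maximal]]
          by (simp add: ideal_prod_list_def)
        moreover have "?b \<otimes> p = ?a" using ac p inv_p_carrier p_carrier by (simp add: m_assoc)
        ultimately show ?thesis
          using IaA ac inv_p_carrier p_carrier A0_carrier by (simp add: A_PIdl p_A0 scale_scale subsetI)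
      qed
      moreover have "radical_ideal (PIdl\<^bsub>A\<^esub> p) A"
        using cring.primeideal_radical[OF A_cring PIdl_p_prime] .
      moreover have "PIdl\<^bsub>A\<^esub> p \<noteq> carrier A" using maximalideal.I_notcarr[OF PIdl_p_maximal] by blast
      ultimately show ?thesis by (intro isp_factorI[of ?b "[PIdl\<^bsub>A\<^esub> p]"]) auto
    qed
  qed
qed

end

text \<open>A generator of the maximal ideal has value one: otherwise the principal ideal generated by
  an element of value one would lie strictly between.\<close>

lemma discrete_valuation_generator:
  assumes dv: "discrete_valuation K v" and D: "D = {x \<in> carrier K. x = \<zero>\<^bsub>K\<^esub> \<or> v x \<ge> 0}"
    and sub: "subring D K"
    and y: "y \<in> carrier K" "y \<noteq> \<zero>\<^bsub>K\<^esub>" "maximalideal (PIdl\<^bsub>K\<lparr>carrier := D\<rparr>\<^esub> y) (K\<lparr>carrier := D\<rparr>)"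
  shows "v y = 1"
proof -
  interpret K: field K using dv by (simp add: discrete_valuation_def)
  let ?D = "K\<lparr>carrier := D\<rparr>"
  have cr: "cring ?D" using K.subring_is_domain[OF sub] by (rule domain.axioms)
  have v: "v (a \<otimes>\<^bsub>K\<^esub> b) = v a + v b"
    if "a \<in> carrier K" "a \<noteq> \<zero>\<^bsub>K\<^esub>" "b \<in> carrier K" "b \<noteq> \<zero>\<^bsub>K\<^esub>" for a b
    using dv that by (simp add: discrete_valuation_def)
  have v1: "v \<one>\<^bsub>K\<^esub> = 0" using v[of "\<one>\<^bsub>K\<^esub>" "\<one>\<^bsub>K\<^esub>"] by simp
  have inv: "inv\<^bsub>K\<^esub> a \<in> carrier K" "inv\<^bsub>K\<^esub> a \<noteq> \<zero>\<^bsub>K\<^esub>" "inv\<^bsub>K\<^esub> a \<otimes>\<^bsub>K\<^esub> a = \<one>\<^bsub>K\<^esub>" "v (inv\<^bsub>K\<^esub> a) = - v a"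
    if a: "a \<in> carrier K" "a \<noteq> \<zero>\<^bsub>K\<^esub>" for a
  proof -
    have u: "a \<in> Units K" using a by (simp add: K.field_Units)
    then show *: "inv\<^bsub>K\<^esub> a \<in> carrier K" "inv\<^bsub>K\<^esub> a \<otimes>\<^bsub>K\<^esub> a = \<one>\<^bsub>K\<^esub>" by auto
    then show n: "inv\<^bsub>K\<^esub> a \<noteq> \<zero>\<^bsub>K\<^esub>" using a by force
    show "v (inv\<^bsub>K\<^esub> a) = - v a" using v[OF *(1) n a] *(2) v1 by simp
  qed
  let ?Y = "PIdl\<^bsub>?D\<^esub> y"
  have iY: "ideal ?Y ?D" using y(3) by (simp add: maximalideal_ideal)
  have nY: "\<one>\<^bsub>K\<^esub> \<notin> ?Y" using ideal.one_imp_carrier[OF iY] maximalideal.I_notcarr[OF y(3)] by auto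
  have "\<one>\<^bsub>K\<^esub> \<otimes>\<^bsub>K\<^esub> y \<in> ?Y" using subringE(3)[OF sub] by (auto simp: cgenideal_def)
  then have "y \<in> ?Y" using y(1) by simp
  then have "y \<in> D" using ideal_subset[OF iY] by auto
  then have vy: "v y \<ge> 0" using y(2) by (simp add: D)
  have "v y \<noteq> 0"
  proof
    assume "v y = 0"
    then have "inv\<^bsub>K\<^esub> y \<in> D" using inv[OF y(1,2)] by (simp add: D)
    then have "inv\<^bsub>K\<^esub> y \<otimes>\<^bsub>K\<^esub> y \<in> ?Y" by (auto simp: cgenideal_def)
    then show False using nY inv(3)[OF y(1,2)] by simp
  qed
  then have vy1: "v y \<ge> 1" using vy by simp
  have "1 \<in> v ` (carrier K - {\<zero>\<^bsub>K\<^esub>})" using dv by (simp add: discrete_valuation_def)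
  then obtain z where z: "z \<in> carrier K" "z \<noteq> \<zero>\<^bsub>K\<^esub>" "v z = 1" by (auto simp: image_iff)
  let ?Z = "PIdl\<^bsub>?D\<^esub> z"
  have zD: "z \<in> D" using z by (simp add: D)
  have iZ: "ideal ?Z ?D" using cring.cgenideal_ideal[OF cr] zD by simp
  have "v (y \<otimes>\<^bsub>K\<^esub> inv\<^bsub>K\<^esub> z) \<ge> 0" using v[OF y(1,2) inv(1,2)[OF z(1,2)]] inv(4)[OF z(1,2)] z vy1 by simp
  then have "y \<otimes>\<^bsub>K\<^esub> inv\<^bsub>K\<^esub> z \<in> D" using y inv[OF z(1,2)] by (simp add: D)
  then have "(y \<otimes>\<^bsub>K\<^esub> inv\<^bsub>K\<^esub> z) \<otimes>\<^bsub>K\<^esub> z \<in> ?Z" by (auto simp: cgenideal_def)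
  then have "y \<in> ?Z" using y(1) z inv[OF z(1,2)] by (simp add: K.m_assoc)
  then have "?Y \<subseteq> ?Z" by (rule ring.cgenideal_minimal[OF cring.axioms(1)[OF cr] iZ])
  moreover have "\<one>\<^bsub>?D\<^esub> \<notin> ?Z"
  proof
    assume "\<one>\<^bsub>?D\<^esub> \<in> ?Z"
    then obtain x where x: "x \<in> D" "\<one>\<^bsub>K\<^esub> = x \<otimes>\<^bsub>K\<^esub> z" by (auto simp: cgenideal_def)
    then have "x \<noteq> \<zero>\<^bsub>K\<^esub>" using z by auto
    then show False using v[of x z] x z v1 by (auto simp: D)
  qed
  ultimately have "?Z = ?Y" by (rule cring.maximalideal_eq[OF cr y(3) iZ])
  then have "z \<in> ?Y" using ring.cgenideal_self[OF cring.axioms(1)[OF cr], of z] zD by simp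
  then obtain x where x: "x \<in> D" "z = x \<otimes>\<^bsub>K\<^esub> y" by (auto simp: cgenideal_def)
  then have "x \<noteq> \<zero>\<^bsub>K\<^esub>" using z y by auto
  then have "v y \<le> 1" using v[of x y] x y z by (auto simp: D)
  then show ?thesis using vy1 by simp
qed

section \<open>Instantiation of the abstract pull-back by the valuation of the residue field\<close>

theorem proposition17:
  fixes C :: "('a, 'b) ring_scheme" and M :: "'a set" and q p :: 'a
    and D :: "'a set set" and A :: "('a, 'b) ring_scheme"
  assumes "sp_domain C" and "\<not> dedekind_domain C"
    and "q \<in> carrier C" and "M = PIdl\<^bsub>C\<^esub> q" and "maximalideal M C"
    and "dvr_of_field D (C Quot M)"
    and "p \<in> Units C"
    and "maximalideal (PIdl\<^bsub>(C Quot M)\<lparr>carrier := D\<rparr>\<^esub> (M +>\<^bsub>C\<^esub> p)) ((C Quot M)\<lparr>carrier := D\<rparr>)"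
    and "A = pullback C M D"
  shows "isp_domain A \<and> krull_dim A = 2 \<and> \<not> h_local A"
proof -
  interpret C: domain C using assms(1) by (rule sp_domain_domain)
  let ?K = "C Quot M"
  let ?c = "\<lambda>x. M +>\<^bsub>C\<^esub> x"
  have max: "maximalideal (PIdl\<^bsub>C\<^esub> q) C" using assms(4,5) by simp
  have iM: "ideal M C" using assms(5) by (simp add: maximalideal_ideal)
  have M1: "\<one>\<^bsub>C\<^esub> \<notin> M" using primeideal_notone[OF C.maximalideal_primeideal[OF assms(5)]] .
  \<comment> \<open>If \<open>q\<close> were zero, the zero ideal would be maximal and
    \<open>C\<close> a field, hence Dedekind.\<close>
  have "q \<noteq> \<zero>\<^bsub>C\<^esub>"
  proof
    assume q: "q = \<zero>\<^bsub>C\<^esub>"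
    have M0: "M = {\<zero>\<^bsub>C\<^esub>}" unfolding assms(4) q by (auto simp: cgenideal_def intro: exI[of _ "\<zero>\<^bsub>C\<^esub>"])
    have "dedekind_domain C"
    proof (rule C.dedekind_domainI[OF assms(1)])
      fix I assume I: "ideal I C" "I \<noteq> {\<zero>\<^bsub>C\<^esub>}"
      then have "I = carrier C"
        using maximalideal.I_maximal[OF assms(5) I(1)] M0 ideal_zero[OF I(1)] ideal_subset[OF I(1)] by auto
      then have "{N. maximalideal N C \<and> I \<subseteq> N} = {}"
        using primeideal_notone[OF C.maximalideal_primeideal] by blast
      then show "finite {N. maximalideal N C \<and> I \<subseteq> N}" by (simp only: finite.emptyI)
    qed
    then show False using assms(2) by blast
  qed
  obtain v where dv: "discrete_valuation ?K v" and D: "D = {x \<in> carrier ?K. x = \<zero>\<^bsub>?K\<^esub> \<or> v x \<ge> 0}"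
    using assms(6) unfolding dvr_of_field_def by blast
  have subD: "subring D ?K" using assms(6) by (rule dvr_of_field_subring)
  have K0: "\<zero>\<^bsub>?K\<^esub> = M" unfolding FactRing_def by (rule ring.select_convs(1))
  interpret c: ring_hom_ring C ?K ?c by (rule ideal.rcos_ring_hom_ring[OF iM])
  have zero_iff: "?c x = \<zero>\<^bsub>?K\<^esub> \<longleftrightarrow> x \<in> M" if "x \<in> carrier C" for x
    unfolding K0 using C.a_rcos_zero[OF iM, of x] ideal.rcos_const_imp_mem[OF iM that] by (rule iffI[rotated])
  let ?A0 = "{x \<in> carrier C. ?c x \<in> D}"
  have sub: "subring ?A0 C"
    using subringE[OF subD] by (intro C.subringI) auto
  have pc: "p \<in> carrier C" using assms(7) by auto
  have "p \<notin> M"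
  proof
    assume "p \<in> M"
    then have "p \<otimes>\<^bsub>C\<^esub> inv\<^bsub>C\<^esub> p \<in> M" using assms(7) iM by (intro ideal.I_r_closed) auto
    then show False using M1 assms(7) by simp
  qed
  then have vp: "v (?c p) = 1"
    using discrete_valuation_generator[OF dv D subD _ _ assms(8)] zero_iff[OF pc] pc by simp
  \<comment> \<open>The coset of an element of \<open>M\<close> is zero, where \<open>v\<close> is
    unspecified; this is why \<open>A0_def\<close> treats \<open>M\<close> separately.\<close>
  interpret V: valuation_pullback C q p "\<lambda>x. v (?c x)" ?A0
  proof (intro valuation_pullback.intro valuation_pullback_axioms.intro
      sp_domain_principal_maximal.intro sp_domain_principal_maximal_axioms.intro)
    show "domain C" by (rule C.domain_axioms)
    show "sp_domain C" by fact
    show "q \<in> carrier C" by fact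
    show "maximalideal (PIdl\<^bsub>C\<^esub> q) C" by fact
    show "q \<noteq> \<zero>\<^bsub>C\<^esub>" by fact
    show "?A0 = {x \<in> carrier C. x \<in> PIdl\<^bsub>C\<^esub> q \<or> v (?c x) \<ge> 0}"
      using zero_iff c.hom_closed unfolding D assms(4)[symmetric] by blast
    show "subring ?A0 C" by (rule sub)
    show "v (?c (x \<otimes>\<^bsub>C\<^esub> y)) = v (?c x) + v (?c y)"
      if "x \<in> carrier C - PIdl\<^bsub>C\<^esub> q" "y \<in> carrier C - PIdl\<^bsub>C\<^esub> q" for x y
    proof -
      have "?c x \<in> carrier ?K - {\<zero>\<^bsub>?K\<^esub>}" "?c y \<in> carrier ?K - {\<zero>\<^bsub>?K\<^esub>}"
        using that zero_iff c.hom_closed unfolding assms(4)[symmetric] by blast+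
      then have "v (?c x \<otimes>\<^bsub>?K\<^esub> ?c y) = v (?c x) + v (?c y)"
        using dv unfolding discrete_valuation_def by blast
      then show ?thesis using c.hom_mult that by simp
    qed
    show "v (?c (x \<oplus>\<^bsub>C\<^esub> m)) = v (?c x)" if x: "x \<in> carrier C - PIdl\<^bsub>C\<^esub> q" and m: "m \<in> PIdl\<^bsub>C\<^esub> q" for x m
    proof -
      have mM: "m \<in> M" "m \<in> carrier C" using m iM assms(4) by (auto intro: ideal.Icarr)
      have "?c (x \<oplus>\<^bsub>C\<^esub> m) = ?c x \<oplus>\<^bsub>?K\<^esub> ?c m" using x mM by simp
      also have "\<dots> = ?c x" using zero_iff[of m] mM x by simp
      finally show ?thesis by simp
    qed
    show "p \<in> Units C" by fact
    show "v (?c p) = 1" by fact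
  qed
  have "A = C\<lparr>carrier := ?A0\<rparr>" unfolding assms(9) pullback_def ..
  then show ?thesis
    using V.isp_domain_A V.krull_dim_A V.not_h_local_A[OF assms(2)] by simp
qed

end
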